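(* Let $k$ be a field and let $A$ be a fully RFD $k$-algebra. The functor $\widehat{(-)}$ from the category ${}_A\mathbf{Mod}_{fg}$ of finitely generated left $A$-modules to the category ${}_{A^\circ}\mathbf{Mod}_{\mathbf B}$ of modules over the ringed coalgebra $A^\circ$ satisfying condition (B) (defined in the context) is fully faithful, i.e. for all finitely generated left $A$-modules $M_1,M_2$ the map $$\widehat{(-)}:\mathrm{Hom}_{{}_A\mathbf{Mod}_{fg}}(M_1,M_2)\to\mathrm{Hom}_{{}_{A^\circ}\mathbf{Mod}_{\mathbf B}}(\widehat{M_1},\widehat{M_2}),\qquad f\mapsto\widehat f,$$ is bijective.
   Context: All vector spaces, unital associative algebras, coalgebras and tensor products are over $k$. For a coalgebra $(C,\Delta,\varepsilon)$, $C^*$ is an algebra via $(fg)(x)=(f\otimes g)(\Delta(x))$. For an algebra $A$, $A^\circ=\{\phi\in A^*:\ker\phi\text{ contains a two-sided ideal of finite codimension}\}$, a coalgebra with $\Delta(\phi)=\sum_i\psi_{1,i}\otimes\psi_{2,i}$ where $\phi(ab)=\sum_i\psi_{1,i}(a)\psi_{2,i}(b)$ and $\varepsilon(\phi)=\phi(1)$. $A$ is RFD if its two-sided ideals of finite codimension intersect in $0$ and fully RFD if every finitely generated left $A$-module is a subdirect product of finite-dimensional left $A$-modules. A left module over an algebra is RFD if its submodules of finite codimension intersect in $0$. Ringed coalgebra of $A$. For $S\subset A$, $Z^\circ(S)=\{\phi\in A^\circ:\phi(S)=0\}$. For a subcoalgebra $C\subset A^\circ$ let $a_C:A\to C^*$,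 $a_C(a)(\phi)=\phi(a)$; $\mathfrak F_C=\{I\subset A\text{ left ideal}: Z^\circ(I)\cap C=0\}$; $S_C=\{x\in C^*:\exists I\in\mathfrak F_C,\ a_C(I)x\subset a_C(A)\}$; $A_C\subset C^*$ the subalgebra generated by $S_C$. The ringed coalgebra associated to $A$ is $(A^\circ,Q_A,\mathcal A_A)$, where $Q_A=\{Z^\circ(I):I\subset A\text{ two-sided ideal}\}$ and $\mathcal A_A(C)=A_C$; for $C'\subset C$ the restriction $C^*\to C'^*$ induces $\rho^C_{C'}:A_C\to A_{C'}$. For $C=A^\circ$ one has $A_{A^\circ}=a_{A^\circ}(A)$, identified with $A$. Modules over $A^\circ$. A module over the ringed coalgebra $A^\circ$ is a contravariant functor $\mathcal F$ from the poset of subcoalgebras of $A^\circ$ to vector spaces, together with an RFD left $A_D$-module structure on each $\mathcal F(D)$, such that for $D'\subset D$ the restriction $\lambda^D_{D'}:\mathcal F(D)\to\mathcal F(D')$ satisfies $\lambda^D_{D'}(am)=\rho^D_{D'}(a)\lambda^D_{D'}(m)$. A morphism $\mathcal F_1\to\mathcal F_2$ is a natural transformation $\{f_D\}$ with each $f_D$ being $A_D$-linear. The category is ${}_{A^\circ}\mathbf{Mod}$. The global section functor is $\Gamma(\mathcal F)=\mathcal F(A^\circ)$, a left $A$-module. Finite duals. For a left module $M$ over an algebra $R$, $M^\circ=\{\phi\in M^*:\ker\phi\text{ contains an }R\text{-submodule of finite codimension}\}$; a homomorphism $f$ induces $f^\circ(\phi)=\phi\circ f$. For a left $A$-module $M$,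 $M^\circ$ is a left $A^\circ$-comodule with coaction $\rho(\phi)=\sum_i\psi_i\otimes\phi_i$ where $\phi(ax)=\sum_i\psi_i(a)\phi_i(x)$. For a subcoalgebra $C\subset A^\circ$, $C\,\square\,M^\circ=\{\phi\in M^\circ:\rho(\phi)\in C\otimes M^\circ\}$, a left $C$-comodule; its dual $(C\,\square\,M^\circ)^*$ is a left $C^*$-module via $(f\cdot g)(x)=(f\otimes g)(\rho(x))$. Let $m^M_C:M\to(C\,\square\,M^\circ)^*$ be evaluation, $T^M_C=\{x\in(C\,\square\,M^\circ)^*:\exists I\in\mathfrak F_C,\ a_C(I)x\subset m^M_C(M)\}$, and $M_C$ the $A_C$-submodule of $(C\,\square\,M^\circ)^*$ generated by $T^M_C$. The functor $\widehat{(-)}$. For $M$ finitely generated, $\widehat M$ is the module over $A^\circ$ given by $\widehat M(C)=M_C$ with restrictions induced by the dual maps of the inclusions $C'\,\square\,M^\circ\subset C\,\square\,M^\circ$. For $f:M\to M'$, $\widehat f_C:M_C\to M'_C$ is the restriction of the dual of $\mathrm{id}_C\,\square\,f^\circ:C\,\square\,M'^\circ\to C\,\square\,M^\circ$. Condition (B). Let $\mathcal F$ be a module over the ringed coalgebra $A^\circ$. For a subcoalgebra $C'\subset A^\circ$, the restriction $\lambda=\lambda^{A^\circ}_{C'}:\mathcal F(A^\circ)\to\mathcal F(C')$ has a finite dual $\lambda^\circ:\mathcal F(C')^\circ\to\mathcal F(A^\circ)^\circ$, which is corestricted to a map $l:\mathcal F(C')^\circ\to C'\,\square\,\mathcal F(A^\circ)^\circ$.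 Condition (B) says that for every subcoalgebra $C'\subset A^\circ$ the dual map $l^*:(C'\,\square\,\mathcal F(A^\circ)^\circ)^*\to(\mathcal F(C')^\circ)^*$ restricts to a homomorphism $\iota_{C'}:\Gamma(\mathcal F)_{C'}\to\mathcal F(C')$ of modules, where $\Gamma(\mathcal F)_{C'}\subset(C'\,\square\,\mathcal F(A^\circ)^\circ)^*$ is the module $M_{C'}$ for $M=\Gamma(\mathcal F)=\mathcal F(A^\circ)$, and $\mathcal F(C')$ is regarded as a subspace of $(\mathcal F(C')^\circ)^*$ by evaluation (injective because $\mathcal F(C')$ is RFD). ${}_{A^\circ}\mathbf{Mod}_{\mathbf B}$ is the full subcategory of ${}_{A^\circ}\mathbf{Mod}$ of modules satisfying (B).
   Formalization: M̂ need not satisfy (B) (e.g. A = M = k[x]), so that M̂ lies in the category of modules satisfying (B) is not claimed; bijectivity is proved for all finitely generated M₁, M₂ onto Hom of modules over A°, which is the Hom in the full subcategory whenever both M̂₁, M̂₂ satisfy (B). *)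

theory Defs
  imports "HOL-Algebra.Algebra" "HOL-Library.Function_Algebras"
begin

text \<open>
  The base field is a type \<open>'k::field\<close>. Algebras and modules are HOL-Algebra records: a
  \<open>'k\<close>-algebra is a \<open>('k, 'a) module\<close>, whose \<open>smult\<close> is the scalar action of \<open>'k\<close>, and a left
  module over an algebra with elements in \<open>'a\<close> is an \<open>('a, 'm) module\<close>, whose fields \<open>mult\<close> and
  \<open>one\<close> carry no meaning. (The HOL-Algebra locales \<open>module\<close> and \<open>algebra\<close> are for commutative
  rings only.) The zero algebra is allowed.
\<close>

section \<open>Algebras and left modules\<close>

locale kalgebra = ring A for A :: "('k::field, 'a) module" (structure) +
  assumes scl_closed: "x \<in> carrier A \<Longrightarrow> c \<odot> x \<in> carrier A"
    and scl_l_distr: "x \<in> carrier A \<Longrightarrow> (c + d) \<odot> x = c \<odot> x \<oplus> d \<odot> x"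
    and scl_r_distr: "x \<in> carrier A \<Longrightarrow> y \<in> carrier A \<Longrightarrow> c \<odot> (x \<oplus> y) = c \<odot> x \<oplus> c \<odot> y"
    and scl_assoc: "x \<in> carrier A \<Longrightarrow> (c * d) \<odot> x = c \<odot> (d \<odot> x)"
    and scl_one: "x \<in> carrier A \<Longrightarrow> 1 \<odot> x = x"
    and scl_mult_l: "x \<in> carrier A \<Longrightarrow> y \<in> carrier A \<Longrightarrow> (c \<odot> x) \<otimes> y = c \<odot> (x \<otimes> y)"
    and scl_mult_r: "x \<in> carrier A \<Longrightarrow> y \<in> carrier A \<Longrightarrow> x \<otimes> (c \<odot> y) = c \<odot> (x \<otimes> y)"

locale left_module = R?: ring R + M?: abelian_group M
  for R :: "('k::field, 'r) module" (structure) and M :: "('r, 'm) module" (structure) +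
  assumes act_closed: "a \<in> carrier R \<Longrightarrow> x \<in> carrier M \<Longrightarrow> a \<odot>\<^bsub>M\<^esub> x \<in> carrier M"
    and act_l_distr: "a \<in> carrier R \<Longrightarrow> b \<in> carrier R \<Longrightarrow> x \<in> carrier M \<Longrightarrow>
      (a \<oplus>\<^bsub>R\<^esub> b) \<odot>\<^bsub>M\<^esub> x = a \<odot>\<^bsub>M\<^esub> x \<oplus>\<^bsub>M\<^esub> b \<odot>\<^bsub>M\<^esub> x"
    and act_r_distr: "a \<in> carrier R \<Longrightarrow> x \<in> carrier M \<Longrightarrow> y \<in> carrier M \<Longrightarrow>
      a \<odot>\<^bsub>M\<^esub> (x \<oplus>\<^bsub>M\<^esub> y) = a \<odot>\<^bsub>M\<^esub> x \<oplus>\<^bsub>M\<^esub> a \<odot>\<^bsub>M\<^esub> y"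
    and act_assoc: "a \<in> carrier R \<Longrightarrow> b \<in> carrier R \<Longrightarrow> x \<in> carrier M \<Longrightarrow>
      (a \<otimes>\<^bsub>R\<^esub> b) \<odot>\<^bsub>M\<^esub> x = a \<odot>\<^bsub>M\<^esub> (b \<odot>\<^bsub>M\<^esub> x)"
    and act_one: "x \<in> carrier M \<Longrightarrow> \<one>\<^bsub>R\<^esub> \<odot>\<^bsub>M\<^esub> x = x"

text \<open>The left regular module of an algebra.\<close>

definition reg :: "('k::field, 'r) module \<Rightarrow> ('r, 'r) module" where
  "reg R = \<lparr>carrier = carrier R, monoid.mult = monoid.mult R, one = one R,
     ring.zero = ring.zero R, ring.add = ring.add R, smult = monoid.mult R\<rparr>"

text \<open>The vector space structure underlying a left module.\<close>

definition kscale :: "('k::field, 'r) module \<Rightarrow> ('r, 'm) module \<Rightarrow> 'k \<Rightarrow> 'm \<Rightarrow> 'm" where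
  "kscale R M c x = (c \<odot>\<^bsub>R\<^esub> \<one>\<^bsub>R\<^esub>) \<odot>\<^bsub>M\<^esub> x"

definition ksubspace :: "('k::field, 'r) module \<Rightarrow> ('r, 'm) module \<Rightarrow> 'm set \<Rightarrow> bool" where
  "ksubspace R M V \<longleftrightarrow> additive_subgroup V M \<and> (\<forall>c. \<forall>x\<in>V. kscale R M c x \<in> V)"

definition lsubmodule :: "('k::field, 'r) module \<Rightarrow> ('r, 'm) module \<Rightarrow> 'm set \<Rightarrow> bool" where
  "lsubmodule R M N \<longleftrightarrow> additive_subgroup N M \<and> (\<forall>a\<in>carrier R. \<forall>x\<in>N. a \<odot>\<^bsub>M\<^esub> x \<in> N)"

definition lspan :: "('k::field, 'r) module \<Rightarrow> ('r, 'm) module \<Rightarrow> 'm set \<Rightarrow> 'm set" where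
  "lspan R M S = \<Inter>{N. lsubmodule R M N \<and> S \<subseteq> N}"

definition fin_gen :: "('k::field, 'r) module \<Rightarrow> ('r, 'm) module \<Rightarrow> bool" where
  "fin_gen R M \<longleftrightarrow> (\<exists>S. finite S \<and> S \<subseteq> carrier M \<and> lspan R M S = carrier M)"

text \<open>\<open>N\<close> has finite codimension in \<open>M\<close>: finitely many elements span \<open>M\<close> over the field modulo \<open>N\<close>.\<close>

definition fin_codim :: "('k::field, 'r) module \<Rightarrow> ('r, 'm) module \<Rightarrow> 'm set \<Rightarrow> bool" where
  "fin_codim R M N \<longleftrightarrow>
     (\<exists>B. finite B \<and> B \<subseteq> carrier M \<and> \<Inter>{V. ksubspace R M V \<and> N \<union> B \<subseteq> V} = carrier M)"

definition fin_dim :: "('k::field, 'r) module \<Rightarrow> ('r, 'm) module \<Rightarrow> bool" where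
  "fin_dim R M \<longleftrightarrow> fin_codim R M {\<zero>\<^bsub>M\<^esub>}"

definition RFD_module :: "('k::field, 'r) module \<Rightarrow> ('r, 'm) module \<Rightarrow> bool" where
  "RFD_module R M \<longleftrightarrow> \<Inter>{N. lsubmodule R M N \<and> fin_codim R M N} = {\<zero>\<^bsub>M\<^esub>}"

definition lmod_hom ::
    "('k::field, 'r) module \<Rightarrow> ('r, 'm) module \<Rightarrow> ('r, 'n) module \<Rightarrow> ('m \<Rightarrow> 'n) set" where
  "lmod_hom R M N = {f \<in> carrier M \<rightarrow>\<^sub>E carrier N.
     (\<forall>x\<in>carrier M. \<forall>y\<in>carrier M. f (x \<oplus>\<^bsub>M\<^esub> y) = f x \<oplus>\<^bsub>N\<^esub> f y) \<and>
     (\<forall>a\<in>carrier R. \<forall>x\<in>carrier M. f (a \<odot>\<^bsub>M\<^esub> x) = a \<odot>\<^bsub>N\<^esub> f x)}"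

text \<open>
  A family of finite-dimensional modules \<open>N\<close> with surjections \<open>p : M \<rightarrow> N\<close> that are jointly
  injective is given as the set of its pairs \<open>(N, p)\<close>.

  A finitely generated module over \<open>A\<close> has at most as many elements as there are lists over \<open>A\<close>
  (send a list to the combination of the generators with these coefficients), so
  every finitely generated \<open>A\<close>-module, in particular every quotient of one, has an isomorphic copy
  with carrier in \<open>'a list\<close>; restricting to that type loses no generality.
\<close>

definition subdirect_product_of_fin_dim ::
    "('k::field, 'a) module \<Rightarrow> ('a, 'a list) module \<Rightarrow> bool" where
  "subdirect_product_of_fin_dim A M \<longleftrightarrow>
     (\<exists>P :: (('a, 'a list) module \<times> ('a list \<Rightarrow> 'a list)) set.
        (\<forall>(N, p)\<in>P. left_module A N \<and> fin_dim A N \<and> p \<in> lmod_hom A M N \<and>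
           p ` carrier M = carrier N) \<and>
        (\<forall>x\<in>carrier M. \<forall>y\<in>carrier M. (\<forall>(N, p)\<in>P. p x = p y) \<longrightarrow> x = y))"

definition fully_RFD :: "('k::field, 'a) module \<Rightarrow> bool" where
  "fully_RFD A \<longleftrightarrow> (\<forall>M :: ('a, 'a list) module.
     left_module A M \<and> fin_gen A M \<longrightarrow> subdirect_product_of_fin_dim A M)"


section \<open>Spaces of functions, duals and tensor products\<close>

text \<open>
  Functionals on a subset of a type are total functions that vanish outside that subset, so that
  dual spaces are linear subspaces of function spaces.
\<close>

definition fscale :: "'k::field \<Rightarrow> ('x \<Rightarrow> 'k) \<Rightarrow> 'x \<Rightarrow> 'k" where
  "fscale c f = (\<lambda>x. c * f x)"

global_interpretation fun_vs: vector_space "fscale :: 'k::field \<Rightarrow> ('x \<Rightarrow> 'k) \<Rightarrow> 'x \<Rightarrow> 'k"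
  by unfold_locales (simp_all add: fscale_def fun_eq_iff algebra_simps)

definition fdual :: "('x \<Rightarrow> 'k::field) set \<Rightarrow> (('x \<Rightarrow> 'k) \<Rightarrow> 'k) set" where
  "fdual V = {f. (\<forall>u\<in>V. \<forall>v\<in>V. f (u + v) = f u + f v) \<and>
     (\<forall>c. \<forall>v\<in>V. f (fscale c v) = c * f v) \<and> (\<forall>v. v \<notin> V \<longrightarrow> f v = 0)}"

definition mdual :: "('k::field, 'r) module \<Rightarrow> ('r, 'm) module \<Rightarrow> ('m \<Rightarrow> 'k) set" where
  "mdual R M = {\<phi>. (\<forall>x\<in>carrier M. \<forall>y\<in>carrier M. \<phi> (x \<oplus>\<^bsub>M\<^esub> y) = \<phi> x + \<phi> y) \<and>
     (\<forall>c. \<forall>x\<in>carrier M. \<phi> (kscale R M c x) = c * \<phi> x) \<and> (\<forall>x. x \<notin> carrier M \<longrightarrow> \<phi> x = 0)}"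

text \<open>
  For spaces \<open>V\<close> and \<open>W\<close> of functions on \<open>'x\<close> and \<open>'y\<close>, the tensor product of \<open>V\<close> and \<open>W\<close> is identified
  with its image under the canonical injection into the functions on \<open>'x \<times> 'y\<close>.
\<close>

definition pure_tensor :: "('x \<Rightarrow> 'k::field) \<Rightarrow> ('y \<Rightarrow> 'k) \<Rightarrow> 'x \<times> 'y \<Rightarrow> 'k" where
  "pure_tensor v w = (\<lambda>(x, y). v x * w y)"

definition tensor :: "('x \<Rightarrow> 'k::field) set \<Rightarrow> ('y \<Rightarrow> 'k) set \<Rightarrow> ('x \<times> 'y \<Rightarrow> 'k) set" where
  "tensor V W = fun_vs.span {pure_tensor v w | v w. v \<in> V \<and> w \<in> W}"

text \<open>The value \<open>(f \<otimes> g) t\<close> for \<open>f\<close> in the dual of \<open>V\<close>, \<open>g\<close> in the dual of \<open>W\<close> and a tensor \<open>t\<close>.\<close>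

definition tensor_app :: "('x \<Rightarrow> 'k::field) set \<Rightarrow> ('y \<Rightarrow> 'k) set \<Rightarrow>
    (('x \<Rightarrow> 'k) \<Rightarrow> 'k) \<Rightarrow> (('y \<Rightarrow> 'k) \<Rightarrow> 'k) \<Rightarrow> ('x \<times> 'y \<Rightarrow> 'k) \<Rightarrow> 'k" where
  "tensor_app V W f g t = (THE s. \<exists>ts. set ts \<subseteq> V \<times> W \<and>
     t = (\<Sum>(v, w)\<leftarrow>ts. pure_tensor v w) \<and> s = (\<Sum>(v, w)\<leftarrow>ts. f v * g w))"


text \<open>
  \<open>tensor_app\<close> does not depend on the chosen representation of the tensor.
\<close>

lemma fdual_sum_list:
  fixes V :: "('x \<Rightarrow> 'k::field) set"
  assumes V: "fun_vs.subspace V" and f: "f \<in> fdual V" and us: "set us \<subseteq> V \<times> UNIV"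
  shows "(\<Sum>(v, c)\<leftarrow>us. fscale c v) \<in> V \<and>
    f (\<Sum>(v, c)\<leftarrow>us. fscale c v) = (\<Sum>(v, c)\<leftarrow>us. c * f v)"
  using us
proof (induction us)
  case Nil
  have "(0 :: 'x \<Rightarrow> 'k) \<in> V" using V by (rule fun_vs.subspace_0)
  moreover from this have "f (fscale 0 0) = 0 * f 0" using f unfolding fdual_def by blast
  then have "f 0 = 0" by simp
  ultimately show ?case by (simp add: zero_fun_def)
next
  case (Cons u us)
  obtain v c where u: "u = (v, c)" by (cases u)
  have "v \<in> V" using Cons.prems u by auto
  then have 1: "fscale c v \<in> V" using V by (simp add: fun_vs.subspace_scale)
  have IH: "(\<Sum>(v, c)\<leftarrow>us. fscale c v) \<in> V"
    "f (\<Sum>(v, c)\<leftarrow>us. fscale c v) = (\<Sum>(v, c)\<leftarrow>us. c * f v)"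
    using Cons by auto
  have 2: "f (fscale c v) = c * f v"
    using f \<open>v \<in> V\<close> unfolding fdual_def by blast
  have "fscale c v + (\<Sum>(v, c)\<leftarrow>us. fscale c v) \<in> V"
    using V 1 IH(1) by (rule fun_vs.subspace_add)
  moreover have "f (fscale c v + (\<Sum>(v, c)\<leftarrow>us. fscale c v)) =
      f (fscale c v) + f (\<Sum>(v, c)\<leftarrow>us. fscale c v)"
    using f 1 IH(1) unfolding fdual_def by blast
  ultimately show ?case
    by (simp only: u list.map sum_list.Cons prod.case IH(2) 2 simp_thms)
qed

lemma tensor_app_sum_list:
  assumes V: "fun_vs.subspace V" and W: "fun_vs.subspace W"
    and f: "f \<in> fdual V" and g: "g \<in> fdual W" and ts: "set ts \<subseteq> V \<times> W"
  shows "tensor_app V W f g (\<Sum>(v, w)\<leftarrow>ts. pure_tensor v w) = (\<Sum>(v, w)\<leftarrow>ts. f v * g w)"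
proof -
  have key: "(\<Sum>(v, w)\<leftarrow>us. f v * g w) =
      f (\<lambda>x. g (\<lambda>y. (\<Sum>(v, w)\<leftarrow>us. pure_tensor v w) (x, y)))"
    if us: "set us \<subseteq> V \<times> W" for us
  proof -
    have 1: "(\<lambda>y. (\<Sum>(v, w)\<leftarrow>us. pure_tensor v w) (x, y)) =
        (\<Sum>(v, c)\<leftarrow>map (\<lambda>(v, w). (w, v x)) us. fscale c v)" for x
      by (induction us) (auto simp: fun_eq_iff fscale_def pure_tensor_def)
    have "g (\<lambda>y. (\<Sum>(v, w)\<leftarrow>us. pure_tensor v w) (x, y)) =
        (\<Sum>(v, c)\<leftarrow>map (\<lambda>(v, w). (w, v x)) us. c * g v)" for x
      unfolding 1 using us by (intro conjunct2[OF fdual_sum_list[OF W g]]) auto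
    also have "(\<Sum>(v, c)\<leftarrow>map (\<lambda>(v, w). (w, v x)) us. c * g v) =
        (\<Sum>(v, c)\<leftarrow>map (\<lambda>(v, w). (v, g w)) us. fscale c v) x" for x
      by (induction us) (auto simp: fscale_def)
    finally have 2: "(\<lambda>x. g (\<lambda>y. (\<Sum>(v, w)\<leftarrow>us. pure_tensor v w) (x, y))) =
        (\<Sum>(v, c)\<leftarrow>map (\<lambda>(v, w). (v, g w)) us. fscale c v)"
      by (simp add: fun_eq_iff)
    have 3: "f (\<Sum>(v, c)\<leftarrow>map (\<lambda>(v, w). (v, g w)) us. fscale c v) =
        (\<Sum>(v, c)\<leftarrow>map (\<lambda>(v, w). (v, g w)) us. c * f v)"
      using us by (intro conjunct2[OF fdual_sum_list[OF V f]]) auto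
    show ?thesis
      unfolding 2 3 by (induction us) (auto simp: mult.commute)
  qed
  show ?thesis
    unfolding tensor_app_def
  proof (rule the_equality)
    show "\<exists>us. set us \<subseteq> V \<times> W \<and>
        (\<Sum>(v, w)\<leftarrow>ts. pure_tensor v w) = (\<Sum>(v, w)\<leftarrow>us. pure_tensor v w) \<and>
        (\<Sum>(v, w)\<leftarrow>ts. f v * g w) = (\<Sum>(v, w)\<leftarrow>us. f v * g w)"
      using ts by blast
  next
    fix s
    assume "\<exists>us. set us \<subseteq> V \<times> W \<and>
        (\<Sum>(v, w)\<leftarrow>ts. pure_tensor v w) = (\<Sum>(v, w)\<leftarrow>us. pure_tensor v w) \<and>
        s = (\<Sum>(v, w)\<leftarrow>us. f v * g w)"
    then show "s = (\<Sum>(v, w)\<leftarrow>ts. f v * g w)" using key ts by auto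
  qed
qed


section \<open>The finite dual coalgebra and the ringed coalgebra of an algebra\<close>

definition findual_alg :: "('k::field, 'a) module \<Rightarrow> ('a \<Rightarrow> 'k) set" where
  "findual_alg A = {\<phi> \<in> mdual A (reg A).
     \<exists>I. ideal I A \<and> fin_codim A (reg A) I \<and> (\<forall>x\<in>I. \<phi> x = 0)}"

definition comult :: "('k::field, 'a) module \<Rightarrow> ('a \<Rightarrow> 'k) \<Rightarrow> 'a \<times> 'a \<Rightarrow> 'k" where
  "comult A \<phi> = (\<lambda>(a, b). if a \<in> carrier A \<and> b \<in> carrier A then \<phi> (a \<otimes>\<^bsub>A\<^esub> b) else 0)"

definition subcoalgebra :: "('k::field, 'a) module \<Rightarrow> ('a \<Rightarrow> 'k) set \<Rightarrow> bool" where
  "subcoalgebra A C \<longleftrightarrow> C \<subseteq> findual_alg A \<and> fun_vs.subspace C \<and>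
     (\<forall>\<phi>\<in>C. comult A \<phi> \<in> tensor C C)"

definition dual_alg ::
    "('k::field, 'a) module \<Rightarrow> ('a \<Rightarrow> 'k) set \<Rightarrow> ('k, ('a \<Rightarrow> 'k) \<Rightarrow> 'k) module" where
  "dual_alg A C = \<lparr>carrier = fdual C,
     monoid.mult = (\<lambda>f g \<phi>. if \<phi> \<in> C then tensor_app C C f g (comult A \<phi>) else 0),
     one = (\<lambda>\<phi>. if \<phi> \<in> C then \<phi> \<one>\<^bsub>A\<^esub> else 0),
     ring.zero = 0, ring.add = (+), smult = fscale\<rparr>"

definition ev_alg :: "('a \<Rightarrow> 'k::field) set \<Rightarrow> 'a \<Rightarrow> ('a \<Rightarrow> 'k) \<Rightarrow> 'k" where
  "ev_alg C a = (\<lambda>\<phi>. if \<phi> \<in> C then \<phi> a else 0)"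

definition Zo :: "('k::field, 'a) module \<Rightarrow> 'a set \<Rightarrow> ('a \<Rightarrow> 'k) set" where
  "Zo A S = {\<phi> \<in> findual_alg A. \<forall>s\<in>S. \<phi> s = 0}"

definition Fil :: "('k::field, 'a) module \<Rightarrow> ('a \<Rightarrow> 'k) set \<Rightarrow> 'a set set" where
  "Fil A C = {I. lsubmodule A (reg A) I \<and> Zo A I \<inter> C = {0}}"

definition S_set :: "('k::field, 'a) module \<Rightarrow> ('a \<Rightarrow> 'k) set \<Rightarrow> (('a \<Rightarrow> 'k) \<Rightarrow> 'k) set" where
  "S_set A C = {x \<in> fdual C. \<exists>I\<in>Fil A C. \<forall>a\<in>I.
     ev_alg C a \<otimes>\<^bsub>dual_alg A C\<^esub> x \<in> ev_alg C ` carrier A}"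

definition subalgebra :: "('k::field, 'r) module \<Rightarrow> 'r set \<Rightarrow> bool" where
  "subalgebra E B \<longleftrightarrow> subring B E \<and> (\<forall>c. \<forall>x\<in>B. c \<odot>\<^bsub>E\<^esub> x \<in> B)"

text \<open>The algebra \<open>A\<^sub>C\<close>, the structure algebra of the ringed coalgebra at \<open>C\<close>.\<close>

definition str_alg ::
    "('k::field, 'a) module \<Rightarrow> ('a \<Rightarrow> 'k) set \<Rightarrow> ('k, ('a \<Rightarrow> 'k) \<Rightarrow> 'k) module" where
  "str_alg A C = (dual_alg A C)
     \<lparr>carrier := \<Inter>{B. subalgebra (dual_alg A C) B \<and> S_set A C \<subseteq> B}\<rparr>"

definition restr :: "('x \<Rightarrow> 'k::field) set \<Rightarrow> (('x \<Rightarrow> 'k) \<Rightarrow> 'k) \<Rightarrow> ('x \<Rightarrow> 'k) \<Rightarrow> 'k" where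
  "restr V f = (\<lambda>\<phi>. if \<phi> \<in> V then f \<phi> else 0)"


section \<open>Modules over the ringed coalgebra\<close>

text \<open>
  \<open>sec F D\<close> is \<open>F(D)\<close> and \<open>res F D D'\<close> the restriction \<open>F(D) \<rightarrow> F(D')\<close>. Only subcoalgebras \<open>D\<close> matter;
  the values elsewhere are irrelevant.
\<close>

record ('k, 'a, 'v) rc_mod =
  sec :: "('a \<Rightarrow> 'k) set \<Rightarrow> (('a \<Rightarrow> 'k) \<Rightarrow> 'k, 'v) module"
  res :: "('a \<Rightarrow> 'k) set \<Rightarrow> ('a \<Rightarrow> 'k) set \<Rightarrow> 'v \<Rightarrow> 'v"

definition rc_module :: "('k::field, 'a) module \<Rightarrow> ('k, 'a, 'v) rc_mod \<Rightarrow> bool" where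
  "rc_module A F \<longleftrightarrow>
     (\<forall>D. subcoalgebra A D \<longrightarrow>
        left_module (str_alg A D) (sec F D) \<and> RFD_module (str_alg A D) (sec F D)) \<and>
     (\<forall>D D'. subcoalgebra A D \<and> subcoalgebra A D' \<and> D' \<subseteq> D \<longrightarrow>
        (\<forall>m\<in>carrier (sec F D). res F D D' m \<in> carrier (sec F D')) \<and>
        (\<forall>m\<in>carrier (sec F D). \<forall>n\<in>carrier (sec F D).
           res F D D' (m \<oplus>\<^bsub>sec F D\<^esub> n) = res F D D' m \<oplus>\<^bsub>sec F D'\<^esub> res F D D' n) \<and>
        (\<forall>c. \<forall>m\<in>carrier (sec F D). res F D D' (kscale (str_alg A D) (sec F D) c m) =
           kscale (str_alg A D') (sec F D') c (res F D D' m)) \<and>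
        (\<forall>a\<in>carrier (str_alg A D). \<forall>m\<in>carrier (sec F D).
           res F D D' (a \<odot>\<^bsub>sec F D\<^esub> m) = restr D' a \<odot>\<^bsub>sec F D'\<^esub> res F D D' m)) \<and>
     (\<forall>D. subcoalgebra A D \<longrightarrow> (\<forall>m\<in>carrier (sec F D). res F D D m = m)) \<and>
     (\<forall>D D' D''. subcoalgebra A D \<and> subcoalgebra A D' \<and> subcoalgebra A D'' \<and>
        D'' \<subseteq> D' \<and> D' \<subseteq> D \<longrightarrow>
        (\<forall>m\<in>carrier (sec F D). res F D' D'' (res F D D' m) = res F D D'' m))"

definition rc_hom :: "('k::field, 'a) module \<Rightarrow> ('k, 'a, 'v) rc_mod \<Rightarrow> ('k, 'a, 'w) rc_mod \<Rightarrow>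
    (('a \<Rightarrow> 'k) set \<Rightarrow> 'v \<Rightarrow> 'w) set" where
  "rc_hom A F G =
     {h \<in> (\<Pi>\<^sub>E D\<in>{D. subcoalgebra A D}. lmod_hom (str_alg A D) (sec F D) (sec G D)).
        \<forall>D D'. subcoalgebra A D \<and> subcoalgebra A D' \<and> D' \<subseteq> D \<longrightarrow>
          (\<forall>m\<in>carrier (sec F D). h D' (res F D D' m) = res G D D' (h D m))}"

text \<open>Global sections, an \<open>A\<close>-module through evaluation from \<open>A\<close> to \<open>A\<^sub>C\<close> for \<open>C\<close> the whole finite dual.\<close>

definition global_sec ::
    "('k::field, 'a) module \<Rightarrow> ('k, 'a, 'v) rc_mod \<Rightarrow> ('a, 'v) module" where
  "global_sec A F = (let E = sec F (findual_alg A) in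
     \<lparr>carrier = carrier E, monoid.mult = monoid.mult E, one = one E,
      ring.zero = ring.zero E, ring.add = ring.add E,
      smult = (\<lambda>a m. ev_alg (findual_alg A) a \<odot>\<^bsub>E\<^esub> m)\<rparr>)"


section \<open>Finite duals of modules and the functor\<close>

definition findual :: "('k::field, 'r) module \<Rightarrow> ('r, 'm) module \<Rightarrow> ('m \<Rightarrow> 'k) set" where
  "findual R M = {\<phi> \<in> mdual R M.
     \<exists>N. lsubmodule R M N \<and> fin_codim R M N \<and> (\<forall>x\<in>N. \<phi> x = 0)}"

definition pullback :: "('m, 'x) partial_object_scheme \<Rightarrow> ('m \<Rightarrow> 'n) \<Rightarrow> ('n \<Rightarrow> 'k::field) \<Rightarrow> 'm \<Rightarrow> 'k" where
  "pullback M f \<phi> = (\<lambda>x. if x \<in> carrier M then \<phi> (f x) else 0)"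

definition coact :: "('k::field, 'a) module \<Rightarrow> ('a, 'm) module \<Rightarrow> ('m \<Rightarrow> 'k) \<Rightarrow> 'a \<times> 'm \<Rightarrow> 'k" where
  "coact A M \<phi> = (\<lambda>(a, x). if a \<in> carrier A \<and> x \<in> carrier M then \<phi> (a \<odot>\<^bsub>M\<^esub> x) else 0)"

definition cotens ::
    "('k::field, 'a) module \<Rightarrow> ('a \<Rightarrow> 'k) set \<Rightarrow> ('a, 'm) module \<Rightarrow> ('m \<Rightarrow> 'k) set" where
  "cotens A C M = {\<phi> \<in> findual A M. coact A M \<phi> \<in> tensor C (findual A M)}"

definition cotens_dual :: "('k::field, 'a) module \<Rightarrow> ('a \<Rightarrow> 'k) set \<Rightarrow> ('a, 'm) module \<Rightarrow>
    (('a \<Rightarrow> 'k) \<Rightarrow> 'k, ('m \<Rightarrow> 'k) \<Rightarrow> 'k) module" where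
  "cotens_dual A C M = \<lparr>carrier = fdual (cotens A C M),
     monoid.mult = undefined, one = undefined, ring.zero = 0, ring.add = (+),
     smult = (\<lambda>f g \<phi>. if \<phi> \<in> cotens A C M
        then tensor_app C (cotens A C M) f g (coact A M \<phi>) else 0)\<rparr>"

definition ev_mod :: "('k::field, 'a) module \<Rightarrow> ('a \<Rightarrow> 'k) set \<Rightarrow> ('a, 'm) module \<Rightarrow>
    'm \<Rightarrow> ('m \<Rightarrow> 'k) \<Rightarrow> 'k" where
  "ev_mod A C M x = (\<lambda>\<phi>. if \<phi> \<in> cotens A C M then \<phi> x else 0)"

definition T_set :: "('k::field, 'a) module \<Rightarrow> ('a \<Rightarrow> 'k) set \<Rightarrow> ('a, 'm) module \<Rightarrow>
    (('m \<Rightarrow> 'k) \<Rightarrow> 'k) set" where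
  "T_set A C M = {x \<in> fdual (cotens A C M). \<exists>I\<in>Fil A C. \<forall>a\<in>I.
     ev_alg C a \<odot>\<^bsub>cotens_dual A C M\<^esub> x \<in> ev_mod A C M ` carrier M}"

text \<open>The \<open>A\<^sub>C\<close>-module \<open>M\<^sub>C\<close>.\<close>

definition loc :: "('k::field, 'a) module \<Rightarrow> ('a \<Rightarrow> 'k) set \<Rightarrow> ('a, 'm) module \<Rightarrow>
    (('a \<Rightarrow> 'k) \<Rightarrow> 'k, ('m \<Rightarrow> 'k) \<Rightarrow> 'k) module" where
  "loc A C M = (cotens_dual A C M)
     \<lparr>carrier := lspan (str_alg A C) (cotens_dual A C M) (T_set A C M)\<rparr>"

definition hat :: "('k::field, 'a) module \<Rightarrow> ('a, 'm) module \<Rightarrow>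
    ('k, 'a, ('m \<Rightarrow> 'k) \<Rightarrow> 'k) rc_mod" where
  "hat A M = \<lparr>sec = (\<lambda>C. loc A C M), res = (\<lambda>C C'. restr (cotens A C' M))\<rparr>"

definition hat_map :: "('k::field, 'a) module \<Rightarrow> ('a, 'm) module \<Rightarrow> ('a, 'n) module \<Rightarrow>
    ('m \<Rightarrow> 'n) \<Rightarrow> ('a \<Rightarrow> 'k) set \<Rightarrow> (('m \<Rightarrow> 'k) \<Rightarrow> 'k) \<Rightarrow> ('n \<Rightarrow> 'k) \<Rightarrow> 'k" where
  "hat_map A M M' f = (\<lambda>C\<in>{C. subcoalgebra A C}. \<lambda>\<xi>\<in>carrier (loc A C M).
     \<lambda>\<phi>. if \<phi> \<in> cotens A C M' then \<xi> (pullback M f \<phi>) else 0)"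


section \<open>Condition (B)\<close>

text \<open>
  The first conjunct says that \<open>l\<close> exists, i.e. that the finite dual of the restriction takes values
  in \<open>cotens A C' (global_sec A F)\<close>. An element \<open>m\<close> of \<open>F(C')\<close> is identified with evaluation at \<open>m\<close>, so
  the last line says that \<open>\<iota> \<xi>\<close> is \<open>l\<^sup>*(\<xi>)\<close>.
\<close>

definition cond_B :: "('k::field, 'a) module \<Rightarrow> ('k, 'a, 'v) rc_mod \<Rightarrow> bool" where
  "cond_B A F \<longleftrightarrow> (\<forall>C'. subcoalgebra A C' \<longrightarrow>
     (let G = global_sec A F;
          l = pullback G (res F (findual_alg A) C');
          Fd = findual (str_alg A C') (sec F C')
      in (\<forall>\<phi>\<in>Fd. l \<phi> \<in> cotens A C' G) \<and>
         (\<exists>\<iota>\<in>lmod_hom (str_alg A C') (loc A C' G) (sec F C').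
            \<forall>\<xi>\<in>carrier (loc A C' G). \<forall>\<phi>\<in>Fd. \<phi> (\<iota> \<xi>) = \<xi> (l \<phi>))))"

definition Mod_B :: "('k::field, 'a) module \<Rightarrow> ('k, 'a, 'v) rc_mod set" where
  "Mod_B A = {F. rc_module A F \<and> cond_B A F}"

text \<open>
  Morphisms of the full subcategory of modules satisfying (B): all morphisms, if both objects
  satisfy (B). Note that \<open>hat A M\<close> need not satisfy (B), because \<open>l\<close> need not exist: take \<open>A = M = k[x]\<close>
  and for \<open>C'\<close> the functionals that vanish on a nonzero radical ideal. Then \<open>A\<^sub>C\<close> for \<open>C = C'\<close> is
  (a copy of) \<open>A\<close>, and \<open>p \<mapsto> p'(0)\<close> is in its finite dual but not in \<open>C'\<close>.
\<close>

definition Mod_B_hom :: "('k::field, 'a) module \<Rightarrow> ('k, 'a, 'v) rc_mod \<Rightarrow> ('k, 'a, 'w) rc_mod \<Rightarrow>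
    (('a \<Rightarrow> 'k) set \<Rightarrow> 'v \<Rightarrow> 'w) set" where
  "Mod_B_hom A F G = {h \<in> rc_hom A F G. F \<in> Mod_B A \<and> G \<in> Mod_B A}"

end

theory Submission
  imports Defs
begin

text \<open>
  Write \<open>C \<box> M\<close> for the cotensor product \<open>cotens A C M\<close>, and \<open>\<langle>a\<rangle>\<close> for the functional \<open>ev_alg C a\<close> on \<open>C\<close>.
  The whole proof rests on one formula: for \<open>f\<close> in \<open>C\<^sup>*\<close> and \<open>\<xi>\<close> in the dual of \<open>C \<box> M\<close>,
  \<open>(f \<xi>)(\<phi>) = f (a \<mapsto> \<xi> (x \<mapsto> \<phi> (a x)))\<close> (\<open>dact_apply\<close>). It makes sense because \<open>C \<box> M\<close> is closed
  under the translations \<open>\<phi> \<mapsto> \<phi> (a _)\<close> and is a comodule over \<open>C\<close>, and it reduces the algebra and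
  module laws to associativity of the action of \<open>A\<close> on \<open>M\<close>.

  Two consequences carry the theorem.

  \<^item> Localised modules have no torsion with respect to \<open>Fil A C\<close> (\<open>Fil_torsion_free\<close>): if \<open>\<langle>a\<rangle> \<eta> = 0\<close>
    for all \<open>a\<close> in some \<open>I \<in> Fil A C\<close>, then for each \<open>\<phi>\<close> the function \<open>a \<mapsto> \<eta> (\<phi> (a _))\<close> lies in \<open>C\<close> and
    vanishes on \<open>I\<close>, hence is zero, and its value at \<open>1\<close> is \<open>\<eta> \<phi>\<close>. As some such \<open>I\<close> multiplies a given generator of
    \<open>loc A C M\<close> into the evaluations at elements of \<open>M\<close>, an \<open>A\<^sub>C\<close>-linear map between localised modules is
    determined by its values on these evaluations (\<open>loc_hom_unique\<close>).

  \<^item> If \<open>A\<close> is fully RFD, then at the whole finite dual nothing is added by localisation. A proper left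
    ideal \<open>I\<close> is contained in a proper left ideal of finite codimension, because \<open>A / I\<close> is a subdirect
    product of finite-dimensional modules; so some nonzero element of the finite dual vanishes on \<open>I\<close>,
    and \<open>Fil A (findual_alg A)\<close> consists of \<open>A\<close> alone (\<open>Fil_findual_alg\<close>). Hence
    \<open>loc A (findual_alg A) M\<close> is the set of evaluations at elements of \<open>M\<close> (\<open>loc_findual_alg\<close>), and for
    finitely generated \<open>M\<close> evaluation is injective (\<open>ev_mod_inject\<close>).

  Faithfulness is read off from the component at the whole finite dual. Conversely, that component of a
  morphism \<open>h\<close> is an \<open>A\<close>-linear map \<open>f : M\<^sub>1 \<rightarrow> M\<^sub>2\<close>; by naturality \<open>h\<close> and the morphism induced by \<open>f\<close>
  agree on evaluations over every subcoalgebra, hence are equal.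

  That a localised module is RFD holds because the coaction sends \<open>\<phi>\<close> to a finite sum
  \<open>\<Sum> c\<^sub>i \<otimes> \<phi>\<^sub>i\<close>: the elements that vanish on all translates of \<open>\<phi>\<close> form a submodule, and it contains the
  common kernel of the finitely many evaluations at the \<open>\<phi>\<^sub>i\<close>.
\<close>

section \<open>Tensors as functions of two variables\<close>

lemma sum_list_pure_tensor_apply:
  "(\<Sum>(v, w)\<leftarrow>ts. pure_tensor v w) (x, y) = (\<Sum>(v, w)\<leftarrow>ts. v x * w y)"
  by (induction ts) (auto simp: pure_tensor_def)

lemma tensor_sum_list:
  assumes "set ts \<subseteq> V \<times> W"
  shows "(\<Sum>(v, w)\<leftarrow>ts. pure_tensor v w) \<in> tensor V W"
  using assms
proof (induction ts)
  case Nil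
  show ?case using fun_vs.subspace_0[OF fun_vs.subspace_span] by (simp only: tensor_def list.map sum_list.Nil)
next
  case (Cons p ts)
  obtain v w where p: "p = (v, w)" by (cases p)
  have "pure_tensor v w \<in> tensor V W"
    using Cons.prems p unfolding tensor_def by (intro fun_vs.span_base) auto
  moreover have "(\<Sum>(v, w)\<leftarrow>ts. pure_tensor v w) \<in> tensor V W" using Cons by auto
  ultimately show ?case unfolding tensor_def p list.map sum_list.Cons prod.case by (rule fun_vs.span_add)
qed

lemma tensor_listE:
  assumes V: "fun_vs.subspace V" and t: "t \<in> tensor V W"
  obtains ts where "set ts \<subseteq> V \<times> W" "t = (\<Sum>(v, w)\<leftarrow>ts. pure_tensor v w)"
proof -
  have "\<exists>ts. set ts \<subseteq> V \<times> W \<and> t = (\<Sum>(v, w)\<leftarrow>ts. pure_tensor v w)"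
    using t unfolding tensor_def
  proof (induction rule: fun_vs.span_induct_alt)
    case base
    show ?case by (rule exI[of _ "[]"]) simp
  next
    case (step c x y)
    then obtain v w ts where x: "x = pure_tensor v w" "v \<in> V" "w \<in> W"
      and ts: "set ts \<subseteq> V \<times> W" "y = (\<Sum>(v, w)\<leftarrow>ts. pure_tensor v w)" by blast
    have "fscale c x = pure_tensor (fscale c v) w"
      by (auto simp: x pure_tensor_def fscale_def fun_eq_iff)
    moreover have "fscale c v \<in> V" using V x by (simp add: fun_vs.subspace_scale)
    ultimately show ?case using x ts by (intro exI[of _ "(fscale c v, w) # ts"]) auto
  qed
  then show ?thesis using that by blast
qed

lemma subspace_sum_list:
  assumes "fun_vs.subspace V" "\<And>p. p \<in> set ps \<Longrightarrow> F p \<in> V"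
  shows "(\<lambda>x. \<Sum>p\<leftarrow>ps. c p * F p x) \<in> V"
  using assms(2)
proof (induction ps)
  case Nil
  then show ?case using fun_vs.subspace_0[OF assms(1)] by (simp add: zero_fun_def)
next
  case (Cons p ps)
  have "fscale (c p) (F p) + (\<lambda>x. \<Sum>p\<leftarrow>ps. c p * F p x) \<in> V"
    using Cons assms(1) by (intro fun_vs.subspace_add fun_vs.subspace_scale) auto
  then show ?case by (simp add: fscale_def plus_fun_def)
qed

lemma fscale_apply [simp]: "fscale c f x = c * f x"
  by (simp add: fscale_def)

lemma fdual_add: "f \<in> fdual V \<Longrightarrow> u \<in> V \<Longrightarrow> v \<in> V \<Longrightarrow> f (u + v) = f u + f v"
  by (simp add: fdual_def)

lemma fdual_scale: "f \<in> fdual V \<Longrightarrow> v \<in> V \<Longrightarrow> f (fscale c v) = c * f v"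
  by (simp add: fdual_def)

lemma fdual_outside: "f \<in> fdual V \<Longrightarrow> v \<notin> V \<Longrightarrow> f v = 0"
  by (simp add: fdual_def)

lemma fdual_0:
  assumes "f \<in> fdual V" shows "f 0 = 0"
proof (cases "0 \<in> V")
  case True
  then have "f (fscale 0 0) = 0 * f 0" using assms by (rule fdual_scale[rotated])
  then show ?thesis by simp
qed (use assms fdual_outside in blast)

lemma fdual_subspace: "fun_vs.subspace (fdual V)"
  by (rule fun_vs.subspaceI) (auto simp: fdual_def fscale_def algebra_simps)

text \<open>Linearity in the form in which slices of a tensor appear, with coefficients and vectors indexed
  by the same list.\<close>

lemma fdual_sum_list':
  assumes V: "fun_vs.subspace V" and f: "f \<in> fdual V" and F: "\<And>p. p \<in> set ps \<Longrightarrow> F p \<in> V"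
  shows "f (\<lambda>x. \<Sum>p\<leftarrow>ps. c p * F p x) = (\<Sum>p\<leftarrow>ps. c p * f (F p))"
  using F
proof (induction ps)
  case Nil
  then show ?case using fdual_0[OF f] by (simp add: zero_fun_def)
next
  case (Cons p ps)
  have 1: "(\<lambda>x. \<Sum>p\<leftarrow>p # ps. c p * F p x) = fscale (c p) (F p) + (\<lambda>x. \<Sum>p\<leftarrow>ps. c p * F p x)"
    by (simp add: fscale_def plus_fun_def)
  have "F p \<in> V" using Cons by simp
  moreover have "(\<lambda>x. \<Sum>p\<leftarrow>ps. c p * F p x) \<in> V"
    using Cons V by (intro subspace_sum_list) auto
  ultimately show ?case
    unfolding 1 using Cons V
    by (simp add: fdual_add[OF f] fdual_scale[OF f] fun_vs.subspace_scale)
qed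

lemma tensor_slice:
  assumes V: "fun_vs.subspace V" and W: "fun_vs.subspace W" and t: "t \<in> tensor V W"
  shows "(\<lambda>y. t (x, y)) \<in> W"
proof -
  obtain ts where ts: "set ts \<subseteq> V \<times> W" "t = (\<Sum>(v, w)\<leftarrow>ts. pure_tensor v w)"
    using tensor_listE[OF V t] .
  have "(\<lambda>y. t (x, y)) = (\<lambda>y. \<Sum>p\<leftarrow>ts. fst p x * snd p y)"
    by (simp add: ts sum_list_pure_tensor_apply) (simp add: split_def)
  also have "\<dots> \<in> W" using ts W by (intro subspace_sum_list) auto
  finally show ?thesis .
qed

text \<open>With a tensor seen as a function of two variables, \<open>f \<otimes> g\<close> is applied one variable at a
  time: \<open>g\<close> is linear, so it can be moved inside a finite sum of pure tensors.\<close>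

lemma tensor_contract:
  assumes V: "fun_vs.subspace V" and W: "fun_vs.subspace W" and t: "t \<in> tensor V W"
    and g: "g \<in> fdual W"
  shows "(\<lambda>x. g (\<lambda>y. t (x, y))) \<in> V"
    and "f \<in> fdual V \<Longrightarrow> tensor_app V W f g t = f (\<lambda>x. g (\<lambda>y. t (x, y)))"
proof -
  obtain ts where ts: "set ts \<subseteq> V \<times> W" "t = (\<Sum>(v, w)\<leftarrow>ts. pure_tensor v w)"
    using tensor_listE[OF V t] .
  have "g (\<lambda>y. t (x, y)) = g (\<lambda>y. \<Sum>p\<leftarrow>ts. fst p x * snd p y)" for x
    by (simp add: ts sum_list_pure_tensor_apply) (simp add: split_def)
  also have "\<And>x. g (\<lambda>y. \<Sum>p\<leftarrow>ts. fst p x * snd p y) = (\<Sum>p\<leftarrow>ts. fst p x * g (snd p))"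
    using ts by (intro fdual_sum_list'[OF W g]) auto
  finally have 1: "(\<lambda>x. g (\<lambda>y. t (x, y))) = (\<lambda>x. \<Sum>p\<leftarrow>ts. g (snd p) * fst p x)"
    by (simp add: mult.commute)
  show "(\<lambda>x. g (\<lambda>y. t (x, y))) \<in> V"
    unfolding 1 using ts V by (intro subspace_sum_list) auto
  assume f: "f \<in> fdual V"
  have "tensor_app V W f g t = (\<Sum>p\<leftarrow>ts. g (snd p) * f (fst p))"
    using tensor_app_sum_list[OF V W f g ts(1)] ts(2) by (simp add: split_def mult.commute)
  also have "\<dots> = f (\<lambda>x. \<Sum>p\<leftarrow>ts. g (snd p) * fst p x)"
    using ts by (intro fdual_sum_list'[OF V f, symmetric]) auto
  finally show "tensor_app V W f g t = f (\<lambda>x. g (\<lambda>y. t (x, y)))" by (simp add: 1)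
qed

text \<open>This is what makes a cotensor product a comodule: the second factors of a tensor may be replaced by
  combinations of its slices. In a sum of \<open>n\<close> pure tensors, a point \<open>x\<^sub>0\<close> at which one of the first
  factors does not vanish lets the corresponding second factor be expressed by the slice at \<open>x\<^sub>0\<close> and the
  others, which leaves a sum of \<open>n - 1\<close> pure tensors.\<close>

lemma tensor_shrink_right:
  fixes V :: "('x \<Rightarrow> 'k::field) set" and W W' :: "('y \<Rightarrow> 'k) set"
  assumes V: "fun_vs.subspace V" and W': "fun_vs.subspace W'" and t: "t \<in> tensor V W"
    and sl: "\<And>x. (\<lambda>y. t (x, y)) \<in> W'"
  shows "t \<in> tensor V W'"
proof -
  have *: "(\<Sum>(v, w)\<leftarrow>ts. pure_tensor v w) \<in> tensor V W'"
    if "set ts \<subseteq> V \<times> UNIV" "\<And>x. (\<lambda>y. \<Sum>(v, w)\<leftarrow>ts. v x * w y) \<in> W'"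
    for ts :: "(('x \<Rightarrow> 'k) \<times> ('y \<Rightarrow> 'k)) list"
    using that
  proof (induction "length ts" arbitrary: ts)
    case 0
    then show ?case by (intro tensor_sum_list) simp
  next
    case (Suc n)
    then obtain v w us where ts: "ts = (v, w) # us" by (cases ts) auto
    show ?case
    proof (cases "v = 0")
      case True
      then have "pure_tensor v w = 0" by (auto simp: pure_tensor_def)
      then have "(\<Sum>(v, w)\<leftarrow>ts. pure_tensor v w) = (\<Sum>(v, w)\<leftarrow>us. pure_tensor v w)"
        by (simp add: ts)
      moreover have "(\<Sum>(v, w)\<leftarrow>us. pure_tensor v w) \<in> tensor V W'"
      proof (rule Suc.hyps(1))
        show "(\<lambda>y. \<Sum>(v, w)\<leftarrow>us. v x * w y) \<in> W'" for x
          using Suc.prems(2)[of x] True by (simp add: ts)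
      qed (use Suc ts in auto)
      ultimately show ?thesis by simp
    next
      case False
      then obtain x0 where x0: "v x0 \<noteq> 0" by (auto simp: fun_eq_iff)
      define w0 where "w0 = (\<lambda>y. \<Sum>(v, w)\<leftarrow>ts. v x0 * w y)"
      have w0: "w0 \<in> W'" unfolding w0_def by (rule Suc.prems(2))
      define v' where "v' = fscale (inverse (v x0)) v"
      have v': "v' \<in> V" using Suc.prems V by (auto simp: v'_def ts fun_vs.subspace_scale)
      define us' where "us' = map (\<lambda>(u, z). (u - fscale (u x0) v', z)) us"
      have us': "set us' \<subseteq> V \<times> UNIV"
        using Suc.prems(1) V v'
        by (auto simp: us'_def ts intro!: fun_vs.subspace_diff fun_vs.subspace_scale)
      \<comment> \<open>Solving the slice at \<open>x0\<close> for \<open>w\<close> removes one summand.\<close>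
      have split: "(\<Sum>(v, w)\<leftarrow>ts. v x * w y) = v' x * w0 y + (\<Sum>(v, w)\<leftarrow>us'. v x * w y)" for x y
      proof -
        have "(\<Sum>(v, w)\<leftarrow>us'. v x * w y) =
            (\<Sum>(v, w)\<leftarrow>us. v x * w y) - v' x * (\<Sum>(v, w)\<leftarrow>us. v x0 * w y)"
          unfolding us'_def by (induction us) (auto simp: fscale_def algebra_simps)
        moreover have "v' x * (v x0 * w y) = v x * w y"
          using x0 by (simp add: v'_def fscale_def)
        ultimately show ?thesis by (auto simp: w0_def ts algebra_simps)
      qed
      have "(\<Sum>(v, w)\<leftarrow>us'. pure_tensor v w) \<in> tensor V W'"
      proof (rule Suc.hyps(1)[OF _ us'])
        show "n = length us'" using Suc.hyps(2) by (simp add: us'_def ts)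
        fix x
        have "(\<lambda>y. \<Sum>(v, w)\<leftarrow>us'. v x * w y) =
            (\<lambda>y. \<Sum>(v, w)\<leftarrow>ts. v x * w y) - fscale (v' x) w0"
          by (auto simp: split fscale_def fun_eq_iff)
        also have "\<dots> \<in> W'"
          by (intro fun_vs.subspace_diff[OF W'] fun_vs.subspace_scale[OF W'] Suc.prems(2) w0)
        finally show "(\<lambda>y. \<Sum>(v, w)\<leftarrow>us'. v x * w y) \<in> W'" .
      qed
      moreover have "pure_tensor v' w0 \<in> tensor V W'"
        using tensor_sum_list[of "[(v', w0)]" V W'] v' w0 by simp
      moreover have "(\<Sum>(v, w)\<leftarrow>ts. pure_tensor v w) =
          pure_tensor v' w0 + (\<Sum>(v, w)\<leftarrow>us'. pure_tensor v w)"
        by (rule ext) (simp add: split_paired_all sum_list_pure_tensor_apply split, simp add: pure_tensor_def)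
      ultimately show ?thesis by (simp add: tensor_def fun_vs.span_add)
    qed
  qed
  obtain ts where ts: "set ts \<subseteq> V \<times> W" "t = (\<Sum>(v, w)\<leftarrow>ts. pure_tensor v w)"
    using tensor_listE[OF V t] .
  show ?thesis
    unfolding ts(2)
  proof (rule *)
    show "(\<lambda>y. \<Sum>(v, w)\<leftarrow>ts. v x * w y) \<in> W'" for x
      using sl[of x] by (simp add: ts(2) sum_list_pure_tensor_apply)
  qed (use ts in auto)
qed

text \<open>The functions \<open>\<alpha>\<close> and \<open>\<beta>\<close> are there to cut off the values outside a carrier, where functionals
  are zero by convention; \<open>p\<close> and \<open>q\<close> will be a multiplication in the algebra or a module
  homomorphism.\<close>

lemma tensor_reindex:
  assumes V: "fun_vs.subspace V" and t: "t \<in> tensor V W"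
    and p: "\<And>v. v \<in> V \<Longrightarrow> (\<lambda>x. \<alpha> x * v (p x)) \<in> V'"
    and q: "\<And>w. w \<in> W \<Longrightarrow> (\<lambda>y. \<beta> y * w (q y)) \<in> W'"
  shows "(\<lambda>(x, y). \<alpha> x * \<beta> y * t (p x, q y)) \<in> tensor V' W'"
proof -
  obtain ts where ts: "set ts \<subseteq> V \<times> W" "t = (\<Sum>(v, w)\<leftarrow>ts. pure_tensor v w)"
    using tensor_listE[OF V t] .
  define us where "us = map (\<lambda>(v, w). (\<lambda>x. \<alpha> x * v (p x), \<lambda>y. \<beta> y * w (q y))) ts"
  have "(\<Sum>(v, w)\<leftarrow>us. v x * w y) = \<alpha> x * \<beta> y * (\<Sum>(v, w)\<leftarrow>ts. v (p x) * w (q y))" for x y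
    unfolding us_def by (induction ts) (auto simp: algebra_simps)
  then have "(\<lambda>(x, y). \<alpha> x * \<beta> y * t (p x, q y)) = (\<Sum>(v, w)\<leftarrow>us. pure_tensor v w)"
    by (auto simp: fun_eq_iff ts(2) sum_list_pure_tensor_apply)
  also have "\<dots> \<in> tensor V' W'"
    using ts p q by (intro tensor_sum_list) (auto simp: us_def)
  finally show ?thesis .
qed

lemma tensor_mono: "V \<subseteq> V' \<Longrightarrow> W \<subseteq> W' \<Longrightarrow> tensor V W \<subseteq> tensor V' W'"
  unfolding tensor_def by (intro fun_vs.span_mono) blast

lemma tensor_subspace: "fun_vs.subspace (tensor V W)"
  by (simp add: tensor_def)

lemma restr_fdual:
  assumes "f \<in> fdual V" "fun_vs.subspace W" "W \<subseteq> V"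
  shows "restr W f \<in> fdual W"
  using assms by (auto simp: fdual_def restr_def fun_vs.subspace_add fun_vs.subspace_scale subset_iff)

section \<open>Modules of finite codimension\<close>

locale kmodule = left_module R M + kalgebra R
  for R :: "('k::field, 'r) module" (structure) and M :: "('r, 'm) module"
begin

abbreviation madd (infixl "\<oplus>\<^sub>M" 65) where "x \<oplus>\<^sub>M y \<equiv> x \<oplus>\<^bsub>M\<^esub> y"
abbreviation mzero ("\<zero>\<^sub>M") where "\<zero>\<^sub>M \<equiv> \<zero>\<^bsub>M\<^esub>"
abbreviation mact (infixr "\<triangleright>" 75) where "a \<triangleright> x \<equiv> a \<odot>\<^bsub>M\<^esub> x"
abbreviation mscale (infixr "\<bullet>" 75) where "c \<bullet> x \<equiv> kscale R M c x"

lemma scl_one_closed: "c \<odot> \<one> \<in> carrier R" by (simp add: scl_closed)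

lemma kscale_closed [simp, intro]: "x \<in> carrier M \<Longrightarrow> c \<bullet> x \<in> carrier M"
  by (simp add: kscale_def act_closed scl_one_closed)

lemma kscale_add: "x \<in> carrier M \<Longrightarrow> (c + d) \<bullet> x = c \<bullet> x \<oplus>\<^sub>M d \<bullet> x"
  by (simp add: kscale_def scl_l_distr act_l_distr scl_one_closed)

lemma kscale_distrib: "x \<in> carrier M \<Longrightarrow> y \<in> carrier M \<Longrightarrow> c \<bullet> (x \<oplus>\<^sub>M y) = c \<bullet> x \<oplus>\<^sub>M c \<bullet> y"
  by (simp add: kscale_def act_r_distr scl_one_closed)

lemma kscale_kscale: "x \<in> carrier M \<Longrightarrow> c \<bullet> d \<bullet> x = (c * d) \<bullet> x"
  by (simp add: kscale_def scl_one_closed scl_mult_l scl_assoc flip: act_assoc)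

lemma kscale_one: "x \<in> carrier M \<Longrightarrow> 1 \<bullet> x = x"
  by (simp add: kscale_def scl_one act_one)

lemma act_kscale: "a \<in> carrier R \<Longrightarrow> x \<in> carrier M \<Longrightarrow> a \<triangleright> c \<bullet> x = c \<bullet> a \<triangleright> x"
  by (simp add: kscale_def scl_one_closed scl_mult_l scl_mult_r flip: act_assoc)

lemma scl_act: "a \<in> carrier R \<Longrightarrow> x \<in> carrier M \<Longrightarrow> (c \<odot> a) \<triangleright> x = c \<bullet> a \<triangleright> x"
  by (simp add: kscale_def scl_one_closed scl_mult_l flip: act_assoc)

lemma act_zero_left: assumes "x \<in> carrier M" shows "\<zero> \<triangleright> x = \<zero>\<^sub>M"
proof -
  have "\<zero> \<triangleright> x \<oplus>\<^sub>M \<zero> \<triangleright> x = \<zero> \<triangleright> x \<oplus>\<^sub>M \<zero>\<^sub>M"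
    using act_l_distr[of \<zero> \<zero> x] assms by (simp add: act_closed)
  then show ?thesis using assms act_closed M.add.l_cancel by blast
qed

lemma act_zero_right: assumes "a \<in> carrier R" shows "a \<triangleright> \<zero>\<^sub>M = \<zero>\<^sub>M"
proof -
  have "a \<triangleright> \<zero>\<^sub>M \<oplus>\<^sub>M a \<triangleright> \<zero>\<^sub>M = a \<triangleright> \<zero>\<^sub>M \<oplus>\<^sub>M \<zero>\<^sub>M"
    using act_r_distr[of a "\<zero>\<^sub>M" "\<zero>\<^sub>M"] assms by (simp add: act_closed)
  then show ?thesis using assms act_closed M.add.l_cancel by blast
qed

lemma kscale_zero: "x \<in> carrier M \<Longrightarrow> 0 \<bullet> x = \<zero>\<^sub>M"
proof -
  assume x: "x \<in> carrier M"
  have "0 \<bullet> x \<oplus>\<^sub>M 0 \<bullet> x = 0 \<bullet> x \<oplus>\<^sub>M \<zero>\<^sub>M"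
    using kscale_add[OF x, of 0 0] x by simp
  then show ?thesis using x M.add.l_cancel by blast
qed

lemma kscale_minus: assumes "x \<in> carrier M" shows "(-1) \<bullet> x = \<ominus>\<^bsub>M\<^esub> x"
proof -
  have "(-1) \<bullet> x \<oplus>\<^sub>M x = \<zero>\<^sub>M"
    using kscale_add[OF assms, of "-1" 1] assms by (simp add: kscale_one kscale_zero)
  then show ?thesis using assms M.minus_equality by (metis kscale_closed M.a_comm)
qed

lemma act_minus_one: assumes "x \<in> carrier M" shows "(\<ominus> \<one>) \<triangleright> x = \<ominus>\<^bsub>M\<^esub> x"
proof -
  have "(\<ominus> \<one>) \<triangleright> x \<oplus>\<^sub>M x = (\<ominus> \<one> \<oplus> \<one>) \<triangleright> x"
    using assms by (simp add: act_l_distr act_one)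
  also have "\<dots> = \<zero>\<^sub>M" using assms by (simp add: R.l_neg act_zero_left)
  finally show ?thesis using assms M.minus_equality by (metis act_closed M.a_comm R.one_closed R.a_inv_closed)
qed

lemma ksubspaceI:
  assumes "V \<subseteq> carrier M" "\<zero>\<^sub>M \<in> V" "\<And>x y. x \<in> V \<Longrightarrow> y \<in> V \<Longrightarrow> x \<oplus>\<^sub>M y \<in> V"
    "\<And>c x. x \<in> V \<Longrightarrow> c \<bullet> x \<in> V"
  shows "ksubspace R M V"
proof -
  have "\<ominus>\<^bsub>M\<^esub> x \<in> V" if "x \<in> V" for x
    using that assms kscale_minus[of x] by (metis subsetD)
  then have "subgroup V (add_monoid M)"
    using assms by (intro M.add.subgroupI) (auto simp: a_inv_def)
  then show ?thesis using assms(4) by (simp add: ksubspace_def additive_subgroup_def)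
qed

lemma lsubmoduleI:
  assumes "V \<subseteq> carrier M" "\<zero>\<^sub>M \<in> V" "\<And>x y. x \<in> V \<Longrightarrow> y \<in> V \<Longrightarrow> x \<oplus>\<^sub>M y \<in> V"
    "\<And>a x. a \<in> carrier R \<Longrightarrow> x \<in> V \<Longrightarrow> a \<triangleright> x \<in> V"
  shows "lsubmodule R M V"
proof -
  have "\<ominus>\<^bsub>M\<^esub> x \<in> V" if "x \<in> V" for x
    using that assms act_minus_one[of x] by (metis subsetD R.one_closed R.a_inv_closed)
  then have "subgroup V (add_monoid M)"
    using assms by (intro M.add.subgroupI) (auto simp: a_inv_def)
  then show ?thesis using assms(4) by (simp add: lsubmodule_def additive_subgroup_def)
qed

lemma ksubspaceD:
  assumes "ksubspace R M V"
  shows "V \<subseteq> carrier M" "\<zero>\<^sub>M \<in> V" "x \<in> V \<Longrightarrow> y \<in> V \<Longrightarrow> x \<oplus>\<^sub>M y \<in> V"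
    "x \<in> V \<Longrightarrow> \<ominus>\<^bsub>M\<^esub> x \<in> V" "x \<in> V \<Longrightarrow> c \<bullet> x \<in> V"
proof -
  interpret additive_subgroup V M using assms by (simp add: ksubspace_def)
  show "V \<subseteq> carrier M" by (rule a_subset)
  show "\<zero>\<^sub>M \<in> V" by (rule zero_closed)
  show "x \<in> V \<Longrightarrow> y \<in> V \<Longrightarrow> x \<oplus>\<^sub>M y \<in> V" by (rule a_closed)
  show *: "x \<in> V \<Longrightarrow> c \<bullet> x \<in> V" for c using assms by (simp add: ksubspace_def)
  show "x \<in> V \<Longrightarrow> \<ominus>\<^bsub>M\<^esub> x \<in> V" using *[of "-1"] kscale_minus[of x] a_subset by auto
qed

lemma lsubmoduleD:
  assumes "lsubmodule R M V"
  shows "ksubspace R M V" "a \<in> carrier R \<Longrightarrow> x \<in> V \<Longrightarrow> a \<triangleright> x \<in> V"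
  using assms by (auto simp: ksubspace_def lsubmodule_def kscale_def scl_one_closed)

lemma lsubmodule_carrier: "lsubmodule R M (carrier M)"
  by (rule lsubmoduleI) (auto simp: act_closed)

lemma lspan_least: "lsubmodule R M N \<Longrightarrow> S \<subseteq> N \<Longrightarrow> lspan R M S \<subseteq> N"
  by (auto simp: lspan_def)

lemma lspan_superset: "S \<subseteq> lspan R M S"
  by (auto simp: lspan_def)

lemma lspan_submodule:
  assumes "S \<subseteq> carrier M" shows "lsubmodule R M (lspan R M S)"
proof (rule lsubmoduleI)
  show "lspan R M S \<subseteq> carrier M" using lspan_least[OF lsubmodule_carrier assms] .
  show "\<zero>\<^sub>M \<in> lspan R M S" by (auto simp: lspan_def dest: lsubmoduleD(1) ksubspaceD(2))
  show "x \<oplus>\<^sub>M y \<in> lspan R M S" if "x \<in> lspan R M S" "y \<in> lspan R M S" for x y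
    using that ksubspaceD(3)[OF lsubmoduleD(1)] by (simp add: lspan_def)
qed (simp add: lspan_def lsubmoduleD(2))

lemma mdual_add: "\<phi> \<in> mdual R M \<Longrightarrow> x \<in> carrier M \<Longrightarrow> y \<in> carrier M \<Longrightarrow> \<phi> (x \<oplus>\<^sub>M y) = \<phi> x + \<phi> y"
  by (simp add: mdual_def)

lemma mdual_scale: "\<phi> \<in> mdual R M \<Longrightarrow> x \<in> carrier M \<Longrightarrow> \<phi> (c \<bullet> x) = c * \<phi> x"
  by (simp add: mdual_def)

lemma mdual_outside: "\<phi> \<in> mdual R M \<Longrightarrow> x \<notin> carrier M \<Longrightarrow> \<phi> x = 0"
  by (simp add: mdual_def)

lemma mdual_zero: "\<phi> \<in> mdual R M \<Longrightarrow> \<phi> \<zero>\<^sub>M = 0"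
  using mdual_scale[of \<phi> "\<zero>\<^sub>M" 0] by (simp add: kscale_zero)

lemma mdual_minus: "\<phi> \<in> mdual R M \<Longrightarrow> x \<in> carrier M \<Longrightarrow> \<phi> (\<ominus>\<^bsub>M\<^esub> x) = - \<phi> x"
  using mdual_scale[of \<phi> x "-1"] by (simp add: kscale_minus)

text \<open>Each functional that does not vanish on the common kernel of the later ones costs one more spanning
  element. In this dual form, finite codimension passes to preimages and intersections without any
  dimension count.\<close>

lemma fin_codim_of_functionals:
  assumes N: "ksubspace R M N" and fs: "set fs \<subseteq> mdual R M"
    and sub: "\<And>x. x \<in> carrier M \<Longrightarrow> (\<forall>f\<in>set fs. f x = 0) \<Longrightarrow> x \<in> N"
  shows "fin_codim R M N"
proof -
  let ?K = "\<lambda>fs. {x \<in> carrier M. \<forall>f\<in>set fs. f x = 0}"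
  have "\<exists>B. finite B \<and> B \<subseteq> carrier M \<and> (\<forall>V. ksubspace R M V \<longrightarrow> ?K fs \<union> B \<subseteq> V \<longrightarrow> V = carrier M)"
    using fs
  proof (induction fs)
    case Nil
    show ?case using ksubspaceD(1) by (intro exI[of _ "{}"]) auto
  next
    case (Cons f fs)
    then obtain B where B: "finite B" "B \<subseteq> carrier M"
      "\<And>V. ksubspace R M V \<Longrightarrow> ?K fs \<union> B \<subseteq> V \<Longrightarrow> V = carrier M" by auto
    have f: "f \<in> mdual R M" using Cons by simp
    show ?case
    proof (cases "\<forall>x\<in>?K fs. f x = 0")
      case True
      then have eq: "?K (f # fs) = ?K fs" by auto
      show ?thesis unfolding eq using B by (intro exI[of _ B]) simp
    next
      case False
      \<comment> \<open>Inside the common kernel of \<open>fs\<close>, the kernel of \<open>f\<close> and \<open>b\<close> span everything.\<close>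
      then obtain b where b: "b \<in> carrier M" "\<forall>f\<in>set fs. f b = 0" "f b \<noteq> 0" by auto
      have "V = carrier M" if V: "ksubspace R M V" "?K (f # fs) \<union> insert b B \<subseteq> V" for V
      proof (rule B(3)[OF V(1)])
        have "x \<in> V" if x: "x \<in> carrier M" "\<forall>g\<in>set fs. g x = 0" for x
        proof -
          define c where "c = f x / f b"
          define y where "y = x \<oplus>\<^sub>M (- c) \<bullet> b"
          have y: "y \<in> carrier M" using x b by (simp add: y_def)
          have g: "g y = g x - c * g b" if "g \<in> set (f # fs)" for g
            using that Cons.prems x b by (subst y_def, subst mdual_add) (auto simp: mdual_scale)
          have "\<forall>g\<in>set (f # fs). g y = 0"
            using x b by (auto simp: g) (auto simp: c_def)
          then have "y \<in> V" using y V by auto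
          moreover have "c \<bullet> b \<in> V" using V by (simp add: ksubspaceD)
          ultimately have "y \<oplus>\<^sub>M c \<bullet> b \<in> V" using V by (simp add: ksubspaceD)
          also have "y \<oplus>\<^sub>M c \<bullet> b = x \<oplus>\<^sub>M ((- c) \<bullet> b \<oplus>\<^sub>M c \<bullet> b)"
            using x b by (simp add: y_def M.a_assoc)
          also have "\<dots> = x" using x b by (simp add: kscale_zero flip: kscale_add)
          finally show ?thesis .
        qed
        then show "?K fs \<union> B \<subseteq> V" using V by auto
      qed
      then show ?thesis using B b by (intro exI[of _ "insert b B"]) auto
    qed
  qed
  then obtain B where B: "finite B" "B \<subseteq> carrier M"
    "\<And>V. ksubspace R M V \<Longrightarrow> ?K fs \<union> B \<subseteq> V \<Longrightarrow> V = carrier M" by auto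
  have "V = carrier M" if "ksubspace R M V" "N \<union> B \<subseteq> V" for V
    using that sub by (intro B(3)) auto
  moreover have "ksubspace R M (carrier M)" "N \<union> B \<subseteq> carrier M"
    using lsubmoduleD(1)[OF lsubmodule_carrier] ksubspaceD(1)[OF N] B(2) by auto
  ultimately have "\<Inter>{V. ksubspace R M V \<and> N \<union> B \<subseteq> V} = carrier M" by blast
  then show ?thesis using B(1,2) unfolding fin_codim_def by blast
qed

text \<open>The functionals \<open>\<beta>\<close> in \<open>L\<close> are coordinates with respect to the vectors \<open>b\<close>, and \<open>P\<close> is a linear
  projection onto \<open>N\<close>. The last two clauses say
  \<open>x = P x + \<Sum> \<beta>(x) b\<close>: tested on functionals, to avoid sums in \<open>M\<close>, and outright for those \<open>x\<close> whose
  coordinates vanish.\<close>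

definition coordinates_modulo :: "'m set \<Rightarrow> ('m \<Rightarrow> 'm) \<Rightarrow> ('m \<times> ('m \<Rightarrow> 'k)) list \<Rightarrow> bool" where
  "coordinates_modulo N P L \<longleftrightarrow>
    (\<forall>x\<in>carrier M. P x \<in> N) \<and>
    (\<forall>x\<in>carrier M. \<forall>y\<in>carrier M. P (x \<oplus>\<^sub>M y) = P x \<oplus>\<^sub>M P y) \<and>
    (\<forall>c. \<forall>x\<in>carrier M. P (c \<bullet> x) = c \<bullet> P x) \<and> (\<forall>x\<in>N. P x = x) \<and>
    set L \<subseteq> carrier M \<times> {\<beta> \<in> mdual R M. \<forall>x\<in>N. \<beta> x = 0} \<and>
    (\<forall>x\<in>carrier M. (\<forall>(b, \<beta>)\<in>set L. \<beta> x = 0) \<longrightarrow> P x = x) \<and>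
    (\<forall>\<psi>\<in>mdual R M. \<forall>x\<in>carrier M. \<psi> x = \<psi> (P x) + (\<Sum>(b, \<beta>)\<leftarrow>L. \<beta> x * \<psi> b))"

text \<open>
  By induction on the spanning set: on \<open>N + kb\<close> the coefficient of \<open>b\<close> is a functional, and
  composed with the projection onto \<open>N + kb\<close> it extends to the whole module. For this extension
  the projection is carried through the induction.
\<close>

lemma fin_codim_coordinates:
  assumes "finite B" "B \<subseteq> carrier M" "ksubspace R M N"
    "\<And>V. ksubspace R M V \<Longrightarrow> N \<union> B \<subseteq> V \<Longrightarrow> V = carrier M"
  shows "\<exists>P L. coordinates_modulo N P L"
  using assms
proof (induction B arbitrary: N rule: finite_induct)
  case empty
  then have "N = carrier M" by auto
  then have "coordinates_modulo N id []" by (simp add: coordinates_modulo_def)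
  then show ?case by blast
next
  case (insert b B)
  have b: "b \<in> carrier M" using insert by simp
  have N: "ksubspace R M N" by fact
  have NM: "\<And>x. x \<in> N \<Longrightarrow> x \<in> carrier M" using ksubspaceD(1)[OF N] by auto
  show ?case
  proof (cases "b \<in> N")
    case True
    have "V = carrier M" if "ksubspace R M V" "N \<union> B \<subseteq> V" for V
      using insert.prems(3)[OF that(1)] that(2) True by auto
    then show ?thesis using insert.prems by (intro insert.IH) auto
  next
    case False
    define N' where "N' = {n \<oplus>\<^sub>M c \<bullet> b | n c. n \<in> N}"
    have N'I: "n \<oplus>\<^sub>M c \<bullet> b \<in> N'" if "n \<in> N" for n c using that by (auto simp: N'_def)
    have add: "(n \<oplus>\<^sub>M c \<bullet> b) \<oplus>\<^sub>M (n' \<oplus>\<^sub>M c' \<bullet> b) = (n \<oplus>\<^sub>M n') \<oplus>\<^sub>M (c + c') \<bullet> b"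
      if "n \<in> N" "n' \<in> N" for n n' c c'
      using that b NM by (simp add: kscale_add M.add.m_ac)
    have scale: "d \<bullet> (n \<oplus>\<^sub>M c \<bullet> b) = d \<bullet> n \<oplus>\<^sub>M (d * c) \<bullet> b" if "n \<in> N" for n c d
      using that b NM by (simp add: kscale_distrib kscale_kscale)
    have NN': "N \<subseteq> N'"
    proof
      fix n assume n: "n \<in> N"
      then show "n \<in> N'" using N'I[OF n, of 0] b NM by (simp add: kscale_zero)
    qed
    have bN': "b \<in> N'"
      using N'I[of "\<zero>\<^sub>M" 1] b ksubspaceD(2)[OF N] by (simp add: kscale_one)
    have N': "ksubspace R M N'"
    proof (rule ksubspaceI)
      show "N' \<subseteq> carrier M" using b NM by (auto simp: N'_def)
      show "\<zero>\<^sub>M \<in> N'" using NN' ksubspaceD(2)[OF N] by auto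
      fix x y assume "x \<in> N'" "y \<in> N'"
      then obtain n c n' c' where "x = n \<oplus>\<^sub>M c \<bullet> b" "y = n' \<oplus>\<^sub>M c' \<bullet> b" "n \<in> N" "n' \<in> N"
        by (auto simp: N'_def)
      then show "x \<oplus>\<^sub>M y \<in> N'" using add N'I ksubspaceD(3)[OF N] by simp
    next
      fix d x assume "x \<in> N'"
      then obtain n c where "x = n \<oplus>\<^sub>M c \<bullet> b" "n \<in> N" by (auto simp: N'_def)
      then show "d \<bullet> x \<in> N'" using scale N'I ksubspaceD(5)[OF N] by simp
    qed
    have uniq: "c = c'" if e: "n \<oplus>\<^sub>M c \<bullet> b = n' \<oplus>\<^sub>M c' \<bullet> b" "n \<in> N" "n' \<in> N" for n n' c c'
    proof (rule ccontr)
      assume ne: "c \<noteq> c'"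
      have "\<ominus>\<^bsub>M\<^esub> n' \<oplus>\<^sub>M n = (c' - c) \<bullet> b"
      proof -
        have "\<ominus>\<^bsub>M\<^esub> n' \<oplus>\<^sub>M n = \<ominus>\<^bsub>M\<^esub> n' \<oplus>\<^sub>M (n \<oplus>\<^sub>M c \<bullet> b) \<oplus>\<^sub>M (- c) \<bullet> b"
          using b NM e(2,3) by (simp add: M.a_assoc kscale_zero flip: kscale_add)
        also have "\<dots> = (\<ominus>\<^bsub>M\<^esub> n' \<oplus>\<^sub>M n') \<oplus>\<^sub>M (c' \<bullet> b \<oplus>\<^sub>M (- c) \<bullet> b)"
          using b NM e(2,3) by (simp add: e(1) M.a_assoc)
        also have "\<dots> = (c' - c) \<bullet> b"
          using b NM e(3) by (simp add: M.l_neg flip: kscale_add)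
        finally show ?thesis .
      qed
      moreover have "\<ominus>\<^bsub>M\<^esub> n' \<oplus>\<^sub>M n \<in> N" using that N by (simp add: ksubspaceD)
      ultimately have "(1 / (c' - c)) \<bullet> (c' - c) \<bullet> b \<in> N" using ksubspaceD(5)[OF N] by metis
      then show False using False ne b by (simp add: kscale_kscale kscale_one)
    qed
    \<comment> \<open>The coefficient of \<open>b\<close> on \<open>N + kb\<close>, well defined by \<open>uniq\<close>; \<open>\<beta>\<close> below is its extension.\<close>
    define \<beta>0 where "\<beta>0 = (\<lambda>y. THE c. \<exists>n\<in>N. y = n \<oplus>\<^sub>M c \<bullet> b)"
    have \<beta>0: "\<beta>0 (n \<oplus>\<^sub>M c \<bullet> b) = c" if "n \<in> N" for n c
      unfolding \<beta>0_def using that by (intro the_equality) (auto dest: uniq)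
    have sp: "V = carrier M" if "ksubspace R M V" "N' \<union> B \<subseteq> V" for V
      using that NN' bN' insert.prems(3)[of V] by blast
    obtain P L where PL: "coordinates_modulo N' P L"
      using insert.IH[OF _ N' sp] insert.prems(1) by auto
    have P: "\<And>x. x \<in> carrier M \<Longrightarrow> P x \<in> N'"
      "\<And>x y. x \<in> carrier M \<Longrightarrow> y \<in> carrier M \<Longrightarrow> P (x \<oplus>\<^sub>M y) = P x \<oplus>\<^sub>M P y"
      "\<And>c x. x \<in> carrier M \<Longrightarrow> P (c \<bullet> x) = c \<bullet> P x" "\<And>x. x \<in> N' \<Longrightarrow> P x = x"
      and L: "set L \<subseteq> carrier M \<times> {\<beta> \<in> mdual R M. \<forall>x\<in>N'. \<beta> x = 0}"
      "\<And>x. x \<in> carrier M \<Longrightarrow> (\<forall>(b, \<beta>)\<in>set L. \<beta> x = 0) \<Longrightarrow> P x = x"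
      "\<And>\<psi> x. \<psi> \<in> mdual R M \<Longrightarrow> x \<in> carrier M \<Longrightarrow> \<psi> x = \<psi> (P x) + (\<Sum>(b, \<beta>)\<leftarrow>L. \<beta> x * \<psi> b)"
      using PL by (simp_all add: coordinates_modulo_def)
    define \<beta> where "\<beta> = (\<lambda>x. if x \<in> carrier M then \<beta>0 (P x) else 0)"
    define Q where "Q = (\<lambda>x. P x \<oplus>\<^sub>M (- \<beta> x) \<bullet> b)"
    have ex: "\<exists>n. n \<in> N \<and> P x = n \<oplus>\<^sub>M \<beta> x \<bullet> b" if x: "x \<in> carrier M" for x
    proof -
      obtain n c where "P x = n \<oplus>\<^sub>M c \<bullet> b" "n \<in> N" using P(1)[OF x] by (auto simp: N'_def)
      then show ?thesis using \<beta>0 x by (auto simp: \<beta>_def)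
    qed
    have PM: "P x \<in> carrier M" if "x \<in> carrier M" for x
      using P(1)[OF that] ksubspaceD(1)[OF N'] by auto
    have Qn: "Q x = n" if x: "x \<in> carrier M" and n: "n \<in> N" "P x = n \<oplus>\<^sub>M \<beta> x \<bullet> b" for x n
      using n b NM by (simp add: Q_def M.a_assoc kscale_zero flip: kscale_add)
    have \<beta>_add: "\<beta> (x \<oplus>\<^sub>M y) = \<beta> x + \<beta> y" if xy: "x \<in> carrier M" "y \<in> carrier M" for x y
    proof -
      obtain m n where "m \<in> N" "P x = m \<oplus>\<^sub>M \<beta> x \<bullet> b" "n \<in> N" "P y = n \<oplus>\<^sub>M \<beta> y \<bullet> b"
        using ex xy by meson
      then have "P (x \<oplus>\<^sub>M y) = (m \<oplus>\<^sub>M n) \<oplus>\<^sub>M (\<beta> x + \<beta> y) \<bullet> b" "m \<oplus>\<^sub>M n \<in> N"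
        using xy add P(2) ksubspaceD(3)[OF N] by simp_all
      then show ?thesis using \<beta>0 xy by (simp add: \<beta>_def)
    qed
    have \<beta>_scale: "\<beta> (c \<bullet> x) = c * \<beta> x" if x: "x \<in> carrier M" for c x
    proof -
      obtain m where "m \<in> N" "P x = m \<oplus>\<^sub>M \<beta> x \<bullet> b" using ex x by meson
      then have "P (c \<bullet> x) = c \<bullet> m \<oplus>\<^sub>M (c * \<beta> x) \<bullet> b" "c \<bullet> m \<in> N"
        using x scale P(3) ksubspaceD(5)[OF N] by simp_all
      then show ?thesis using \<beta>0 x by (simp add: \<beta>_def)
    qed
    have \<beta>M: "\<beta> \<in> mdual R M"
      unfolding mdual_def using \<beta>_add \<beta>_scale by (auto simp: \<beta>_def)
    have \<beta>N: "\<beta> x = 0" if "x \<in> N" for x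
      using \<beta>0[OF that, of 0] P(4)[of x] NN' that NM b by (auto simp: \<beta>_def kscale_zero)
    have "coordinates_modulo N Q ((b, \<beta>) # L)"
      unfolding coordinates_modulo_def
    proof (intro conjI ballI allI impI)
      show "Q x \<in> N" if "x \<in> carrier M" for x using ex[OF that] Qn[OF that] by auto
      show "Q (x \<oplus>\<^sub>M y) = Q x \<oplus>\<^sub>M Q y" if "x \<in> carrier M" "y \<in> carrier M" for x y
      proof -
        have "(- (\<beta> x + \<beta> y)) \<bullet> b = (- \<beta> x) \<bullet> b \<oplus>\<^sub>M (- \<beta> y) \<bullet> b"
          using kscale_add[OF b, of "- \<beta> x" "- \<beta> y"] by (simp add: algebra_simps)
        then show ?thesis using that b PM by (simp only: Q_def P(2) \<beta>_add) (simp add: M.add.m_ac)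
      qed
      show "Q (c \<bullet> x) = c \<bullet> Q x" if "x \<in> carrier M" for c x
      proof -
        have "Q (c \<bullet> x) = c \<bullet> P x \<oplus>\<^sub>M (c * - \<beta> x) \<bullet> b"
          using that by (simp add: Q_def P(3) \<beta>_scale)
        then show ?thesis using that b PM
          by (simp only: Q_def kscale_distrib kscale_closed kscale_kscale)
      qed
      show "Q x = x" if "x \<in> N" for x
        using that NM NN' P(4)[of x] b by (auto simp: Q_def \<beta>N kscale_zero)
      show "set ((b, \<beta>) # L) \<subseteq> carrier M \<times> {\<beta> \<in> mdual R M. \<forall>x\<in>N. \<beta> x = 0}"
        using L(1) b \<beta>M \<beta>N NN' by auto
      show "Q x = x" if "x \<in> carrier M" "\<forall>(b, \<beta>)\<in>set ((b, \<beta>) # L). \<beta> x = 0" for x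
        using that L(2)[of x] b by (auto simp: Q_def kscale_zero)
      show "\<psi> x = \<psi> (Q x) + (\<Sum>(b, \<beta>)\<leftarrow>(b, \<beta>) # L. \<beta> x * \<psi> b)"
        if "\<psi> \<in> mdual R M" "x \<in> carrier M" for \<psi> x
      proof -
        have "\<psi> (Q x) = \<psi> (P x) - \<beta> x * \<psi> b"
          using that b PM by (simp add: Q_def mdual_add mdual_scale)
        then show ?thesis using L(3)[OF that] by simp
      qed
    qed
    then show ?thesis by blast
  qed
qed

text \<open>The coordinates without the projection, in the form of the dual basis lemma for \<open>M / N\<close>: the
  vectors may be linearly dependent modulo \<open>N\<close>.\<close>

definition dual_basis_modulo :: "'m set \<Rightarrow> ('m \<times> ('m \<Rightarrow> 'k)) list \<Rightarrow> bool" where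
  "dual_basis_modulo N L \<longleftrightarrow>
    set L \<subseteq> carrier M \<times> {\<beta> \<in> mdual R M. \<forall>x\<in>N. \<beta> x = 0} \<and>
    (\<forall>x\<in>carrier M. (\<forall>b \<beta>. (b, \<beta>) \<in> set L \<longrightarrow> \<beta> x = 0) \<longrightarrow> x \<in> N) \<and>
    (\<forall>\<psi>\<in>mdual R M. (\<forall>y\<in>N. \<psi> y = 0) \<longrightarrow>
       (\<forall>x\<in>carrier M. \<psi> x = (\<Sum>(b, \<beta>)\<leftarrow>L. \<beta> x * \<psi> b)))"

lemma dual_basis_moduloD:
  assumes "dual_basis_modulo N L"
  shows "(b, \<beta>) \<in> set L \<Longrightarrow> b \<in> carrier M" "(b, \<beta>) \<in> set L \<Longrightarrow> \<beta> \<in> mdual R M"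
    "(b, \<beta>) \<in> set L \<Longrightarrow> x \<in> N \<Longrightarrow> \<beta> x = 0"
    "x \<in> carrier M \<Longrightarrow> (\<And>b \<beta>. (b, \<beta>) \<in> set L \<Longrightarrow> \<beta> x = 0) \<Longrightarrow> x \<in> N"
    "\<psi> \<in> mdual R M \<Longrightarrow> (\<And>y. y \<in> N \<Longrightarrow> \<psi> y = 0) \<Longrightarrow> x \<in> carrier M \<Longrightarrow>
       \<psi> x = (\<Sum>(b, \<beta>)\<leftarrow>L. \<beta> x * \<psi> b)"
  using assms unfolding dual_basis_modulo_def by blast+

lemma fin_codim_dual_basis:
  assumes N: "ksubspace R M N" and fc: "fin_codim R M N"
  shows "\<exists>L. dual_basis_modulo N L"
proof -
  obtain B where B: "finite B" "B \<subseteq> carrier M"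
      "\<Inter>{V. ksubspace R M V \<and> N \<union> B \<subseteq> V} = carrier M"
    using fc by (auto simp: fin_codim_def)
  have sp: "V = carrier M" if "ksubspace R M V" "N \<union> B \<subseteq> V" for V
    using that B(3) ksubspaceD(1) by blast
  obtain P L where PL: "coordinates_modulo N P L"
    using fin_codim_coordinates[OF B(1,2) N sp] by auto
  have P: "\<And>x. x \<in> carrier M \<Longrightarrow> P x \<in> N"
    and L: "set L \<subseteq> carrier M \<times> {\<beta> \<in> mdual R M. \<forall>x\<in>N. \<beta> x = 0}"
      "\<And>x. x \<in> carrier M \<Longrightarrow> (\<forall>(b, \<beta>)\<in>set L. \<beta> x = 0) \<Longrightarrow> P x = x"
      "\<And>\<psi> x. \<psi> \<in> mdual R M \<Longrightarrow> x \<in> carrier M \<Longrightarrow> \<psi> x = \<psi> (P x) + (\<Sum>(b, \<beta>)\<leftarrow>L. \<beta> x * \<psi> b)"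
    using PL by (simp_all add: coordinates_modulo_def)
  have "dual_basis_modulo N L"
    unfolding dual_basis_modulo_def
  proof (intro conjI ballI impI)
    show "set L \<subseteq> carrier M \<times> {\<beta> \<in> mdual R M. \<forall>x\<in>N. \<beta> x = 0}" by (rule L(1))
    show "x \<in> N" if "x \<in> carrier M" "\<forall>b \<beta>. (b, \<beta>) \<in> set L \<longrightarrow> \<beta> x = 0" for x
      using that L(2)[of x] P[of x] by fastforce
    show "\<psi> x = (\<Sum>(b, \<beta>)\<leftarrow>L. \<beta> x * \<psi> b)"
      if "\<psi> \<in> mdual R M" "\<forall>y\<in>N. \<psi> y = 0" "x \<in> carrier M" for \<psi> x
      using that L(3)[of \<psi> x] P[of x] by simp
  qed
  then show ?thesis by blast
qed

end

section \<open>The coaction on the finite dual\<close>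

lemma reg_simps [simp]:
  "carrier (reg R) = carrier R" "monoid.mult (reg R) = monoid.mult R" "one (reg R) = one R"
  "ring.zero (reg R) = ring.zero R" "ring.add (reg R) = ring.add R" "smult (reg R) = monoid.mult R"
  by (simp_all add: reg_def)

text \<open>Statements about \<open>A\<close> and its finite dual are obtained from those about modules by taking \<open>M\<close> to
  be the regular module.\<close>

lemma kmodule_reg:
  assumes "kalgebra R" shows "kmodule R (reg R)"
proof -
  interpret kalgebra R by fact
  have "abelian_group (reg R)"
    by (rule abelian_groupI) (auto simp: add.m_ac intro: bexI[of _ "\<ominus>\<^bsub>R\<^esub> x" for x] l_neg)
  then have "left_module R (reg R)"
    by (intro left_module.intro left_module_axioms.intro ring_axioms)
      (simp_all add: l_distr r_distr m_assoc)
  then show ?thesis by (rule kmodule.intro) fact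
qed

lemma kscale_reg: "kalgebra R \<Longrightarrow> x \<in> carrier R \<Longrightarrow> kscale R (reg R) c x = c \<odot>\<^bsub>R\<^esub> x"
  by (simp add: kscale_def kalgebra.scl_mult_l kalgebra.axioms(1) ring.ring_simprules)

lemma comult_eq_coact_reg: "comult A \<phi> = coact A (reg A) \<phi>"
  by (auto simp: comult_def coact_def fun_eq_iff)

text \<open>The translate \<open>x \<mapsto> \<phi> (a x)\<close>, which is a slice of the coaction.\<close>

abbreviation coslice ::
    "('k::field, 'a) module \<Rightarrow> ('a, 'm) module \<Rightarrow> ('m \<Rightarrow> 'k) \<Rightarrow> 'a \<Rightarrow> 'm \<Rightarrow> 'k" where
  "coslice A M \<phi> a \<equiv> (\<lambda>x. coact A M \<phi> (a, x))"

lemma coslice_simps [simp]: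
  "a \<in> carrier A \<Longrightarrow> x \<in> carrier M \<Longrightarrow> coact A M \<phi> (a, x) = \<phi> (a \<odot>\<^bsub>M\<^esub> x)"
  "a \<notin> carrier A \<Longrightarrow> coact A M \<phi> (a, x) = 0"
  "x \<notin> carrier M \<Longrightarrow> coact A M \<phi> (a, x) = 0"
  by (simp_all add: coact_def)

context kmodule begin

lemma coslice_mdual:
  assumes "\<phi> \<in> mdual R M" shows "coslice R M \<phi> a \<in> mdual R M"
proof (cases "a \<in> carrier R")
  case True
  then show ?thesis
    using assms unfolding mdual_def[of R M]
    by (auto simp: act_closed act_r_distr act_kscale)
next
  case False
  then show ?thesis by (simp add: mdual_def coact_def)
qed

lemma coslice_coslice:
  "a \<in> carrier R \<Longrightarrow> b \<in> carrier R \<Longrightarrow>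
    coslice R M (coslice R M \<phi> a) b = coslice R M \<phi> (a \<otimes> b)"
  by (auto simp: coact_def act_closed act_assoc)

lemma coslice_findual:
  assumes "\<phi> \<in> findual R M" shows "coslice R M \<phi> a \<in> findual R M"
proof -
  obtain N where \<phi>: "\<phi> \<in> mdual R M" and N: "lsubmodule R M N" "fin_codim R M N" "\<forall>x\<in>N. \<phi> x = 0"
    using assms by (auto simp: findual_def)
  have "\<forall>x\<in>N. coslice R M \<phi> a x = 0"
    using N lsubmoduleD(2)[OF N(1)] by (auto simp: coact_def)
  then show ?thesis using N coslice_mdual[OF \<phi>] by (auto simp: findual_def)
qed

text \<open>With a dual basis \<open>(b\<^sub>i, \<beta>\<^sub>i)\<close> of \<open>M / N\<close>, an element \<open>a\<close> maps \<open>M\<close> into \<open>N\<close> as soon as its matrix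
  coefficients \<open>\<beta>\<^sub>j (a b\<^sub>i)\<close> vanish, and these are finitely many functionals of \<open>a\<close>.\<close>

lemma annihilator_ideal:
  assumes N: "lsubmodule R M N" "fin_codim R M N"
  defines "I \<equiv> {a \<in> carrier R. \<forall>x\<in>carrier M. a \<triangleright> x \<in> N}"
  shows "ideal I R" and "fin_codim R (reg R) I"
proof -
  interpret reg: kmodule R "reg R" by (rule kmodule_reg) unfold_locales
  note Nk = lsubmoduleD(1)[OF N(1)]
  have I: "ksubspace R (reg R) I"
  proof (rule reg.ksubspaceI)
    show "I \<subseteq> carrier (reg R)" by (auto simp: I_def)
    show "\<zero>\<^bsub>reg R\<^esub> \<in> I" using ksubspaceD(2)[OF Nk] by (simp add: I_def act_zero_left)
    show "x \<oplus>\<^bsub>reg R\<^esub> y \<in> I" if "x \<in> I" "y \<in> I" for x y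
      using that ksubspaceD(3)[OF Nk] by (auto simp: I_def act_l_distr)
    show "kscale R (reg R) c x \<in> I" if "x \<in> I" for c x
      using that ksubspaceD(5)[OF Nk] kscale_reg[OF kalgebra_axioms]
      by (auto simp: I_def scl_act scl_closed)
  qed
  have "subgroup I (add_monoid R)"
    using I by (simp add: ksubspace_def additive_subgroup_def subgroup_def m_inv_def)
  then show "ideal I R"
    using lsubmoduleD(2)[OF N(1)] by (intro idealI R.ring_axioms) (auto simp: I_def act_assoc act_closed)
  obtain L where L: "dual_basis_modulo N L"
    using fin_codim_dual_basis[OF Nk N(2)] by blast
  define G where "G = (\<lambda>b \<beta> a. if a \<in> carrier R then \<beta> (a \<triangleright> b) else 0 :: 'k)"
  show "fin_codim R (reg R) I"
  proof (rule reg.fin_codim_of_functionals[OF I])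
    show "set [G b \<beta>. (b, _) \<leftarrow> L, (_, \<beta>) \<leftarrow> L] \<subseteq> mdual R (reg R)"
    proof
      fix g assume "g \<in> set [G b \<beta>. (b, _) \<leftarrow> L, (_, \<beta>) \<leftarrow> L]"
      then obtain b \<beta> where g: "g = G b \<beta>" and b: "b \<in> carrier M" and \<beta>: "\<beta> \<in> mdual R M"
        using dual_basis_moduloD(1,2)[OF L] by auto
      show "g \<in> mdual R (reg R)"
        using b kscale_reg[OF kalgebra_axioms] unfolding g mdual_def[of R "reg R"]
        by (auto simp: G_def act_l_distr mdual_add[OF \<beta>] act_closed scl_act mdual_scale[OF \<beta>] scl_closed)
    qed
    fix a assume a: "a \<in> carrier (reg R)"
      and 0: "\<forall>f\<in>set [G b \<beta>. (b, _) \<leftarrow> L, (_, \<beta>) \<leftarrow> L]. f a = 0"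
    have ab: "\<beta> (a \<triangleright> b) = 0" if "(b, \<beta>') \<in> set L" "(b', \<beta>) \<in> set L" for b b' \<beta> \<beta>'
    proof -
      have "G b \<beta> \<in> set [G b \<beta>. (b, _) \<leftarrow> L, (_, \<beta>) \<leftarrow> L]" using that by force
      then have "G b \<beta> a = 0" using 0 by blast
      then show ?thesis using a by (simp add: G_def)
    qed
    have "a \<triangleright> x \<in> N" if x: "x \<in> carrier M" for x
    proof (rule dual_basis_moduloD(4)[OF L])
      show "a \<triangleright> x \<in> carrier M" using a x by (simp add: act_closed)
      fix b' \<beta> assume \<beta>: "(b', \<beta>) \<in> set L"
      then have \<beta>': "\<beta> \<in> mdual R M" "\<And>x. x \<in> N \<Longrightarrow> \<beta> x = 0"
        using dual_basis_moduloD(2,3)[OF L] by blast+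
      \<comment> \<open>The functional \<open>y \<mapsto> \<beta> (a y)\<close> vanishes on \<open>N\<close>, so it is determined by its values at the \<open>b\<^sub>i\<close>.\<close>
      have "coslice R M \<beta> a y = 0" if "y \<in> N" for y
        using that \<beta>'(2) lsubmoduleD(2)[OF N(1)] by (auto simp: coact_def)
      from dual_basis_moduloD(5)[OF L coslice_mdual[OF \<beta>'(1)] this x]
      have "coslice R M \<beta> a x = (\<Sum>(b, \<gamma>)\<leftarrow>L. \<gamma> x * coslice R M \<beta> a b)" .
      also have "\<dots> = (\<Sum>(b, \<gamma>)\<leftarrow>L. 0)"
      proof (rule arg_cong[of _ _ sum_list], rule map_cong[OF refl], clarify)
        fix b \<gamma> assume "(b, \<gamma>) \<in> set L"
        then show "\<gamma> x * coslice R M \<beta> a b = 0" using ab[OF _ \<beta>] dual_basis_moduloD(1)[OF L] a by simp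
      qed
      also have "\<dots> = 0" by (induction L) auto
      finally show "\<beta> (a \<triangleright> x) = 0" using a x by simp
    qed
    then show "a \<in> I" using a by (simp add: I_def)
  qed
qed

lemma matrix_coefficient:
  assumes \<phi>: "\<phi> \<in> findual R M" and b: "b \<in> carrier M"
  shows "(\<lambda>a. if a \<in> carrier R then \<phi> (a \<triangleright> b) else 0) \<in> findual_alg R"
proof -
  obtain N where \<phi>': "\<phi> \<in> mdual R M" and N: "lsubmodule R M N" "fin_codim R M N" "\<forall>x\<in>N. \<phi> x = 0"
    using \<phi> by (auto simp: findual_def)
  have "(\<lambda>a. if a \<in> carrier R then \<phi> (a \<triangleright> b) else 0) \<in> mdual R (reg R)"
    using b kscale_reg[OF kalgebra_axioms] unfolding mdual_def[of R "reg R"]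
    by (auto simp: act_l_distr mdual_add[OF \<phi>'] act_closed scl_act mdual_scale[OF \<phi>'] scl_closed)
  then show ?thesis
    using annihilator_ideal[OF N(1,2)] b N(3) unfolding findual_alg_def
    by (intro CollectI conjI exI[of _ "{a \<in> carrier R. \<forall>x\<in>carrier M. a \<triangleright> x \<in> N}"]) auto
qed

text \<open>With a dual basis \<open>(b\<^sub>i, \<beta>\<^sub>i)\<close> modulo a submodule on which \<open>\<phi>\<close> vanishes,
  \<open>\<phi> (a x) = \<Sum> \<phi> (a b\<^sub>i) \<beta>\<^sub>i(x)\<close>.\<close>

lemma coact_tensor:
  assumes \<phi>: "\<phi> \<in> findual R M"
  shows "coact R M \<phi> \<in> tensor (findual_alg R) (findual R M)"
proof -
  obtain N where \<phi>': "\<phi> \<in> mdual R M" and N: "lsubmodule R M N" "fin_codim R M N" "\<forall>x\<in>N. \<phi> x = 0"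
    using \<phi> by (auto simp: findual_def)
  obtain L where L: "dual_basis_modulo N L"
    using fin_codim_dual_basis[OF lsubmoduleD(1)[OF N(1)] N(2)] by blast
  define us where "us = map (\<lambda>(b, \<beta>). (\<lambda>a. if a \<in> carrier R then \<phi> (a \<triangleright> b) else 0, \<beta>)) L"
  have us: "(\<Sum>(v, w)\<leftarrow>us. v a * w x) =
      (if a \<in> carrier R then (\<Sum>(b, \<beta>)\<leftarrow>L. \<beta> x * \<phi> (a \<triangleright> b)) else 0)" for a x
    unfolding us_def by (induction L) (auto simp: mult.commute)
  have "coact R M \<phi> (a, x) = (\<Sum>(v, w)\<leftarrow>us. v a * w x)" for a x
  proof (cases "a \<in> carrier R \<and> x \<in> carrier M")
    case True
    have "coslice R M \<phi> a y = 0" if "y \<in> N" for y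
      using that N lsubmoduleD(2)[OF N(1)] by (auto simp: coact_def)
    from dual_basis_moduloD(5)[OF L coslice_mdual[OF \<phi>'] this, of x] True
    have "coact R M \<phi> (a, x) = (\<Sum>(b, \<beta>)\<leftarrow>L. \<beta> x * coslice R M \<phi> a b)" by blast
    also have "\<dots> = (\<Sum>(b, \<beta>)\<leftarrow>L. \<beta> x * \<phi> (a \<triangleright> b))"
      using dual_basis_moduloD(1)[OF L] True by (intro arg_cong[of _ _ sum_list] map_cong) auto
    finally show ?thesis using True by (simp add: us)
  next
    case False
    have "(\<Sum>(b, \<beta>)\<leftarrow>L. \<beta> x * \<phi> (a \<triangleright> b)) = 0" if "x \<notin> carrier M"
    proof -
      have "(\<Sum>(b, \<beta>)\<leftarrow>L. \<beta> x * \<phi> (a \<triangleright> b)) = (\<Sum>(b, \<beta>)\<leftarrow>L. 0)"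
        using dual_basis_moduloD(2)[OF L] mdual_outside[OF _ that]
        by (intro arg_cong[of _ _ sum_list] map_cong) auto
      then show ?thesis by (simp add: split_def)
    qed
    then show ?thesis using False by (auto simp: us)
  qed
  then have "coact R M \<phi> = (\<Sum>(v, w)\<leftarrow>us. pure_tensor v w)"
    by (auto simp: fun_eq_iff sum_list_pure_tensor_apply)
  also have "\<dots> \<in> tensor (findual_alg R) (findual R M)"
  proof (rule tensor_sum_list, rule subsetI)
    fix p assume "p \<in> set us"
    then obtain b \<beta> where p: "(b, \<beta>) \<in> set L"
        "p = (\<lambda>a. if a \<in> carrier R then \<phi> (a \<triangleright> b) else 0, \<beta>)"
      by (auto simp: us_def)
    have "\<beta> \<in> findual R M"
      using dual_basis_moduloD(2,3)[OF L p(1)] N unfolding findual_def by blast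
    then show "p \<in> findual_alg R \<times> findual R M"
      using matrix_coefficient[OF \<phi> dual_basis_moduloD(1)[OF L p(1)]] p(2) by simp
  qed
  finally show ?thesis .
qed

lemma findual_subspace: "fun_vs.subspace (findual R M)"
proof (rule fun_vs.subspaceI)
  show "0 \<in> findual R M"
    unfolding findual_def using lsubmodule_carrier
      fin_codim_of_functionals[OF lsubmoduleD(1)[OF lsubmodule_carrier], of "[]"]
    by (auto simp: mdual_def)
next
  fix c \<phi> assume "\<phi> \<in> findual R M"
  then show "fscale c \<phi> \<in> findual R M"
    by (auto simp: findual_def mdual_def fscale_def algebra_simps)
next
  fix \<phi> \<psi> assume \<phi>: "\<phi> \<in> findual R M" and \<psi>: "\<psi> \<in> findual R M"
  obtain N where N: "lsubmodule R M N" "fin_codim R M N" "\<forall>x\<in>N. \<phi> x = 0"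
    using \<phi> by (auto simp: findual_def)
  obtain N' where N': "lsubmodule R M N'" "fin_codim R M N'" "\<forall>x\<in>N'. \<psi> x = 0"
    using \<psi> by (auto simp: findual_def)
  obtain L where L: "dual_basis_modulo N L"
    using fin_codim_dual_basis[OF lsubmoduleD(1)[OF N(1)] N(2)] by blast
  obtain L' where L': "dual_basis_modulo N' L'"
    using fin_codim_dual_basis[OF lsubmoduleD(1)[OF N'(1)] N'(2)] by blast
  have sub: "lsubmodule R M (N \<inter> N')"
    using ksubspaceD(1-3)[OF lsubmoduleD(1)[OF N(1)]] lsubmoduleD(2)[OF N(1)]
      ksubspaceD(1-3)[OF lsubmoduleD(1)[OF N'(1)]] lsubmoduleD(2)[OF N'(1)]
    by (intro lsubmoduleI) auto
  have "fin_codim R M (N \<inter> N')"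
  proof (rule fin_codim_of_functionals[OF lsubmoduleD(1)[OF sub]])
    show "set (map snd (L @ L')) \<subseteq> mdual R M"
      using dual_basis_moduloD(2)[OF L] dual_basis_moduloD(2)[OF L'] by auto
    fix x assume x: "x \<in> carrier M" "\<forall>f\<in>set (map snd (L @ L')). f x = 0"
    have "\<beta> x = 0" if "(b, \<beta>) \<in> set L \<union> set L'" for b \<beta>
      using that x(2) by force
    then show "x \<in> N \<inter> N'"
      using dual_basis_moduloD(4)[OF L x(1)] dual_basis_moduloD(4)[OF L' x(1)] by blast
  qed
  moreover have "\<phi> + \<psi> \<in> mdual R M"
    using \<phi> \<psi> by (auto simp: findual_def mdual_def algebra_simps)
  ultimately show "\<phi> + \<psi> \<in> findual R M"
    using sub N(3) N'(3) by (auto simp: findual_def)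
qed

end

text \<open>A functional on \<open>A\<close> that vanishes on a left ideal of finite codimension also vanishes on a
  two-sided one, because it is the matrix coefficient of the regular module at \<open>1\<close>.\<close>

lemma findual_reg:
  assumes "kalgebra A" shows "findual A (reg A) = findual_alg A"
proof
  interpret reg: kmodule A "reg A" by (rule kmodule_reg) fact
  show "findual_alg A \<subseteq> findual A (reg A)"
  proof
    fix \<phi> assume "\<phi> \<in> findual_alg A"
    then obtain I where \<phi>: "\<phi> \<in> mdual A (reg A)" and I: "ideal I A" "fin_codim A (reg A) I"
        "\<forall>x\<in>I. \<phi> x = 0" by (auto simp: findual_alg_def)
    interpret ideal I A by fact
    have "lsubmodule A (reg A) I"
      using I_l_closed a_subset by (intro reg.lsubmoduleI) (auto simp: subset_iff)
    then show "\<phi> \<in> findual A (reg A)" using \<phi> I by (auto simp: findual_def)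
  qed
  show "findual A (reg A) \<subseteq> findual_alg A"
  proof
    fix \<phi> assume \<phi>: "\<phi> \<in> findual A (reg A)"
    have "(\<lambda>a. if a \<in> carrier A then \<phi> (a \<odot>\<^bsub>reg A\<^esub> \<one>\<^bsub>A\<^esub>) else 0) = \<phi>"
      using \<phi> by (auto simp: fun_eq_iff findual_def mdual_def)
    then show "\<phi> \<in> findual_alg A" using reg.matrix_coefficient[OF \<phi>, of "\<one>\<^bsub>A\<^esub>"] by simp
  qed
qed

lemma subcoalgebra_findual_alg:
  assumes "kalgebra A" shows "subcoalgebra A (findual_alg A)"
proof -
  interpret reg: kmodule A "reg A" by (rule kmodule_reg) fact
  show ?thesis
    using reg.coact_tensor reg.findual_subspace
    by (simp add: subcoalgebra_def comult_eq_coact_reg findual_reg[OF assms])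
qed

section \<open>The dual algebra of a subcoalgebra and its modules\<close>

lemma subcoalgebraD:
  assumes "subcoalgebra A C"
  shows "C \<subseteq> findual_alg A" "fun_vs.subspace C" "\<phi> \<in> C \<Longrightarrow> comult A \<phi> \<in> tensor C C"
  using assms by (auto simp: subcoalgebra_def)

lemma coslice_subcoalgebra:
  assumes "subcoalgebra A C" "\<phi> \<in> C" shows "coslice A (reg A) \<phi> a \<in> C"
  using tensor_slice[OF subcoalgebraD(2)[OF assms(1)] subcoalgebraD(2)[OF assms(1)] subcoalgebraD(3)[OF assms]]
  by (simp add: comult_eq_coact_reg)

lemma cotens_mono: "C' \<subseteq> C \<Longrightarrow> cotens A C' M \<subseteq> cotens A C M"
  using tensor_mono[of C' C "findual A M" "findual A M"] by (auto simp: cotens_def)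

locale comodule_setting = kmodule A M
  for A :: "('k::field, 'a) module" (structure) and M :: "('a, 'm) module" +
  fixes C :: "('a \<Rightarrow> 'k) set"
  assumes C: "subcoalgebra A C"
begin

abbreviation CM where "CM \<equiv> cotens A C M"

lemma C_subspace: "fun_vs.subspace C" by (rule subcoalgebraD(2)[OF C])

lemma cotens_findual: "\<phi> \<in> CM \<Longrightarrow> \<phi> \<in> findual A M" by (simp add: cotens_def)

lemma cotens_mdual: "\<phi> \<in> CM \<Longrightarrow> \<phi> \<in> mdual A M" by (simp add: cotens_def findual_def)

lemma coact_add: "coact A M (\<phi> + \<psi>) = coact A M \<phi> + coact A M \<psi>"
  by (auto simp: coact_def fun_eq_iff)

lemma coact_scale: "coact A M (fscale c \<phi>) = fscale c (coact A M \<phi>)"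
  by (auto simp: coact_def fun_eq_iff fscale_def)

lemma coact_zero: "coact A M 0 = 0"
  by (auto simp: coact_def fun_eq_iff)

lemma coslice_add: "coslice A M (\<phi> + \<psi>) a = coslice A M \<phi> a + coslice A M \<psi> a"
  by (auto simp: coact_def fun_eq_iff)

lemma coslice_scale: "coslice A M (fscale c \<phi>) a = fscale c (coslice A M \<phi> a)"
  by (auto simp: coact_def fun_eq_iff)

lemma cotens_subspace: "fun_vs.subspace CM"
  using findual_subspace tensor_subspace[of C "findual A M"]
  by (intro fun_vs.subspaceI)
    (auto simp: cotens_def coact_add coact_scale coact_zero
      intro: fun_vs.subspace_0 fun_vs.subspace_add fun_vs.subspace_scale)

text \<open>Coassociativity: translating \<open>\<phi>\<close> by \<open>a\<close> translates the \<open>C\<close>-factors of its coaction by \<open>a\<close>, and \<open>C\<close> is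
  closed under translation.\<close>

lemma coslice_cotens:
  assumes \<phi>: "\<phi> \<in> CM" shows "coslice A M \<phi> a \<in> CM"
proof (cases "a \<in> carrier A")
  case a: True
  have t: "coact A M \<phi> \<in> tensor C (findual A M)" using \<phi> by (simp add: cotens_def)
  have "(\<lambda>(b, x). (if b \<in> carrier A then 1 else 0) * 1 * coact A M \<phi> (a \<otimes> b, x))
      \<in> tensor C (findual A M)"
  proof (rule tensor_reindex[OF C_subspace t])
    fix c assume "c \<in> C"
    then have "coslice A (reg A) c a \<in> C" by (rule coslice_subcoalgebra[OF C])
    also have "coslice A (reg A) c a = (\<lambda>b. (if b \<in> carrier A then 1 else 0) * c (a \<otimes> b))"
      using a by (auto simp: coact_def)
    finally show "(\<lambda>b. (if b \<in> carrier A then 1 else 0) * c (a \<otimes> b)) \<in> C" .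
  qed simp
  also have "(\<lambda>(b, x). (if b \<in> carrier A then 1 else 0) * 1 * coact A M \<phi> (a \<otimes> b, x)) =
      coact A M (coslice A M \<phi> a)"
    using a by (auto simp: fun_eq_iff coact_def act_assoc act_closed)
  finally show ?thesis using coslice_findual[OF cotens_findual[OF \<phi>]] by (simp add: cotens_def)
next
  case False
  then have "coslice A M \<phi> a = 0" by (simp add: fun_eq_iff)
  then show ?thesis using fun_vs.subspace_0[OF cotens_subspace] by (simp only:)
qed

lemma coact_cotens:
  assumes \<phi>: "\<phi> \<in> CM" shows "coact A M \<phi> \<in> tensor C CM"
  using \<phi> by (intro tensor_shrink_right[OF C_subspace cotens_subspace, of _ "findual A M"] coslice_cotens)
    (simp add: cotens_def)

lemma contract_in_C:
  assumes "\<phi> \<in> CM" "g \<in> fdual CM"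
  shows "(\<lambda>a. g (coslice A M \<phi> a)) \<in> C"
  using tensor_contract(1)[OF C_subspace cotens_subspace coact_cotens] assms by simp

abbreviation dact (infixr "\<star>" 75) where "f \<star> g \<equiv> f \<odot>\<^bsub>cotens_dual A C M\<^esub> g"

text \<open>The formula for the action of \<open>C\<^sup>*\<close> on the dual of the cotensor product from which all the
  module laws below follow.\<close>

lemma dact_apply:
  assumes "\<phi> \<in> CM" "f \<in> fdual C" "g \<in> fdual CM"
  shows "(f \<star> g) \<phi> = f (\<lambda>a. g (coslice A M \<phi> a))"
  using tensor_contract(2)[OF C_subspace cotens_subspace coact_cotens] assms
  by (simp add: cotens_dual_def)

lemma dact_outside: "\<phi> \<notin> CM \<Longrightarrow> (f \<star> g) \<phi> = 0"
  by (simp add: cotens_dual_def)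

lemma dact_closed:
  assumes f: "f \<in> fdual C" and g: "g \<in> fdual CM" shows "f \<star> g \<in> fdual CM"
proof -
  have "(f \<star> g) (\<phi> + \<psi>) = (f \<star> g) \<phi> + (f \<star> g) \<psi>" if "\<phi> \<in> CM" "\<psi> \<in> CM" for \<phi> \<psi>
  proof -
    have "(f \<star> g) (\<phi> + \<psi>) = f (\<lambda>a. g (coslice A M \<phi> a + coslice A M \<psi> a))"
      using that f g fun_vs.subspace_add[OF cotens_subspace] by (simp only: dact_apply coslice_add)
    also have "\<dots> = f ((\<lambda>a. g (coslice A M \<phi> a)) + (\<lambda>a. g (coslice A M \<psi> a)))"
      using that by (intro arg_cong[of _ _ f] ext) (simp add: fdual_add[OF g] coslice_cotens)
    also have "\<dots> = (f \<star> g) \<phi> + (f \<star> g) \<psi>"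
      using that f g by (simp add: fdual_add[OF f] contract_in_C dact_apply)
    finally show ?thesis .
  qed
  moreover have "(f \<star> g) (fscale c \<phi>) = c * (f \<star> g) \<phi>" if "\<phi> \<in> CM" for c \<phi>
  proof -
    have "(f \<star> g) (fscale c \<phi>) = f (\<lambda>a. g (fscale c (coslice A M \<phi> a)))"
      using that f g fun_vs.subspace_scale[OF cotens_subspace] by (simp only: dact_apply coslice_scale)
    also have "\<dots> = f (fscale c (\<lambda>a. g (coslice A M \<phi> a)))"
      using that by (intro arg_cong[of _ _ f] ext) (simp add: fdual_scale[OF g] coslice_cotens)
    also have "\<dots> = c * (f \<star> g) \<phi>"
      using that f g by (simp add: fdual_scale[OF f] contract_in_C dact_apply)
    finally show ?thesis .
  qed
  ultimately show ?thesis by (simp add: fdual_def dact_outside)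
qed

lemma dact_add_left:
  assumes "f \<in> fdual C" "f' \<in> fdual C" "g \<in> fdual CM"
  shows "(f + f') \<star> g = f \<star> g + f' \<star> g"
proof
  fix \<phi> show "((f + f') \<star> g) \<phi> = (f \<star> g + f' \<star> g) \<phi>"
    using assms fun_vs.subspace_add[OF fdual_subspace, of f C f']
    by (cases "\<phi> \<in> CM") (simp_all add: dact_apply dact_outside)
qed

lemma dact_add_right:
  assumes "f \<in> fdual C" "g \<in> fdual CM" "g' \<in> fdual CM"
  shows "f \<star> (g + g') = f \<star> g + f \<star> g'"
proof
  fix \<phi> show "(f \<star> (g + g')) \<phi> = (f \<star> g + f \<star> g') \<phi>"
  proof (cases "\<phi> \<in> CM")
    case True
    have "(f \<star> (g + g')) \<phi> = f ((\<lambda>a. g (coslice A M \<phi> a)) + (\<lambda>a. g' (coslice A M \<phi> a)))"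
      using assms True fun_vs.subspace_add[OF fdual_subspace, of g CM g']
      by (simp add: dact_apply plus_fun_def)
    then show ?thesis using assms True by (simp add: fdual_add[OF assms(1)] contract_in_C dact_apply)
  qed (simp add: dact_outside)
qed

lemma dact_scale_left:
  assumes "f \<in> fdual C" "g \<in> fdual CM"
  shows "fscale c f \<star> g = fscale c (f \<star> g)"
proof
  fix \<phi> show "(fscale c f \<star> g) \<phi> = fscale c (f \<star> g) \<phi>"
    using assms fun_vs.subspace_scale[OF fdual_subspace, of f C c]
    by (cases "\<phi> \<in> CM") (simp_all add: dact_apply dact_outside fscale_def)
qed

lemma dact_scale_right:
  assumes "f \<in> fdual C" "g \<in> fdual CM"
  shows "f \<star> fscale c g = fscale c (f \<star> g)"
proof
  fix \<phi> show "(f \<star> fscale c g) \<phi> = fscale c (f \<star> g) \<phi>"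
  proof (cases "\<phi> \<in> CM")
    case True
    have "(f \<star> fscale c g) \<phi> = f (fscale c (\<lambda>a. g (coslice A M \<phi> a)))"
      using assms True fun_vs.subspace_scale[OF fdual_subspace, of g CM c]
      by (simp add: dact_apply fscale_def)
    also have "\<dots> = c * f (\<lambda>a. g (coslice A M \<phi> a))"
      using assms True by (simp add: fdual_scale[OF assms(1)] contract_in_C)
    finally show ?thesis using assms True by (simp add: dact_apply)
  qed (simp add: dact_outside fscale_def)
qed

lemma ev_alg_fdual: "ev_alg C a \<in> fdual C"
  using fun_vs.subspace_add[OF C_subspace] fun_vs.subspace_scale[OF C_subspace]
  by (simp add: fdual_def ev_alg_def)

lemma ev_alg_dact:
  assumes "g \<in> fdual CM"
  shows "ev_alg C a \<star> g = (\<lambda>\<phi>. if \<phi> \<in> CM then g (coslice A M \<phi> a) else 0)"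
proof
  fix \<phi> show "(ev_alg C a \<star> g) \<phi> = (if \<phi> \<in> CM then g (coslice A M \<phi> a) else 0)"
  proof (cases "\<phi> \<in> CM")
    case True
    then show ?thesis using assms by (simp add: dact_apply ev_alg_fdual) (simp add: ev_alg_def contract_in_C)
  qed (simp add: dact_outside)
qed

lemma coslice_one: "\<phi> \<in> CM \<Longrightarrow> coslice A M \<phi> \<one> = \<phi>"
  using mdual_outside[OF cotens_mdual] by (auto simp: fun_eq_iff coact_def act_one)

lemma one_dact:
  assumes "g \<in> fdual CM" shows "ev_alg C \<one> \<star> g = g"
proof
  fix \<phi> show "(ev_alg C \<one> \<star> g) \<phi> = g \<phi>"
  proof (cases "\<phi> \<in> CM")
    case True
    then show ?thesis using assms by (simp add: ev_alg_dact coslice_one)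
  qed (simp add: dact_outside fdual_outside[OF assms])
qed

end

lemma kmodule_setting:
  "kmodule A M \<Longrightarrow> subcoalgebra A C \<Longrightarrow> comodule_setting A M C"
  by (simp add: comodule_setting_def comodule_setting_axioms_def)

text \<open>By the counit axiom \<open>C \<box> A\<degree> = C\<close>, so the algebra structure of \<open>C\<^sup>*\<close> is the special case
  \<open>M = A\<close> of its action on duals of cotensor products (\<open>dual_alg_mult\<close>).\<close>

lemma cotens_reg:
  assumes A: "kalgebra A" and C: "subcoalgebra A C"
  shows "cotens A C (reg A) = C"
proof
  interpret reg: kmodule A "reg A" by (rule kmodule_reg) fact
  show "C \<subseteq> cotens A C (reg A)"
    using subcoalgebraD(1,3)[OF C] tensor_mono[OF order.refl subcoalgebraD(1)[OF C]]
    by (auto simp: cotens_def findual_reg[OF A] comult_eq_coact_reg)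
  show "cotens A C (reg A) \<subseteq> C"
  proof
    fix \<phi> assume "\<phi> \<in> cotens A C (reg A)"
    then have \<phi>: "\<phi> \<in> findual A (reg A)" "coact A (reg A) \<phi> \<in> tensor C (findual A (reg A))"
      by (auto simp: cotens_def)
    \<comment> \<open>Evaluation at \<open>1\<close> is the counit.\<close>
    define \<epsilon> where "\<epsilon> = (\<lambda>\<psi>. if \<psi> \<in> findual A (reg A) then \<psi> \<one>\<^bsub>A\<^esub> else 0)"
    have "\<epsilon> \<in> fdual (findual A (reg A))"
      using reg.findual_subspace
      by (simp add: fdual_def \<epsilon>_def fun_vs.subspace_add fun_vs.subspace_scale)
    then have "(\<lambda>a. \<epsilon> (coslice A (reg A) \<phi> a)) \<in> C"
      by (rule tensor_contract(1)[OF subcoalgebraD(2)[OF C] reg.findual_subspace \<phi>(2)])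
    also have "(\<lambda>a. \<epsilon> (coslice A (reg A) \<phi> a)) = \<phi>"
    proof
      fix a show "\<epsilon> (coslice A (reg A) \<phi> a) = \<phi> a"
        using reg.coslice_findual[OF \<phi>(1), of a] reg.mdual_outside[of \<phi> a] \<phi>(1)
        by (cases "a \<in> carrier A") (simp_all add: \<epsilon>_def findual_def)
    qed
    finally show "\<phi> \<in> C" .
  qed
qed

lemma dual_alg_simps [simp]:
  "carrier (dual_alg A C) = fdual C" "\<zero>\<^bsub>dual_alg A C\<^esub> = 0"
  "f \<oplus>\<^bsub>dual_alg A C\<^esub> g = f + g" "c \<odot>\<^bsub>dual_alg A C\<^esub> f = fscale c f"
  "\<one>\<^bsub>dual_alg A C\<^esub> = ev_alg C \<one>\<^bsub>A\<^esub>"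
  by (simp_all add: dual_alg_def ev_alg_def)

lemma cotens_dual_simps [simp]:
  "carrier (cotens_dual A C M) = fdual (cotens A C M)" "\<zero>\<^bsub>cotens_dual A C M\<^esub> = 0"
  "f \<oplus>\<^bsub>cotens_dual A C M\<^esub> g = f + g"
  by (simp_all add: cotens_dual_def)

lemma dual_alg_mult:
  assumes "kalgebra A" "subcoalgebra A C"
  shows "f \<otimes>\<^bsub>dual_alg A C\<^esub> g = f \<odot>\<^bsub>cotens_dual A C (reg A)\<^esub> g"
  by (auto simp: dual_alg_def cotens_dual_def cotens_reg[OF assms] comult_eq_coact_reg fun_eq_iff)

context comodule_setting begin

lemma regular_setting: "comodule_setting A (reg A) C"
  by (rule kmodule_setting[OF kmodule_reg[OF kalgebra_axioms] C])

lemma dual_alg_mult_apply: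
  assumes "\<phi> \<in> C" "f \<in> fdual C" "g \<in> fdual C"
  shows "(f \<otimes>\<^bsub>dual_alg A C\<^esub> g) \<phi> = f (\<lambda>a. g (coslice A (reg A) \<phi> a))"
  using comodule_setting.dact_apply[OF regular_setting] assms
  by (simp add: dual_alg_mult[OF kalgebra_axioms C] cotens_reg[OF kalgebra_axioms C])

lemma dual_alg_mult_closed:
  "f \<in> fdual C \<Longrightarrow> g \<in> fdual C \<Longrightarrow> f \<otimes>\<^bsub>dual_alg A C\<^esub> g \<in> fdual C"
  using comodule_setting.dact_closed[OF regular_setting]
  by (simp add: dual_alg_mult[OF kalgebra_axioms C] cotens_reg[OF kalgebra_axioms C])

text \<open>Both sides evaluate at \<open>\<phi>\<close> to \<open>f (a \<mapsto> g (b \<mapsto> h (x \<mapsto> \<phi> (a b x))))\<close>.\<close>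

lemma dact_assoc:
  assumes f: "f \<in> fdual C" and g: "g \<in> fdual C" and h: "h \<in> fdual CM"
  shows "(f \<otimes>\<^bsub>dual_alg A C\<^esub> g) \<star> h = f \<star> g \<star> h"
proof
  fix \<phi> show "((f \<otimes>\<^bsub>dual_alg A C\<^esub> g) \<star> h) \<phi> = (f \<star> g \<star> h) \<phi>"
  proof (cases "\<phi> \<in> CM")
    case \<phi>: True
    define u where "u = (\<lambda>a. h (coslice A M \<phi> a))"
    have u: "u \<in> C" unfolding u_def using contract_in_C \<phi> h by blast
    have "coslice A (reg A) u a b = h (coslice A M (coslice A M \<phi> a) b)" for a b
    proof (cases "a \<in> carrier A \<and> b \<in> carrier A")
      case True
      then show ?thesis by (simp add: u_def coslice_coslice)
    next
      case False
      then have "coslice A M (coslice A M \<phi> a) b = 0" by (auto simp: fun_eq_iff coact_def)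
      then show ?thesis using False fdual_0[OF h] by (auto simp: coact_def zero_fun_def)
    qed
    then have "coslice A (reg A) u a = (\<lambda>b. h (coslice A M (coslice A M \<phi> a) b))" for a by blast
    then show ?thesis
      using \<phi> f g h u dual_alg_mult_closed[OF f g]
      by (simp add: dact_apply dact_closed dual_alg_mult_apply coslice_cotens flip: u_def)
  qed (simp add: dact_outside)
qed

end

lemma abelian_group_function_space:
  assumes "fun_vs.subspace V" "carrier G = V" "\<zero>\<^bsub>G\<^esub> = 0" "\<And>f g. f \<oplus>\<^bsub>G\<^esub> g = f + g"
  shows "abelian_group G"
  by (rule abelian_groupI)
    (use assms in \<open>auto simp: add.assoc intro: add.commute fun_vs.subspace_0 fun_vs.subspace_add
      bexI[of _ "- x" for x] fun_vs.subspace_neg\<close>)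

lemma kalgebra_dual_alg:
  assumes A: "kalgebra A" and C: "subcoalgebra A C" shows "kalgebra (dual_alg A C)"
proof -
  interpret r: comodule_setting A "reg A" C
    by (rule kmodule_setting[OF kmodule_reg[OF A] C])
  note [simp] = cotens_reg[OF A C]
  note mult = dual_alg_mult[OF A C]
  have one: "ev_alg C \<one>\<^bsub>A\<^esub> \<in> fdual C" by (rule r.ev_alg_fdual)
  have r_one: "f \<odot>\<^bsub>cotens_dual A C (reg A)\<^esub> ev_alg C \<one>\<^bsub>A\<^esub> = f" if f: "f \<in> fdual C" for f
  proof
    fix \<phi> show "(f \<odot>\<^bsub>cotens_dual A C (reg A)\<^esub> ev_alg C \<one>\<^bsub>A\<^esub>) \<phi> = f \<phi>"
    proof (cases "\<phi> \<in> C")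
      case True
      have "(\<lambda>a. ev_alg C \<one>\<^bsub>A\<^esub> (coslice A (reg A) \<phi> a)) = \<phi>"
        using True r.cotens_mdual[of \<phi>] r.mdual_outside[of \<phi>] coslice_subcoalgebra[OF C True]
        by (auto simp: fun_eq_iff ev_alg_def coact_def)
      then show ?thesis using True f one by (simp add: r.dact_apply)
    qed (use r.dact_outside fdual_outside[OF f] in simp)
  qed
  have "monoid (dual_alg A C)"
    using r.dact_closed r.dact_assoc r.one_dact one r_one
    by (intro monoidI) (simp_all add: mult)
  then have "ring (dual_alg A C)"
    using r.dact_add_left r.dact_add_right
    by (intro ringI abelian_group_function_space[OF fdual_subspace]) (simp_all add: mult)
  then show ?thesis
    using r.dact_scale_left r.dact_scale_right fun_vs.subspace_scale[OF fdual_subspace]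
    by (intro kalgebra.intro kalgebra_axioms.intro)
      (simp_all add: mult fun_eq_iff algebra_simps)
qed

lemma (in comodule_setting) kmodule_cotens_dual: "kmodule (dual_alg A C) (cotens_dual A C M)"
proof -
  note E = kalgebra_dual_alg[OF kalgebra_axioms C]
  have "left_module (dual_alg A C) (cotens_dual A C M)"
    using dact_closed dact_add_left dact_add_right dact_assoc one_dact
    by (intro left_module.intro left_module_axioms.intro kalgebra.axioms(1)[OF E]
        abelian_group_function_space[OF fdual_subspace]) simp_all
  then show ?thesis using E by (rule kmodule.intro)
qed

section \<open>Structure algebras and localised modules\<close>

lemma subalgebraI:
  assumes E: "kalgebra E" and "B \<subseteq> carrier E" "\<one>\<^bsub>E\<^esub> \<in> B"
    "\<And>x y. x \<in> B \<Longrightarrow> y \<in> B \<Longrightarrow> x \<otimes>\<^bsub>E\<^esub> y \<in> B" "\<And>x y. x \<in> B \<Longrightarrow> y \<in> B \<Longrightarrow> x \<oplus>\<^bsub>E\<^esub> y \<in> B"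
    and scl: "\<And>c x. x \<in> B \<Longrightarrow> c \<odot>\<^bsub>E\<^esub> x \<in> B"
  shows "subalgebra E B"
proof -
  interpret kalgebra E by fact
  have "\<ominus>\<^bsub>E\<^esub> x \<in> B" if x: "x \<in> B" for x
  proof -
    have xE: "x \<in> carrier E" using x assms(2) by auto
    have "0 \<odot>\<^bsub>E\<^esub> x \<oplus>\<^bsub>E\<^esub> 0 \<odot>\<^bsub>E\<^esub> x = 0 \<odot>\<^bsub>E\<^esub> x \<oplus>\<^bsub>E\<^esub> \<zero>\<^bsub>E\<^esub>"
      using scl_l_distr[OF xE, of 0 0] xE by (simp add: scl_closed)
    then have "0 \<odot>\<^bsub>E\<^esub> x = \<zero>\<^bsub>E\<^esub>" using xE add.l_cancel scl_closed by blast
    then have "(-1) \<odot>\<^bsub>E\<^esub> x \<oplus>\<^bsub>E\<^esub> x = \<zero>\<^bsub>E\<^esub>"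
      using scl_l_distr[OF xE, of "-1" 1] xE by (simp add: scl_one)
    then have "\<ominus>\<^bsub>E\<^esub> x = (-1) \<odot>\<^bsub>E\<^esub> x" using xE scl_closed minus_equality by blast
    then show ?thesis using scl[OF x] by simp
  qed
  then have "subring B E" using assms by (intro subringI) auto
  then show ?thesis using scl by (simp add: subalgebra_def)
qed

lemma subalgebraD:
  assumes "subalgebra E B"
  shows "B \<subseteq> carrier E" "\<one>\<^bsub>E\<^esub> \<in> B" "x \<in> B \<Longrightarrow> y \<in> B \<Longrightarrow> x \<otimes>\<^bsub>E\<^esub> y \<in> B"
    "x \<in> B \<Longrightarrow> y \<in> B \<Longrightarrow> x \<oplus>\<^bsub>E\<^esub> y \<in> B" "x \<in> B \<Longrightarrow> c \<odot>\<^bsub>E\<^esub> x \<in> B"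
  using assms subringE[of B E] by (auto simp: subalgebra_def)

lemma subalgebra_carrier: "kalgebra E \<Longrightarrow> subalgebra E (carrier E)"
  by (rule subalgebraI)
    (auto simp: kalgebra.scl_closed kalgebra.axioms(1) ring.ring_simprules monoid.one_closed ring.is_monoid)

lemma subalgebra_Inter:
  assumes E: "kalgebra E" and S: "S \<subseteq> carrier E"
  shows "subalgebra E (\<Inter>{B. subalgebra E B \<and> S \<subseteq> B})"
proof (rule subalgebraI[OF E])
  show "\<Inter>{B. subalgebra E B \<and> S \<subseteq> B} \<subseteq> carrier E"
    using subalgebra_carrier[OF E] S by blast
qed (auto dest: subalgebraD)

lemma kalgebra_subalgebra:
  assumes E: "kalgebra E" and B: "subalgebra E B"
  shows "kalgebra (E\<lparr>carrier := B\<rparr>)"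
proof -
  interpret kalgebra E by fact
  have BE: "x \<in> carrier E" if "x \<in> B" for x using that subalgebraD(1)[OF B] by auto
  have "ring (E\<lparr>carrier := B\<rparr>)" using B subring_is_ring by (simp add: subalgebra_def)
  then show ?thesis
    using subalgebraD(5)[OF B] BE
    by (intro kalgebra.intro kalgebra_axioms.intro)
      (simp_all add: scl_l_distr scl_r_distr scl_assoc scl_one scl_mult_l scl_mult_r)
qed

lemma kmodule_restrict:
  assumes N: "kmodule E N" and B: "subalgebra E B"
    and L: "additive_subgroup L N" "\<And>a x. a \<in> B \<Longrightarrow> x \<in> L \<Longrightarrow> a \<odot>\<^bsub>N\<^esub> x \<in> L"
  shows "kmodule (E\<lparr>carrier := B\<rparr>) (N\<lparr>carrier := L\<rparr>)"
proof -
  interpret kmodule E N by fact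
  interpret L: additive_subgroup L N by fact
  have sub: "x \<in> B \<Longrightarrow> x \<in> carrier E" "y \<in> L \<Longrightarrow> y \<in> carrier N" for x y
    using subalgebraD(1)[OF B] L.a_subset by auto
  have E': "kalgebra (E\<lparr>carrier := B\<rparr>)" by (rule kalgebra_subalgebra[OF kalgebra_axioms B])
  have "abelian_group (N\<lparr>carrier := L\<rparr>)"
  proof (rule abelian_groupI)
    fix x assume "x \<in> carrier (N\<lparr>carrier := L\<rparr>)"
    then show "\<exists>y\<in>carrier (N\<lparr>carrier := L\<rparr>). y \<oplus>\<^bsub>N\<lparr>carrier := L\<rparr>\<^esub> x = \<zero>\<^bsub>N\<lparr>carrier := L\<rparr>\<^esub>"
      using sub by (intro bexI[of _ "\<ominus>\<^bsub>N\<^esub> x"]) (auto simp: M.l_neg)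
  qed (use sub in \<open>auto simp: M.add.m_ac\<close>)
  then have "left_module (E\<lparr>carrier := B\<rparr>) (N\<lparr>carrier := L\<rparr>)"
    using sub L(2) by (intro left_module.intro left_module_axioms.intro kalgebra.axioms(1)[OF E'])
      (simp_all add: act_l_distr act_r_distr act_assoc act_one)
  then show ?thesis using E' by (rule kmodule.intro)
qed

lemma S_set_subset: "S_set A C \<subseteq> fdual C"
  by (auto simp: S_set_def)

lemma str_alg_simps [simp]:
  "\<zero>\<^bsub>str_alg A C\<^esub> = 0" "f \<oplus>\<^bsub>str_alg A C\<^esub> g = f + g"
  "c \<odot>\<^bsub>str_alg A C\<^esub> f = fscale c f" "\<one>\<^bsub>str_alg A C\<^esub> = ev_alg C \<one>\<^bsub>A\<^esub>"
  "monoid.mult (str_alg A C) = monoid.mult (dual_alg A C)"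
  by (simp_all add: str_alg_def)

lemma str_alg_subalgebra:
  assumes "kalgebra A" "subcoalgebra A C"
  shows "subalgebra (dual_alg A C) (carrier (str_alg A C))"
  using subalgebra_Inter[OF kalgebra_dual_alg[OF assms], of "S_set A C"] S_set_subset[of A C]
  by (simp add: str_alg_def)

lemma str_alg_least: "subalgebra (dual_alg A C) B \<Longrightarrow> S_set A C \<subseteq> B \<Longrightarrow> carrier (str_alg A C) \<subseteq> B"
  by (auto simp: str_alg_def)

lemma str_alg_eq: "str_alg A C = (dual_alg A C)\<lparr>carrier := carrier (str_alg A C)\<rparr>"
  by (simp add: str_alg_def)

lemma S_set_str_alg: "S_set A C \<subseteq> carrier (str_alg A C)"
  by (auto simp: str_alg_def)

text \<open>Since smaller subcoalgebras have more left ideals in \<open>Fil\<close>, generators of \<open>A\<^sub>C\<close> and of localised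
  modules restrict to generators.\<close>

lemma Fil_mono:
  assumes "C' \<subseteq> C" "fun_vs.subspace C'" shows "Fil A C \<subseteq> Fil A C'"
proof
  fix I assume I: "I \<in> Fil A C"
  have "0 \<in> Zo A I" using I by (auto simp: Fil_def)
  then show "I \<in> Fil A C'"
    using I assms(1) fun_vs.subspace_0[OF assms(2)] by (auto simp: Fil_def)
qed

lemma loc_simps [simp]:
  "\<zero>\<^bsub>loc A C M\<^esub> = 0" "f \<oplus>\<^bsub>loc A C M\<^esub> g = f + g"
  "smult (loc A C M) = smult (cotens_dual A C M)"
  by (simp_all add: loc_def)

lemma T_set_subset: "T_set A C M \<subseteq> fdual (cotens A C M)"
  by (auto simp: T_set_def)

context comodule_setting begin

lemma str_alg_fdual: "f \<in> carrier (str_alg A C) \<Longrightarrow> f \<in> fdual C"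
  using subalgebraD(1)[OF str_alg_subalgebra[OF kalgebra_axioms C]] by auto

lemma kmodule_cotens_dual_str: "kmodule (str_alg A C) (cotens_dual A C M)"
proof -
  have "additive_subgroup (fdual CM) (cotens_dual A C M)"
    using kmodule.lsubmodule_carrier[OF kmodule_cotens_dual] by (simp add: lsubmodule_def)
  from kmodule_restrict[OF kmodule_cotens_dual str_alg_subalgebra[OF kalgebra_axioms C] this]
  show ?thesis using str_alg_fdual dact_closed
    by (simp flip: str_alg_eq) (simp add: cotens_dual_def)
qed

lemma loc_submodule: "lsubmodule (str_alg A C) (cotens_dual A C M) (carrier (loc A C M))"
  using kmodule.lspan_submodule[OF kmodule_cotens_dual_str] T_set_subset[of A C M]
  by (simp add: loc_def)

lemma loc_fdual: "\<xi> \<in> carrier (loc A C M) \<Longrightarrow> \<xi> \<in> fdual CM"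
  using kmodule.ksubspaceD(1)[OF kmodule_cotens_dual_str
      kmodule.lsubmoduleD(1)[OF kmodule_cotens_dual_str loc_submodule]] by auto

lemma T_set_loc: "T_set A C M \<subseteq> carrier (loc A C M)"
  using kmodule.lspan_superset[OF kmodule_cotens_dual_str] by (simp add: loc_def)

lemma kmodule_loc: "kmodule (str_alg A C) (loc A C M)"
proof -
  have "kmodule ((dual_alg A C)\<lparr>carrier := carrier (str_alg A C)\<rparr>)
      ((cotens_dual A C M)\<lparr>carrier := carrier (loc A C M)\<rparr>)"
    using loc_submodule
    by (intro kmodule_restrict[OF kmodule_cotens_dual] str_alg_subalgebra[OF kalgebra_axioms C])
      (auto simp: lsubmodule_def)
  then show ?thesis by (simp add: loc_def flip: str_alg_eq)
qed

lemma loc_zero: "0 \<in> carrier (loc A C M)"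
  and loc_add: "\<xi> \<in> carrier (loc A C M) \<Longrightarrow> \<eta> \<in> carrier (loc A C M) \<Longrightarrow> \<xi> + \<eta> \<in> carrier (loc A C M)"
  and loc_act: "f \<in> carrier (str_alg A C) \<Longrightarrow> \<xi> \<in> carrier (loc A C M) \<Longrightarrow> f \<star> \<xi> \<in> carrier (loc A C M)"
proof -
  interpret N: kmodule "str_alg A C" "loc A C M" by (rule kmodule_loc)
  show "0 \<in> carrier (loc A C M)" using N.M.zero_closed by simp
  show "\<xi> \<in> carrier (loc A C M) \<Longrightarrow> \<eta> \<in> carrier (loc A C M) \<Longrightarrow> \<xi> + \<eta> \<in> carrier (loc A C M)"
    using N.M.a_closed[of \<xi> \<eta>] by simp
  show "f \<in> carrier (str_alg A C) \<Longrightarrow> \<xi> \<in> carrier (loc A C M) \<Longrightarrow> f \<star> \<xi> \<in> carrier (loc A C M)"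
    using N.act_closed[of f \<xi>] by simp
qed

lemma loc_induct [consumes 1, case_names gen zero add act]:
  assumes \<xi>: "\<xi> \<in> carrier (loc A C M)"
    and "\<And>\<xi>. \<xi> \<in> T_set A C M \<Longrightarrow> P \<xi>" and "P 0"
    and "\<And>\<xi> \<eta>. \<xi> \<in> carrier (loc A C M) \<Longrightarrow> \<eta> \<in> carrier (loc A C M) \<Longrightarrow> P \<xi> \<Longrightarrow> P \<eta> \<Longrightarrow> P (\<xi> + \<eta>)"
    and "\<And>f \<xi>. f \<in> carrier (str_alg A C) \<Longrightarrow> \<xi> \<in> carrier (loc A C M) \<Longrightarrow> P \<xi> \<Longrightarrow> P (f \<star> \<xi>)"
  shows "P \<xi>"
proof -
  interpret N: kmodule "str_alg A C" "cotens_dual A C M" by (rule kmodule_cotens_dual_str)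
  have "lsubmodule (str_alg A C) (cotens_dual A C M) {\<xi> \<in> carrier (loc A C M). P \<xi>}"
    using assms(3-5) loc_zero loc_add loc_act loc_fdual by (intro N.lsubmoduleI) auto
  then have "lspan (str_alg A C) (cotens_dual A C M) (T_set A C M) \<subseteq> {\<xi> \<in> carrier (loc A C M). P \<xi>}"
    using assms(2) T_set_loc by (intro N.lspan_least) auto
  then show ?thesis using \<xi> by (auto simp: loc_def)
qed

lemma kscale_loc:
  assumes "\<xi> \<in> fdual CM"
  shows "kscale (str_alg A C) (loc A C M) c \<xi> = fscale c \<xi>"
  using assms by (simp add: kscale_def dact_scale_left ev_alg_fdual one_dact)

text \<open>The elements that vanish on all translates of \<open>\<phi>\<close> form a submodule because translates of
  translates are translates; together with the next lemma this is a supply of submodules of finite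
  codimension which proves that localised modules are RFD.\<close>

lemma loc_orbit_zero_submodule:
  assumes \<phi>: "\<phi> \<in> CM"
  shows "lsubmodule (str_alg A C) (loc A C M)
    {\<xi> \<in> carrier (loc A C M). \<forall>a. \<xi> (coslice A M \<phi> a) = 0}"
proof -
  interpret N: kmodule "str_alg A C" "loc A C M" by (rule kmodule_loc)
  show ?thesis
  proof (rule N.lsubmoduleI)
    fix f \<xi> assume f: "f \<in> carrier (str_alg A C)"
      and "\<xi> \<in> {\<xi> \<in> carrier (loc A C M). \<forall>a. \<xi> (coslice A M \<phi> a) = 0}"
    then have \<xi>: "\<xi> \<in> carrier (loc A C M)" "\<And>a. \<xi> (coslice A M \<phi> a) = 0" by auto
    have "\<xi> (coslice A M (coslice A M \<phi> a) b) = 0" for a b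
    proof (cases "a \<in> carrier A \<and> b \<in> carrier A")
      case True
      then show ?thesis using \<xi>(2) by (simp add: coslice_coslice)
    next
      case False
      then have "coslice A M (coslice A M \<phi> a) b = 0" by (auto simp: fun_eq_iff coact_def)
      then show ?thesis using fdual_0[OF loc_fdual[OF \<xi>(1)]] by simp
    qed
    then have "(f \<star> \<xi>) (coslice A M \<phi> a) = 0" for a
      using fdual_0[OF str_alg_fdual[OF f]] coslice_cotens[OF \<phi>]
      by (simp add: dact_apply str_alg_fdual[OF f] loc_fdual[OF \<xi>(1)] zero_fun_def)
    then show "f \<odot>\<^bsub>loc A C M\<^esub> \<xi> \<in> {\<xi> \<in> carrier (loc A C M). \<forall>a. \<xi> (coslice A M \<phi> a) = 0}"
      using loc_act[OF f \<xi>(1)] by simp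
  qed (auto simp: loc_zero loc_add)
qed

text \<open>If the coaction sends \<open>\<phi>\<close> to \<open>\<Sum> c\<^sub>i \<otimes> \<phi>\<^sub>i\<close>, the translates of \<open>\<phi>\<close> lie in the span of the
  finitely many \<open>\<phi>\<^sub>i\<close>.\<close>

lemma loc_orbit_zero_fin_codim:
  assumes \<phi>: "\<phi> \<in> CM"
  shows "fin_codim (str_alg A C) (loc A C M)
    {\<xi> \<in> carrier (loc A C M). \<forall>a. \<xi> (coslice A M \<phi> a) = 0}"
proof -
  interpret N: kmodule "str_alg A C" "loc A C M" by (rule kmodule_loc)
  obtain ts where ts: "set ts \<subseteq> C \<times> CM" "coact A M \<phi> = (\<Sum>(v, w)\<leftarrow>ts. pure_tensor v w)"
    using tensor_listE[OF C_subspace coact_cotens[OF \<phi>]] .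
  define G where "G = (\<lambda>w \<xi>. if \<xi> \<in> carrier (loc A C M) then \<xi> w else 0 :: 'k)"
  show ?thesis
  proof (rule N.fin_codim_of_functionals[OF N.lsubmoduleD(1)[OF loc_orbit_zero_submodule[OF \<phi>]]])
    show "set (map (\<lambda>(v, w). G w) ts) \<subseteq> mdual (str_alg A C) (loc A C M)"
      using N.kscale_closed by (auto simp: mdual_def G_def loc_add kscale_loc loc_fdual)
    fix \<xi> assume \<xi>: "\<xi> \<in> carrier (loc A C M)" and 0: "\<forall>g\<in>set (map (\<lambda>(v, w). G w) ts). g \<xi> = 0"
    have w: "\<xi> (snd p) = 0" if "p \<in> set ts" for p
    proof -
      have "G (snd p) \<in> set (map (\<lambda>(v, w). G w) ts)" using that by (force simp: split_def)
      then have "G (snd p) \<xi> = 0" using 0 by blast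
      then show ?thesis using \<xi> by (simp add: G_def)
    qed
    have "\<xi> (coslice A M \<phi> a) = 0" for a
    proof -
      have "coslice A M \<phi> a = (\<lambda>x. \<Sum>p\<leftarrow>ts. fst p a * snd p x)"
        by (simp add: ts(2) sum_list_pure_tensor_apply) (simp add: split_def)
      moreover have "\<xi> (\<lambda>x. \<Sum>p\<leftarrow>ts. fst p a * snd p x) = (\<Sum>p\<leftarrow>ts. fst p a * \<xi> (snd p))"
        by (rule fdual_sum_list'[OF cotens_subspace loc_fdual[OF \<xi>]]) (use ts(1) in auto)
      moreover have "(\<Sum>p\<leftarrow>ts. fst p a * \<xi> (snd p)) = (\<Sum>p\<leftarrow>ts. 0)"
        using w by (intro arg_cong[of _ _ sum_list] map_cong) auto
      ultimately show ?thesis by simp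
    qed
    then show "\<xi> \<in> {\<xi> \<in> carrier (loc A C M). \<forall>a. \<xi> (coslice A M \<phi> a) = 0}" using \<xi> by simp
  qed
qed

lemma RFD_loc: "RFD_module (str_alg A C) (loc A C M)"
proof -
  interpret N: kmodule "str_alg A C" "loc A C M" by (rule kmodule_loc)
  let ?F = "{N. lsubmodule (str_alg A C) (loc A C M) N \<and> fin_codim (str_alg A C) (loc A C M) N}"
  let ?K = "\<lambda>\<phi>. {\<xi> \<in> carrier (loc A C M). \<forall>a. \<xi> (coslice A M \<phi> a) = 0}"
  have K: "?K \<phi> \<in> ?F" if "\<phi> \<in> CM" for \<phi>
    using that loc_orbit_zero_submodule loc_orbit_zero_fin_codim by simp
  have "\<xi> = 0" if "\<xi> \<in> \<Inter>?F" for \<xi>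
  proof
    fix \<phi> show "\<xi> \<phi> = 0 \<phi>"
    proof (cases "\<phi> \<in> CM")
      case True
      then have "\<xi> \<in> ?K \<phi>" using that K by blast
      then have "\<xi> (coslice A M \<phi> \<one>) = 0" by blast
      then show ?thesis by (simp add: coslice_one[OF True])
    next
      case False
      have "\<xi> \<in> ?K 0" using that K[OF fun_vs.subspace_0[OF cotens_subspace]] by blast
      then show ?thesis using fdual_outside[OF loc_fdual False] by simp
    qed
  qed
  moreover have "0 \<in> \<Inter>?F" using N.ksubspaceD(2)[OF N.lsubmoduleD(1)] by auto
  ultimately show ?thesis by (auto simp: RFD_module_def)
qed

lemma Fil_carrier: "carrier A \<in> Fil A C"
proof -
  interpret reg: kmodule A "reg A" by (rule kmodule_reg) unfold_locales
  have "\<phi> = 0" if "\<phi> \<in> C" "\<forall>a\<in>carrier A. \<phi> a = 0" for \<phi>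
  proof
    fix a show "\<phi> a = 0 a"
      using that subcoalgebraD(1)[OF C] reg.mdual_outside[of \<phi> a]
      by (cases "a \<in> carrier A") (auto simp: findual_alg_def)
  qed
  moreover have "0 \<in> C" by (rule fun_vs.subspace_0[OF C_subspace])
  ultimately have "Zo A (carrier A) \<inter> C = {0}"
    using subcoalgebraD(1)[OF C] by (auto simp: Zo_def)
  then show ?thesis using reg.lsubmodule_carrier by (simp add: Fil_def)
qed

lemma ev_mod_fdual: "ev_mod A C M x \<in> fdual CM"
  using fun_vs.subspace_add[OF cotens_subspace] fun_vs.subspace_scale[OF cotens_subspace]
  by (simp add: fdual_def ev_mod_def)

lemma ev_alg_ev_mod:
  "a \<in> carrier A \<Longrightarrow> x \<in> carrier M \<Longrightarrow> ev_alg C a \<star> ev_mod A C M x = ev_mod A C M (a \<odot>\<^bsub>M\<^esub> x)"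
  by (subst ev_alg_dact[OF ev_mod_fdual]) (auto simp: ev_mod_def coslice_cotens fun_eq_iff)

lemma ev_mod_T_set: "x \<in> carrier M \<Longrightarrow> ev_mod A C M x \<in> T_set A C M"
  unfolding T_set_def using Fil_carrier
  by (auto simp: ev_mod_fdual ev_alg_ev_mod act_closed intro!: bexI[of _ "carrier A"])

lemma ev_mod_loc: "x \<in> carrier M \<Longrightarrow> ev_mod A C M x \<in> carrier (loc A C M)"
  using ev_mod_T_set T_set_loc by blast

lemma ev_alg_str_alg:
  assumes "a \<in> carrier A" shows "ev_alg C a \<in> carrier (str_alg A C)"
proof -
  interpret r: comodule_setting A "reg A" C by (rule regular_setting)
  have ev: "ev_mod A C (reg A) = ev_alg C"
    by (auto simp: fun_eq_iff ev_mod_def ev_alg_def cotens_reg[OF kalgebra_axioms C])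
  have "ev_alg C a \<in> S_set A C"
    using r.ev_mod_T_set[of a] assms
    by (simp add: T_set_def S_set_def ev dual_alg_mult[OF kalgebra_axioms C] cotens_reg[OF kalgebra_axioms C])
  then show ?thesis using S_set_str_alg by blast
qed

end

section \<open>Restriction to a smaller subcoalgebra\<close>

context comodule_setting begin

context
  fixes C' assumes C': "subcoalgebra A C'" and sub: "C' \<subseteq> C"
begin

lemma smaller_setting: "comodule_setting A M C'"
  by (rule kmodule_setting[OF kmodule_axioms C'])

lemma restr_cotens_fdual: "g \<in> fdual CM \<Longrightarrow> restr (cotens A C' M) g \<in> fdual (cotens A C' M)"
  using restr_fdual comodule_setting.cotens_subspace[OF smaller_setting] cotens_mono[OF sub] by blast

lemma restr_str_fdual: "f \<in> fdual C \<Longrightarrow> restr C' f \<in> fdual C'"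
  using restr_fdual subcoalgebraD(2)[OF C'] sub by blast

text \<open>Both sides are given by the same formula: for \<open>\<phi>\<close> in the smaller cotensor product, the translates
  of \<open>\<phi>\<close> and the function \<open>a \<mapsto> g (\<phi> (a _))\<close> lie in the smaller spaces too.\<close>

lemma restr_dact:
  assumes f: "f \<in> fdual C" and g: "g \<in> fdual CM"
  shows "restr (cotens A C' M) (f \<star> g) =
    restr C' f \<odot>\<^bsub>cotens_dual A C' M\<^esub> restr (cotens A C' M) g"
proof
  interpret s: comodule_setting A M C' by (rule smaller_setting)
  fix \<phi>
  show "restr (cotens A C' M) (f \<star> g) \<phi> =
    (restr C' f \<odot>\<^bsub>cotens_dual A C' M\<^esub> restr (cotens A C' M) g) \<phi>"
  proof (cases "\<phi> \<in> cotens A C' M")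
    case \<phi>: True
    have eq: "restr (cotens A C' M) g (coslice A M \<phi> a) = g (coslice A M \<phi> a)" for a
      using s.coslice_cotens[OF \<phi>] by (simp add: restr_def)
    have "(\<lambda>a. g (coslice A M \<phi> a)) \<in> C'"
      using s.contract_in_C[OF \<phi> restr_cotens_fdual[OF g]] by (simp add: eq)
    moreover have "\<phi> \<in> CM" using \<phi> cotens_mono[OF sub] by blast
    ultimately show ?thesis
      using \<phi> f g restr_str_fdual[OF f] restr_cotens_fdual[OF g]
      by (simp add: dact_apply s.dact_apply eq) (simp add: restr_def dact_apply)
  qed (simp add: restr_def s.dact_outside)
qed

end

end

lemma restr_str_alg:
  assumes A: "kalgebra A" and C: "subcoalgebra A C" and C': "subcoalgebra A C'" and sub: "C' \<subseteq> C"
    and f: "f \<in> carrier (str_alg A C)"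
  shows "restr C' f \<in> carrier (str_alg A C')"
proof -
  interpret r: comodule_setting A "reg A" C
    by (rule kmodule_setting[OF kmodule_reg[OF A] C])
  note E = kalgebra_dual_alg[OF A C]
  note B' = subalgebraD[OF str_alg_subalgebra[OF A C']]
  have mult: "restr C' (f \<otimes>\<^bsub>dual_alg A C\<^esub> g) = restr C' f \<otimes>\<^bsub>dual_alg A C'\<^esub> restr C' g"
    if "f \<in> fdual C" "g \<in> fdual C" for f g
    using r.restr_dact[OF C' sub] that
    by (simp add: dual_alg_mult[OF A C] dual_alg_mult[OF A C'] cotens_reg[OF A C] cotens_reg[OF A C'])
  have ev: "restr C' (ev_alg C a) = ev_alg C' a" for a
    using sub by (auto simp: restr_def ev_alg_def fun_eq_iff)
  have "subalgebra (dual_alg A C) {f \<in> fdual C. restr C' f \<in> carrier (str_alg A C')}"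
  proof (rule subalgebraI[OF E])
    show "\<one>\<^bsub>dual_alg A C\<^esub> \<in> {f \<in> fdual C. restr C' f \<in> carrier (str_alg A C')}"
      using B'(2) r.ev_alg_fdual by (simp add: ev)
  next
    fix f g assume f: "f \<in> {f \<in> fdual C. restr C' f \<in> carrier (str_alg A C')}"
      and g: "g \<in> {f \<in> fdual C. restr C' f \<in> carrier (str_alg A C')}"
    show "f \<otimes>\<^bsub>dual_alg A C\<^esub> g \<in> {f \<in> fdual C. restr C' f \<in> carrier (str_alg A C')}"
      using f g B'(3) r.dual_alg_mult_closed by (simp add: mult)
    have "restr C' (f + g) = restr C' f + restr C' g" by (auto simp: restr_def fun_eq_iff)
    then show "f \<oplus>\<^bsub>dual_alg A C\<^esub> g \<in> {f \<in> fdual C. restr C' f \<in> carrier (str_alg A C')}"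
      using f g B'(4)[of "restr C' f" "restr C' g"] by (simp add: fun_vs.subspace_add[OF fdual_subspace])
  next
    fix c f assume f: "f \<in> {f \<in> fdual C. restr C' f \<in> carrier (str_alg A C')}"
    have "restr C' (fscale c f) = fscale c (restr C' f)" by (auto simp: restr_def fun_eq_iff)
    then show "c \<odot>\<^bsub>dual_alg A C\<^esub> f \<in> {f \<in> fdual C. restr C' f \<in> carrier (str_alg A C')}"
      using f B'(5)[of "restr C' f"] by (simp add: fun_vs.subspace_scale[OF fdual_subspace])
  qed auto
  moreover have "S_set A C \<subseteq> {f \<in> fdual C. restr C' f \<in> carrier (str_alg A C')}"
  proof
    fix x assume "x \<in> S_set A C"
    then obtain I where x: "x \<in> fdual C" and I: "I \<in> Fil A C"
      "\<And>a. a \<in> I \<Longrightarrow> ev_alg C a \<otimes>\<^bsub>dual_alg A C\<^esub> x \<in> ev_alg C ` carrier A"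
      by (auto simp: S_set_def)
    have "ev_alg C' a \<otimes>\<^bsub>dual_alg A C'\<^esub> restr C' x \<in> ev_alg C' ` carrier A" if a: "a \<in> I" for a
    proof -
      obtain b where "b \<in> carrier A" "ev_alg C a \<otimes>\<^bsub>dual_alg A C\<^esub> x = ev_alg C b" using I(2)[OF a] by blast
      then show ?thesis using mult[OF r.ev_alg_fdual x, of a] by (metis ev imageI)
    qed
    moreover have "I \<in> Fil A C'" using I(1) Fil_mono[OF sub] subcoalgebraD(2)[OF C'] by blast
    moreover have "restr C' x \<in> fdual C'" using r.restr_str_fdual[OF C' sub x] .
    ultimately have "restr C' x \<in> S_set A C'" by (auto simp: S_set_def)
    then show "x \<in> {f \<in> fdual C. restr C' f \<in> carrier (str_alg A C')}" using x S_set_str_alg by auto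
  qed
  ultimately show ?thesis using f str_alg_least by blast
qed

lemma restr_ev_mod:
  "C' \<subseteq> C \<Longrightarrow> restr (cotens A C' M) (ev_mod A C M x) = ev_mod A C' M x"
  using cotens_mono[of C' C A M] by (auto simp: restr_def ev_mod_def fun_eq_iff)

context comodule_setting begin

lemma restr_loc:
  assumes C': "subcoalgebra A C'" and sub: "C' \<subseteq> C" and \<xi>: "\<xi> \<in> carrier (loc A C M)"
  shows "restr (cotens A C' M) \<xi> \<in> carrier (loc A C' M)"
proof -
  interpret s: comodule_setting A M C' by (rule smaller_setting[OF C' sub])
  show ?thesis
    using \<xi>
  proof (induction rule: loc_induct)
    case (gen \<xi>)
    then obtain I where \<xi>: "\<xi> \<in> fdual CM" and I: "I \<in> Fil A C"
      "\<And>a. a \<in> I \<Longrightarrow> ev_alg C a \<star> \<xi> \<in> ev_mod A C M ` carrier M"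
      by (auto simp: T_set_def)
    have "ev_alg C' a \<odot>\<^bsub>cotens_dual A C' M\<^esub> restr (cotens A C' M) \<xi> \<in> ev_mod A C' M ` carrier M"
      if a: "a \<in> I" for a
    proof -
      obtain x where x: "x \<in> carrier M" "ev_alg C a \<star> \<xi> = ev_mod A C M x" using I(2)[OF a] by blast
      have "restr C' (ev_alg C a) = ev_alg C' a"
        using sub by (auto simp: restr_def ev_alg_def fun_eq_iff)
      then show ?thesis
        using restr_dact[OF C' sub ev_alg_fdual \<xi>, of a] restr_ev_mod[OF sub] x by (metis imageI)
    qed
    moreover have "I \<in> Fil A C'" using I(1) Fil_mono[OF sub] subcoalgebraD(2)[OF C'] by blast
    ultimately have "restr (cotens A C' M) \<xi> \<in> T_set A C' M"
      using restr_cotens_fdual[OF C' sub \<xi>] by (auto simp: T_set_def)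
    then show ?case using s.T_set_loc by blast
  next
    case zero
    have "restr (cotens A C' M) 0 = 0" by (auto simp: restr_def fun_eq_iff)
    then show ?case using s.loc_zero by (simp only:)
  next
    case (add \<xi> \<eta>)
    have "restr (cotens A C' M) (\<xi> + \<eta>) = restr (cotens A C' M) \<xi> + restr (cotens A C' M) \<eta>"
      by (auto simp: restr_def fun_eq_iff)
    then show ?case using s.loc_add[OF add(3,4)] by (simp only:)
  next
    case (act f \<xi>)
    then show ?case
      using restr_dact[OF C' sub str_alg_fdual[OF act(1)] loc_fdual[OF act(2)]]
        restr_str_alg[OF kalgebra_axioms C C' sub act(1)] s.loc_act by simp
  qed
qed

end

lemma rc_module_hat:
  assumes M: "kmodule A M" shows "rc_module A (hat A M)"
proof -
  note set = kmodule_setting[OF M]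
  have A: "kalgebra A" using M by (simp add: kmodule_def)
  have 1: "left_module (str_alg A D) (loc A D M) \<and> RFD_module (str_alg A D) (loc A D M)"
    if "subcoalgebra A D" for D
    using comodule_setting.kmodule_loc[OF set[OF that]] comodule_setting.RFD_loc[OF set[OF that]]
    by (simp add: kmodule_def)
  have 2: "restr (cotens A D' M) (m \<oplus>\<^bsub>loc A D M\<^esub> n) =
      restr (cotens A D' M) m \<oplus>\<^bsub>loc A D' M\<^esub> restr (cotens A D' M) n" for D D' m n
    by (auto simp: restr_def fun_eq_iff)
  have 3: "restr (cotens A D' M) (kscale (str_alg A D) (loc A D M) c m) =
      kscale (str_alg A D') (loc A D' M) c (restr (cotens A D' M) m)"
    if D: "subcoalgebra A D" and D': "subcoalgebra A D'" "D' \<subseteq> D" and m: "m \<in> carrier (loc A D M)" for D D' c m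
  proof -
    have m': "m \<in> fdual (cotens A D M)" by (rule comodule_setting.loc_fdual[OF set[OF D] m])
    show ?thesis
      using comodule_setting.kscale_loc[OF set[OF D] m']
        comodule_setting.kscale_loc[OF set[OF D'(1)] comodule_setting.restr_cotens_fdual[OF set[OF D] D' m']]
      by (auto simp: restr_def fun_eq_iff)
  qed
  have 4: "restr (cotens A D M) m = m" if D: "subcoalgebra A D" and m: "m \<in> carrier (loc A D M)" for D m
    using fdual_outside[OF comodule_setting.loc_fdual[OF set[OF D] m]] by (auto simp: restr_def fun_eq_iff)
  have 5: "restr (cotens A D'' M) (restr (cotens A D' M) m) = restr (cotens A D'' M) m"
    if "D'' \<subseteq> D'" for D' D'' m
    using cotens_mono[OF that] by (auto simp: restr_def fun_eq_iff)
  have 6: "restr (cotens A D' M) (a \<odot>\<^bsub>loc A D M\<^esub> m) =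
      restr D' a \<odot>\<^bsub>loc A D' M\<^esub> restr (cotens A D' M) m"
    if D: "subcoalgebra A D" and D': "subcoalgebra A D'" "D' \<subseteq> D" and a: "a \<in> carrier (str_alg A D)"
      and m: "m \<in> carrier (loc A D M)" for D D' a m
    using comodule_setting.restr_dact[OF set[OF D] D' comodule_setting.str_alg_fdual[OF set[OF D] a]
        comodule_setting.loc_fdual[OF set[OF D] m]] by simp
  show ?thesis
    unfolding rc_module_def hat_def rc_mod.simps
  proof (intro conjI allI impI ballI; (elim conjE)?)
    show "left_module (str_alg A D) (loc A D M)" if "subcoalgebra A D" for D using 1[OF that] by simp
    show "RFD_module (str_alg A D) (loc A D M)" if "subcoalgebra A D" for D using 1[OF that] by simp
    show "restr (cotens A D M) m = m" if "subcoalgebra A D" "m \<in> carrier (loc A D M)" for D m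
      using 4[OF that] .
    show "restr (cotens A D'' M) (restr (cotens A D' M) m) = restr (cotens A D'' M) m"
      if "D'' \<subseteq> D'" for D D' D'' m using 5[OF that] .
    fix D D' assume D: "subcoalgebra A D" and D': "subcoalgebra A D'" "D' \<subseteq> D"
    show "restr (cotens A D' M) m \<in> carrier (loc A D' M)" if "m \<in> carrier (loc A D M)" for m
      using comodule_setting.restr_loc[OF set[OF D] D' that] .
    show "restr (cotens A D' M) (m \<oplus>\<^bsub>loc A D M\<^esub> n) =
      restr (cotens A D' M) m \<oplus>\<^bsub>loc A D' M\<^esub> restr (cotens A D' M) n" for m n by (rule 2)
    show "restr (cotens A D' M) (kscale (str_alg A D) (loc A D M) c m) =
      kscale (str_alg A D') (loc A D' M) c (restr (cotens A D' M) m)"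
      if "m \<in> carrier (loc A D M)" for c m using 3[OF D D' that] .
    show "restr (cotens A D' M) (a \<odot>\<^bsub>loc A D M\<^esub> m) =
        restr D' a \<odot>\<^bsub>loc A D' M\<^esub> restr (cotens A D' M) m"
      if "a \<in> carrier (str_alg A D)" "m \<in> carrier (loc A D M)" for a m using 6[OF D D' that] .
  qed
qed

section \<open>Separation by finite-dimensional quotients\<close>

lemma lmod_homD:
  assumes "f \<in> lmod_hom R M N"
  shows "x \<in> carrier M \<Longrightarrow> f x \<in> carrier N"
    "x \<in> carrier M \<Longrightarrow> y \<in> carrier M \<Longrightarrow> f (x \<oplus>\<^bsub>M\<^esub> y) = f x \<oplus>\<^bsub>N\<^esub> f y"
    "a \<in> carrier R \<Longrightarrow> x \<in> carrier M \<Longrightarrow> f (a \<odot>\<^bsub>M\<^esub> x) = a \<odot>\<^bsub>N\<^esub> f x"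
    "x \<notin> carrier M \<Longrightarrow> f x = undefined"
  using assms by (auto simp: lmod_hom_def)

lemma (in kmodule) hom_kscale:
  assumes "f \<in> lmod_hom R M N" "x \<in> carrier M"
  shows "f (c \<bullet> x) = kscale R N c (f x)"
  using lmod_homD(3)[OF assms(1) scl_one_closed assms(2)] by (simp add: kscale_def)

lemma (in kmodule) hom_zero:
  assumes N: "kmodule R N" and f: "f \<in> lmod_hom R M N"
  shows "f \<zero>\<^bsub>M\<^esub> = \<zero>\<^bsub>N\<^esub>"
proof -
  interpret N: kmodule R N by fact
  have "f (\<zero> \<triangleright> \<zero>\<^bsub>M\<^esub>) = \<zero> \<odot>\<^bsub>N\<^esub> f \<zero>\<^bsub>M\<^esub>"
    by (rule lmod_homD(3)[OF f]) auto
  then show ?thesis using lmod_homD(1)[OF f] by (simp add: act_zero_left N.act_zero_left)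
qed

lemma (in kmodule) hom_mdual:
  assumes N: "kmodule R N" and f: "f \<in> lmod_hom R M N" and \<phi>: "\<phi> \<in> mdual R N"
  shows "pullback M f \<phi> \<in> mdual R M"
proof -
  interpret N: kmodule R N by fact
  show ?thesis
    using lmod_homD(1,2)[OF f] hom_kscale[OF f] N.mdual_add[OF \<phi>] N.mdual_scale[OF \<phi>]
    unfolding mdual_def[of R M] by (simp add: pullback_def)
qed

lemma (in kmodule) preimage_submodule:
  assumes N: "kmodule R N" and f: "f \<in> lmod_hom R M N"
    and J: "lsubmodule R N J"
  shows "lsubmodule R M {x \<in> carrier M. f x \<in> J}"
proof -
  interpret N: kmodule R N by fact
  show ?thesis
    using N.ksubspaceD(2,3)[OF N.lsubmoduleD(1)[OF J]] N.lsubmoduleD(2)[OF J] hom_zero[OF N f]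
      lmod_homD(2,3)[OF f]
    by (intro lsubmoduleI) (auto simp: act_closed)
qed

lemma (in kmodule) preimage_fin_codim:
  assumes N: "kmodule R N" and f: "f \<in> lmod_hom R M N"
    and J: "lsubmodule R N J" "fin_codim R N J"
  shows "fin_codim R M {x \<in> carrier M. f x \<in> J}"
proof -
  interpret N: kmodule R N by fact
  obtain L where L: "N.dual_basis_modulo J L"
    using N.fin_codim_dual_basis[OF N.lsubmoduleD(1)[OF J(1)] J(2)] by blast
  show ?thesis
  proof (rule fin_codim_of_functionals[OF lsubmoduleD(1)[OF preimage_submodule[OF N f J(1)]]])
    show "set (map (\<lambda>(b, \<beta>). pullback M f \<beta>) L) \<subseteq> mdual R M"
      using N.dual_basis_moduloD(2)[OF L] hom_mdual[OF N f] by auto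
    fix x assume x: "x \<in> carrier M" and 0: "\<forall>g\<in>set (map (\<lambda>(b, \<beta>). pullback M f \<beta>) L). g x = 0"
    have "\<beta> (f x) = 0" if "(b, \<beta>) \<in> set L" for b \<beta>
    proof -
      have "pullback M f \<beta> \<in> set (map (\<lambda>(b, \<beta>). pullback M f \<beta>) L)" using that by force
      then have "pullback M f \<beta> x = 0" using 0 by blast
      then show ?thesis using x by (simp add: pullback_def)
    qed
    then have "f x \<in> J" using N.dual_basis_moduloD(4)[OF L] lmod_homD(1)[OF f x] by blast
    then show "x \<in> {x \<in> carrier M. f x \<in> J}" using x by simp
  qed
qed

lemma (in kmodule) hom_findual:
  assumes N: "kmodule R N" and f: "f \<in> lmod_hom R M N" and \<phi>: "\<phi> \<in> findual R N"
  shows "pullback M f \<phi> \<in> findual R M"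
proof -
  obtain J where J: "\<phi> \<in> mdual R N" "lsubmodule R N J" "fin_codim R N J" "\<forall>x\<in>J. \<phi> x = 0"
    using \<phi> by (auto simp: findual_def)
  have "\<forall>x\<in>{x \<in> carrier M. f x \<in> J}. pullback M f \<phi> x = 0" using J(4) by (simp add: pullback_def)
  then show ?thesis
    using hom_mdual[OF N f J(1)] preimage_submodule[OF N f J(2)] preimage_fin_codim[OF N f J(2,3)]
    unfolding findual_def by blast
qed

text \<open>The module laws are equations, so they pass to the image of any map that respects the operations.\<close>

lemma left_module_surjective_image:
  assumes M: "left_module R M" and car: "carrier N = q ` carrier M" and q0: "\<zero>\<^bsub>N\<^esub> = q \<zero>\<^bsub>M\<^esub>"
    and q_add: "\<And>x y. x \<in> carrier M \<Longrightarrow> y \<in> carrier M \<Longrightarrow> q x \<oplus>\<^bsub>N\<^esub> q y = q (x \<oplus>\<^bsub>M\<^esub> y)"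
    and q_act: "\<And>a x. a \<in> carrier R \<Longrightarrow> x \<in> carrier M \<Longrightarrow> a \<odot>\<^bsub>N\<^esub> q x = q (a \<odot>\<^bsub>M\<^esub> x)"
  shows "left_module R N"
proof -
  interpret left_module R M by fact
  have "abelian_group N"
  proof (rule abelian_groupI)
    fix u assume "u \<in> carrier N"
    then obtain x where x: "x \<in> carrier M" "u = q x" by (auto simp: car)
    then have "q (\<ominus>\<^bsub>M\<^esub> x) \<oplus>\<^bsub>N\<^esub> u = \<zero>\<^bsub>N\<^esub>" by (simp add: q0 q_add M.l_neg)
    then show "\<exists>v\<in>carrier N. v \<oplus>\<^bsub>N\<^esub> u = \<zero>\<^bsub>N\<^esub>" using x(1) by (auto simp: car)
    show "\<zero>\<^bsub>N\<^esub> \<oplus>\<^bsub>N\<^esub> u = u" using x by (simp add: q0 q_add)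
    fix v assume "v \<in> carrier N"
    then obtain y where y: "y \<in> carrier M" "v = q y" by (auto simp: car)
    show "u \<oplus>\<^bsub>N\<^esub> v \<in> carrier N" using x y by (simp add: car q_add)
    show "u \<oplus>\<^bsub>N\<^esub> v = v \<oplus>\<^bsub>N\<^esub> u" using x y by (simp add: q_add M.a_comm)
    fix w assume "w \<in> carrier N"
    then obtain z where "z \<in> carrier M" "w = q z" by (auto simp: car)
    then show "u \<oplus>\<^bsub>N\<^esub> v \<oplus>\<^bsub>N\<^esub> w = u \<oplus>\<^bsub>N\<^esub> (v \<oplus>\<^bsub>N\<^esub> w)"
      using x y by (simp add: q_add M.a_assoc)
  qed (simp add: car q0)
  then show ?thesis
  proof (intro left_module.intro left_module_axioms.intro R.ring_axioms)
    fix a u assume a: "a \<in> carrier R" and "u \<in> carrier N"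
    then obtain x where x: "x \<in> carrier M" "u = q x" by (auto simp: car)
    show "a \<odot>\<^bsub>N\<^esub> u \<in> carrier N" using a x by (simp add: car q_act act_closed)
    fix b assume b: "b \<in> carrier R"
    show "(a \<oplus>\<^bsub>R\<^esub> b) \<odot>\<^bsub>N\<^esub> u = a \<odot>\<^bsub>N\<^esub> u \<oplus>\<^bsub>N\<^esub> b \<odot>\<^bsub>N\<^esub> u"
      using a b x by (simp add: q_act q_add act_closed act_l_distr)
    show "(a \<otimes>\<^bsub>R\<^esub> b) \<odot>\<^bsub>N\<^esub> u = a \<odot>\<^bsub>N\<^esub> (b \<odot>\<^bsub>N\<^esub> u)"
      using a b x by (simp add: q_act act_closed act_assoc)
  next
    fix a u v assume a: "a \<in> carrier R" and "u \<in> carrier N" "v \<in> carrier N"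
    then obtain x y where "x \<in> carrier M" "u = q x" "y \<in> carrier M" "v = q y" by (auto simp: car)
    then show "a \<odot>\<^bsub>N\<^esub> (u \<oplus>\<^bsub>N\<^esub> v) = a \<odot>\<^bsub>N\<^esub> u \<oplus>\<^bsub>N\<^esub> a \<odot>\<^bsub>N\<^esub> v"
      using a by (simp add: q_act q_add act_closed act_r_distr)
  next
    fix u assume "u \<in> carrier N"
    then obtain x where "x \<in> carrier M" "u = q x" by (auto simp: car)
    then show "\<one>\<^bsub>R\<^esub> \<odot>\<^bsub>N\<^esub> u = u" by (simp add: q_act act_one)
  qed auto
qed

text \<open>A list is sent to the combination of the generators with its entries as coefficients; this is
  what allows quotients to be realised on lists, the carrier type in the definition of \<open>fully_RFD\<close>.\<close>

lemma (in kmodule) fin_gen_range: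
  assumes "fin_gen R M"
  shows "\<exists>g :: 'r list \<Rightarrow> 'm. carrier M \<subseteq> range g"
proof -
  obtain S where S: "finite S" "S \<subseteq> carrier M" "lspan R M S = carrier M"
    using assms by (auto simp: fin_gen_def)
  have "\<exists>g :: 'r list \<Rightarrow> 'm. lspan R M S \<subseteq> range g"
    using S(1,2)
  proof (induction S rule: finite_induct)
    case empty
    have "lsubmodule R M {\<zero>\<^sub>M}" by (rule lsubmoduleI) (auto simp: act_zero_right)
    then have "lspan R M {} \<subseteq> {\<zero>\<^sub>M}" by (rule lspan_least) simp
    then have "lspan R M {} \<subseteq> range (\<lambda>_::'r list. \<zero>\<^sub>M)" by simp
    then show ?case by blast
  next
    case (insert s S)
    then obtain g :: "'r list \<Rightarrow> 'm" where g: "lspan R M S \<subseteq> range g" by auto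
    have s: "s \<in> carrier M" using insert by simp
    have sub: "lsubmodule R M (lspan R M S)" using insert by (intro lspan_submodule) simp
    note subD = ksubspaceD(2,3)[OF lsubmoduleD(1)[OF sub]] lsubmoduleD(2)[OF sub]
    have car: "y \<in> carrier M" if "y \<in> lspan R M S" for y
      using ksubspaceD(1)[OF lsubmoduleD(1)[OF sub]] that by auto
    define N where "N = {a \<triangleright> s \<oplus>\<^sub>M y | a y. a \<in> carrier R \<and> y \<in> lspan R M S}"
    have N: "a \<triangleright> s \<oplus>\<^sub>M y \<in> N" if "a \<in> carrier R" "y \<in> lspan R M S" for a y
      using that by (auto simp: N_def)
    have "lsubmodule R M N"
    proof (rule lsubmoduleI)
      show "N \<subseteq> carrier M" using s car by (auto simp: N_def act_closed)
      show "\<zero>\<^sub>M \<in> N" using N[of \<zero> "\<zero>\<^sub>M"] s subD(1) by (simp add: act_zero_left)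
    next
      fix x y assume "x \<in> N" "y \<in> N"
      then obtain a b u v where "x = a \<triangleright> s \<oplus>\<^sub>M u" "y = b \<triangleright> s \<oplus>\<^sub>M v"
        and ab: "a \<in> carrier R" "b \<in> carrier R" "u \<in> lspan R M S" "v \<in> lspan R M S"
        by (auto simp: N_def)
      then have "x \<oplus>\<^sub>M y = (a \<oplus> b) \<triangleright> s \<oplus>\<^sub>M (u \<oplus>\<^sub>M v)"
        using s car by (simp add: act_l_distr act_closed M.add.m_ac)
      then show "x \<oplus>\<^sub>M y \<in> N" using N ab subD(2) by simp
    next
      fix c x assume c: "c \<in> carrier R" and "x \<in> N"
      then obtain a u where "x = a \<triangleright> s \<oplus>\<^sub>M u" and a: "a \<in> carrier R" "u \<in> lspan R M S"
        by (auto simp: N_def)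
      then have "c \<triangleright> x = (c \<otimes> a) \<triangleright> s \<oplus>\<^sub>M c \<triangleright> u"
        using s c car by (simp add: act_r_distr act_closed act_assoc)
      then show "c \<triangleright> x \<in> N" using N c a subD(3) by simp
    qed
    moreover have "insert s S \<subseteq> N"
    proof -
      have "s \<in> N" using N[of \<one> "\<zero>\<^sub>M"] s subD(1) by (simp add: act_one)
      moreover have "y \<in> N" if "y \<in> S" for y
      proof -
        have "y \<in> lspan R M S" using that lspan_superset by blast
        then show ?thesis using N[of \<zero> y] s car by (simp add: act_zero_left)
      qed
      ultimately show ?thesis by auto
    qed
    ultimately have "lspan R M (insert s S) \<subseteq> N" by (rule lspan_least)
    moreover have "N \<subseteq> range (\<lambda>l. hd l \<triangleright> s \<oplus>\<^sub>M g (tl l))"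
    proof
      fix x assume "x \<in> N"
      then obtain a y where x: "x = a \<triangleright> s \<oplus>\<^sub>M y" "y \<in> lspan R M S" by (auto simp: N_def)
      then obtain l where "y = g l" using g by auto
      then have "x = hd (a # l) \<triangleright> s \<oplus>\<^sub>M g (tl (a # l))" using x by simp
      then show "x \<in> range (\<lambda>l. hd l \<triangleright> s \<oplus>\<^sub>M g (tl l))" by blast
    qed
    ultimately show ?case by (intro exI[of _ "\<lambda>l. hd l \<triangleright> s \<oplus>\<^sub>M g (tl l)"]) blast
  qed
  then show ?thesis using S(3) by simp
qed

text \<open>The quotient \<open>M / K\<close>, carried by one list for each coset.\<close>

lemma (in kmodule) quotient_on_lists:
  assumes fg: "fin_gen R M" and K: "lsubmodule R M K"
  obtains Q :: "('r, 'r list) module" and q where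
    "left_module R Q" "fin_gen R Q" "q \<in> lmod_hom R M Q"
    "\<And>x y. x \<in> carrier M \<Longrightarrow> y \<in> carrier M \<Longrightarrow> q x = q y \<longleftrightarrow> (\<exists>k\<in>K. x = k \<oplus>\<^bsub>M\<^esub> y)"
proof -
  obtain g :: "'r list \<Rightarrow> 'm" where g: "carrier M \<subseteq> range g" using fin_gen_range[OF fg] by blast
  note KD = ksubspaceD(2-4)[OF lsubmoduleD(1)[OF K]] lsubmoduleD(2)[OF K]
  have KM: "k \<in> carrier M" if "k \<in> K" for k using ksubspaceD(1)[OF lsubmoduleD(1)[OF K]] that by auto
  define eqv where "eqv = (\<lambda>x y. \<exists>k\<in>K. x = k \<oplus>\<^sub>M y)"
  have eqv_refl: "eqv x x" if "x \<in> carrier M" for x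
    using that KD(1) by (auto simp: eqv_def intro: bexI[of _ "\<zero>\<^sub>M"])
  have eqv_sym: "eqv y x" if xy: "eqv x y" and y: "y \<in> carrier M" for x y
  proof -
    obtain k where k: "k \<in> K" "x = k \<oplus>\<^sub>M y" using xy by (auto simp: eqv_def)
    then have "y = \<ominus>\<^bsub>M\<^esub> k \<oplus>\<^sub>M x" using y KM by (simp add: M.l_neg flip: M.a_assoc)
    then show ?thesis using k KD(3) by (auto simp: eqv_def)
  qed
  have eqv_trans: "eqv x z" if xy: "eqv x y" "eqv y z" and z: "z \<in> carrier M" for x y z
  proof -
    obtain k l where k: "k \<in> K" "x = k \<oplus>\<^sub>M y" "l \<in> K" "y = l \<oplus>\<^sub>M z" using xy by (auto simp: eqv_def)
    then have "x = (k \<oplus>\<^sub>M l) \<oplus>\<^sub>M z" using z KM by (simp add: M.a_assoc)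
    then show ?thesis using k KD(2) by (auto simp: eqv_def)
  qed
  have eqv_add: "eqv (x \<oplus>\<^sub>M x') (y \<oplus>\<^sub>M y')"
    if xy: "eqv x y" "eqv x' y'" and y: "y \<in> carrier M" "y' \<in> carrier M" for x x' y y'
  proof -
    obtain k l where k: "k \<in> K" "x = k \<oplus>\<^sub>M y" "l \<in> K" "x' = l \<oplus>\<^sub>M y'" using xy by (auto simp: eqv_def)
    then have "x \<oplus>\<^sub>M x' = (k \<oplus>\<^sub>M l) \<oplus>\<^sub>M (y \<oplus>\<^sub>M y')" using y KM by (simp add: M.add.m_ac)
    then show ?thesis using k KD(2) by (auto simp: eqv_def)
  qed
  have eqv_act: "eqv (a \<triangleright> x) (a \<triangleright> y)" if xy: "eqv x y" and y: "y \<in> carrier M" "a \<in> carrier R" for a x y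
  proof -
    obtain k where k: "k \<in> K" "x = k \<oplus>\<^sub>M y" using xy by (auto simp: eqv_def)
    then have "a \<triangleright> x = a \<triangleright> k \<oplus>\<^sub>M a \<triangleright> y" using y KM by (simp add: act_r_distr)
    then show ?thesis using k KD(4) y by (auto simp: eqv_def)
  qed
  \<comment> \<open>A coset is represented by a list that \<open>g\<close> sends into it.\<close>
  define q where "q = (\<lambda>x. SOME l. g l \<in> carrier M \<and> eqv (g l) x)"
  have gq: "g (q x) \<in> carrier M" "eqv (g (q x)) x" if "x \<in> carrier M" for x
  proof -
    have "x \<in> range g" using g that by blast
    then obtain l where "g l = x" by auto
    then have "\<exists>l. g l \<in> carrier M \<and> eqv (g l) x" using that eqv_refl by auto
    then show "g (q x) \<in> carrier M" "eqv (g (q x)) x" unfolding q_def by (metis (mono_tags, lifting) someI_ex)+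
  qed
  have q_eq: "q x = q y \<longleftrightarrow> eqv x y" if x: "x \<in> carrier M" and y: "y \<in> carrier M" for x y
  proof
    assume "q x = q y"
    then show "eqv x y" using eqv_trans[OF eqv_sym[OF gq(2)[OF x] x]] gq(2)[OF y] y by simp
  next
    assume e: "eqv x y"
    have "(g l \<in> carrier M \<and> eqv (g l) x) = (g l \<in> carrier M \<and> eqv (g l) y)" for l
      using eqv_trans[OF _ e y] eqv_trans[OF _ eqv_sym[OF e y] x] by blast
    then show "q x = q y" by (simp add: q_def)
  qed
  define Q :: "('r, 'r list) module" where
    "Q = \<lparr>carrier = q ` carrier M, monoid.mult = undefined, one = undefined, ring.zero = q \<zero>\<^sub>M,
       ring.add = (\<lambda>u v. q (g u \<oplus>\<^sub>M g v)), smult = (\<lambda>a u. q (a \<triangleright> g u))\<rparr>"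
  have Q [simp]: "carrier Q = q ` carrier M" "\<zero>\<^bsub>Q\<^esub> = q \<zero>\<^sub>M" by (simp_all add: Q_def)
  have q_add: "q x \<oplus>\<^bsub>Q\<^esub> q y = q (x \<oplus>\<^sub>M y)" if "x \<in> carrier M" "y \<in> carrier M" for x y
    using that gq eqv_add by (simp add: Q_def q_eq)
  have q_act: "a \<odot>\<^bsub>Q\<^esub> q x = q (a \<triangleright> x)" if "x \<in> carrier M" "a \<in> carrier R" for a x
    using that gq eqv_act by (simp add: Q_def q_eq act_closed)
  have LQ: "left_module R Q"
    by (rule left_module_surjective_image[OF left_module_axioms, of Q q]) (simp, simp, erule (1) q_add, erule (1) q_act)
  then interpret Q: kmodule R Q by (simp add: kmodule_def kalgebra_axioms)
  define q' where "q' = restrict q (carrier M)"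
  have hom: "q' \<in> lmod_hom R M Q"
    by (simp add: lmod_hom_def q'_def q_add q_act act_closed)
  obtain S where S: "finite S" "S \<subseteq> carrier M" "lspan R M S = carrier M"
    using fg by (auto simp: fin_gen_def)
  have "lspan R Q (q ` S) = carrier Q"
  proof
    have qS: "q ` S \<subseteq> carrier Q" using S by auto
    show "lspan R Q (q ` S) \<subseteq> carrier Q" using Q.lspan_least[OF Q.lsubmodule_carrier qS] .
    have "lsubmodule R M {x \<in> carrier M. q' x \<in> lspan R Q (q ` S)}"
      by (rule preimage_submodule[OF Q.kmodule_axioms hom Q.lspan_submodule[OF qS]])
    moreover have "S \<subseteq> {x \<in> carrier M. q' x \<in> lspan R Q (q ` S)}"
      using S(2) Q.lspan_superset[of "q ` S"] by (auto simp: q'_def)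
    ultimately have "carrier M \<subseteq> {x \<in> carrier M. q' x \<in> lspan R Q (q ` S)}"
      using lspan_least S(3) by blast
    then show "carrier Q \<subseteq> lspan R Q (q ` S)" by (auto simp: q'_def)
  qed
  then have "fin_gen R Q" using S(1,2) unfolding fin_gen_def by (intro exI[of _ "q ` S"]) auto
  moreover have "q' x = q' y \<longleftrightarrow> (\<exists>k\<in>K. x = k \<oplus>\<^bsub>M\<^esub> y)"
    if "x \<in> carrier M" "y \<in> carrier M" for x y
    using that q_eq by (simp add: q'_def eqv_def)
  ultimately show thesis using that LQ hom by blast
qed

text \<open>The hypothesis on \<open>R\<close>, applied to \<open>M / K\<close>, gives a finite-dimensional quotient of \<open>M / K\<close> in which \<open>x\<close> does
  not become zero; a coordinate functional of that quotient, pulled back to \<open>M\<close>, is as required.\<close>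

lemma (in kmodule) fully_RFD_separation:
  assumes RFD: "fully_RFD R" and fg: "fin_gen R M" and K: "lsubmodule R M K"
    and x: "x \<in> carrier M" "x \<notin> K"
  shows "\<exists>\<phi>\<in>findual R M. (\<forall>y\<in>K. \<phi> y = 0) \<and> \<phi> x \<noteq> 0"
proof -
  obtain Q :: "('r, 'r list) module" and q where LQ: "left_module R Q" and "fin_gen R Q"
    and q: "q \<in> lmod_hom R M Q"
    and q_eq: "\<And>x y. x \<in> carrier M \<Longrightarrow> y \<in> carrier M \<Longrightarrow> q x = q y \<longleftrightarrow> (\<exists>k\<in>K. x = k \<oplus>\<^bsub>M\<^esub> y)"
    using quotient_on_lists[OF fg K] by metis
  then have "subdirect_product_of_fin_dim R Q" using RFD by (simp add: fully_RFD_def)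
  then obtain P :: "(('r, 'r list) module \<times> ('r list \<Rightarrow> 'r list)) set"
    where P: "\<forall>(N, p)\<in>P. left_module R N \<and> fin_dim R N \<and> p \<in> lmod_hom R Q N \<and> p ` carrier Q = carrier N"
    and sep: "\<forall>x\<in>carrier Q. \<forall>y\<in>carrier Q. (\<forall>(N, p)\<in>P. p x = p y) \<longrightarrow> x = y"
    unfolding subdirect_product_of_fin_dim_def by (elim exE conjE)
  interpret Q: kmodule R Q using LQ by (simp add: kmodule_def kalgebra_axioms)
  have KM: "k \<in> carrier M" if "k \<in> K" for k using ksubspaceD(1)[OF lsubmoduleD(1)[OF K]] that by auto
  have "q x \<noteq> q \<zero>\<^sub>M" using x KM q_eq[of x "\<zero>\<^sub>M"] by auto
  moreover have "q x \<in> carrier Q" "q \<zero>\<^sub>M \<in> carrier Q" using lmod_homD(1)[OF q] x by auto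
  ultimately have "\<not> (\<forall>(N, p)\<in>P. p (q x) = p (q \<zero>\<^sub>M))"
    using bspec[OF bspec[OF sep, of "q x"], of "q \<zero>\<^sub>M"] by blast
  then obtain N p where Np: "(N, p) \<in> P" "p (q x) \<noteq> p (q \<zero>\<^sub>M)" by auto
  then have N: "left_module R N" "fin_dim R N" and p: "p \<in> lmod_hom R Q N"
    using bspec[OF P Np(1)] by auto
  interpret N: kmodule R N using N by (simp add: kmodule_def kalgebra_axioms)
  define f where "f = restrict (p \<circ> q) (carrier M)"
  have f: "f \<in> lmod_hom R M N"
    using lmod_homD(1-3)[OF q] lmod_homD(1-3)[OF p]
    by (simp add: f_def lmod_hom_def act_closed)
  have zero: "lsubmodule R N {\<zero>\<^bsub>N\<^esub>}"
    by (rule N.lsubmoduleI) (auto simp: N.act_zero_right)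
  define J where "J = {y \<in> carrier M. f y \<in> {\<zero>\<^bsub>N\<^esub>}}"
  have J: "lsubmodule R M J" "fin_codim R M J"
    unfolding J_def using preimage_submodule[OF N.kmodule_axioms f zero]
      preimage_fin_codim[OF N.kmodule_axioms f zero] N(2) by (simp_all add: fin_dim_def)
  have f0: "p (q \<zero>\<^sub>M) = \<zero>\<^bsub>N\<^esub>" using hom_zero[OF N.kmodule_axioms f] by (simp add: f_def)
  have "x \<notin> J" using Np(2) f0 x by (simp add: J_def f_def)
  have KJ: "K \<subseteq> J"
  proof
    fix k assume k: "k \<in> K"
    then have "q k = q \<zero>\<^sub>M" using q_eq[of k "\<zero>\<^sub>M"] KM by force
    then show "k \<in> J" using k KM f0 by (simp add: J_def f_def)
  qed
  obtain L where L: "dual_basis_modulo J L"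
    using fin_codim_dual_basis[OF lsubmoduleD(1)[OF J(1)] J(2)] by blast
  obtain b \<beta> where \<beta>: "(b, \<beta>) \<in> set L" "\<beta> x \<noteq> 0"
    using dual_basis_moduloD(4)[OF L x(1)] \<open>x \<notin> J\<close> by blast
  have "\<beta> \<in> findual R M"
    using dual_basis_moduloD(2,3)[OF L \<beta>(1)] J unfolding findual_def by blast
  then show ?thesis using dual_basis_moduloD(3)[OF L \<beta>(1)] KJ \<beta>(2) by blast
qed

section \<open>Global sections\<close>

lemma fin_gen_reg:
  assumes "kalgebra A" shows "fin_gen A (reg A)"
proof -
  interpret reg: kmodule A "reg A" by (rule kmodule_reg) fact
  have sub: "lsubmodule A (reg A) (lspan A (reg A) {\<one>\<^bsub>A\<^esub>})"
    by (rule reg.lspan_submodule) simp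
  have "carrier A \<subseteq> lspan A (reg A) {\<one>\<^bsub>A\<^esub>}"
  proof
    fix a assume "a \<in> carrier A"
    then show "a \<in> lspan A (reg A) {\<one>\<^bsub>A\<^esub>}"
      using reg.lsubmoduleD(2)[OF sub, of a "\<one>\<^bsub>A\<^esub>"] reg.lspan_superset[of "{\<one>\<^bsub>A\<^esub>}"] by simp
  qed
  then have "lspan A (reg A) {\<one>\<^bsub>A\<^esub>} = carrier (reg A)"
    using reg.ksubspaceD(1)[OF reg.lsubmoduleD(1)[OF sub]] by auto
  then show ?thesis unfolding fin_gen_def by (intro exI[of _ "{\<one>\<^bsub>A\<^esub>}"]) simp
qed

text \<open>A proper left ideal is separated from some element of \<open>A\<close> by a functional in the finite dual, which
  then is a nonzero element of \<open>Zo A I\<close>.\<close>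

lemma Fil_findual_alg:
  assumes A: "kalgebra A" and RFD: "fully_RFD A" and I: "I \<in> Fil A (findual_alg A)"
  shows "I = carrier A"
proof (rule ccontr)
  interpret reg: kmodule A "reg A" by (rule kmodule_reg) fact
  have sub: "lsubmodule A (reg A) I" and Zo: "Zo A I \<inter> findual_alg A = {0}"
    using I by (auto simp: Fil_def)
  have IA: "I \<subseteq> carrier A" using reg.ksubspaceD(1)[OF reg.lsubmoduleD(1)[OF sub]] by simp
  assume "I \<noteq> carrier A"
  then obtain x where x: "x \<in> carrier A" "x \<notin> I" using IA by auto
  then obtain \<phi> where \<phi>: "\<phi> \<in> findual_alg A" "\<forall>y\<in>I. \<phi> y = 0" "\<phi> x \<noteq> 0"
    using reg.fully_RFD_separation[OF RFD fin_gen_reg[OF A] sub, of x] by (auto simp: findual_reg[OF A])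
  then have "\<phi> \<in> Zo A I \<inter> findual_alg A" by (simp add: Zo_def)
  then show False using Zo \<phi>(3) by auto
qed

lemma cotens_findual_alg:
  assumes "kmodule A M" shows "cotens A (findual_alg A) M = findual A M"
  using kmodule.coact_tensor[OF assms] by (auto simp: cotens_def)

text \<open>The only member of \<open>Fil\<close> contains \<open>1\<close>, so every generator is already an evaluation; the same
  argument gives \<open>loc_findual_alg\<close> below.\<close>

lemma str_alg_findual_alg:
  assumes A: "kalgebra A" and RFD: "fully_RFD A"
  shows "carrier (str_alg A (findual_alg A)) = ev_alg (findual_alg A) ` carrier A"
proof
  let ?C = "findual_alg A"
  note C = subcoalgebra_findual_alg[OF A]
  interpret r: comodule_setting A "reg A" ?C by (rule kmodule_setting[OF kmodule_reg[OF A] C])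
  show "ev_alg ?C ` carrier A \<subseteq> carrier (str_alg A ?C)" using r.ev_alg_str_alg by auto
  have ev: "ev_mod A ?C (reg A) = ev_alg ?C"
    by (auto simp: fun_eq_iff ev_mod_def ev_alg_def cotens_reg[OF A C])
  have evI: "f = ev_alg ?C a \<Longrightarrow> a \<in> carrier A \<Longrightarrow> f \<in> ev_alg ?C ` carrier A" for f a by blast
  show "carrier (str_alg A ?C) \<subseteq> ev_alg ?C ` carrier A"
  proof (rule str_alg_least)
    show "S_set A ?C \<subseteq> ev_alg ?C ` carrier A"
    proof
      fix x assume "x \<in> S_set A ?C"
      then obtain I where x: "x \<in> fdual ?C" and I: "I \<in> Fil A ?C"
        "\<And>a. a \<in> I \<Longrightarrow> ev_alg ?C a \<otimes>\<^bsub>dual_alg A ?C\<^esub> x \<in> ev_alg ?C ` carrier A"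
        by (auto simp: S_set_def)
      have "ev_alg ?C \<one>\<^bsub>A\<^esub> \<otimes>\<^bsub>dual_alg A ?C\<^esub> x \<in> ev_alg ?C ` carrier A"
        using I(2) Fil_findual_alg[OF A RFD I(1)] by simp
      then show "x \<in> ev_alg ?C ` carrier A"
        using r.one_dact x by (simp add: dual_alg_mult[OF A C] cotens_reg[OF A C])
    qed
    show "subalgebra (dual_alg A ?C) (ev_alg ?C ` carrier A)"
    proof (rule subalgebraI[OF kalgebra_dual_alg[OF A C]])
      fix f g assume "f \<in> ev_alg ?C ` carrier A" "g \<in> ev_alg ?C ` carrier A"
      then obtain a b where ab: "f = ev_alg ?C a" "a \<in> carrier A" "g = ev_alg ?C b" "b \<in> carrier A" by auto
      show "f \<otimes>\<^bsub>dual_alg A ?C\<^esub> g \<in> ev_alg ?C ` carrier A"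
        using ab r.ev_alg_ev_mod[of a b]
        by (intro evI[of _ "a \<otimes>\<^bsub>A\<^esub> b"]) (simp_all add: dual_alg_mult[OF A C] ev)
      show "f \<oplus>\<^bsub>dual_alg A ?C\<^esub> g \<in> ev_alg ?C ` carrier A"
        using ab r.mdual_add
        by (intro evI[of _ "a \<oplus>\<^bsub>A\<^esub> b"]) (auto simp: ev_alg_def fun_eq_iff findual_alg_def)
    next
      fix c f assume "f \<in> ev_alg ?C ` carrier A"
      then obtain a where a: "f = ev_alg ?C a" "a \<in> carrier A" by auto
      then show "c \<odot>\<^bsub>dual_alg A ?C\<^esub> f \<in> ev_alg ?C ` carrier A"
        using r.mdual_scale[of _ a c] kscale_reg[OF A, of a c] r.scl_closed[of a c]
        by (intro evI[of _ "c \<odot>\<^bsub>A\<^esub> a"]) (auto simp: ev_alg_def fun_eq_iff findual_alg_def)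
    qed (auto simp: r.ev_alg_fdual)
  qed
qed

lemma loc_findual_alg:
  assumes M: "kmodule A M" and RFD: "fully_RFD A"
  shows "carrier (loc A (findual_alg A) M) = ev_mod A (findual_alg A) M ` carrier M"
proof
  let ?C = "findual_alg A"
  interpret M: kmodule A M by fact
  have A: "kalgebra A" by unfold_locales
  interpret s: comodule_setting A M ?C by (rule kmodule_setting[OF M subcoalgebra_findual_alg[OF A]])
  show "ev_mod A ?C M ` carrier M \<subseteq> carrier (loc A ?C M)" using s.ev_mod_loc by auto
  have evI: "f = ev_mod A ?C M x \<Longrightarrow> x \<in> carrier M \<Longrightarrow> f \<in> ev_mod A ?C M ` carrier M" for f x
    by blast
  show "carrier (loc A ?C M) \<subseteq> ev_mod A ?C M ` carrier M"
  proof
    fix \<xi> assume "\<xi> \<in> carrier (loc A ?C M)"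
    then show "\<xi> \<in> ev_mod A ?C M ` carrier M"
    proof (induction rule: s.loc_induct)
      case (gen \<xi>)
      then obtain I where \<xi>: "\<xi> \<in> fdual (cotens A ?C M)" and I: "I \<in> Fil A ?C"
        "\<And>a. a \<in> I \<Longrightarrow> ev_alg ?C a \<odot>\<^bsub>cotens_dual A ?C M\<^esub> \<xi> \<in> ev_mod A ?C M ` carrier M"
        by (auto simp: T_set_def)
      show ?case using I(2)[of "\<one>\<^bsub>A\<^esub>"] Fil_findual_alg[OF A RFD I(1)] s.one_dact[OF \<xi>] by simp
    next
      case zero
      show ?case
        by (rule evI[of _ "\<zero>\<^bsub>M\<^esub>"])
          (auto simp: ev_mod_def fun_eq_iff M.mdual_zero s.cotens_mdual)
    next
      case (add \<xi> \<eta>)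
      then obtain x y where x: "\<xi> = ev_mod A ?C M x" "x \<in> carrier M" "\<eta> = ev_mod A ?C M y" "y \<in> carrier M"
        by blast
      then show ?case
        by (intro evI[of _ "x \<oplus>\<^bsub>M\<^esub> y"]) (auto simp: ev_mod_def fun_eq_iff M.mdual_add s.cotens_mdual)
    next
      case (act f \<xi>)
      then obtain a x where "f = ev_alg ?C a" "a \<in> carrier A" "\<xi> = ev_mod A ?C M x" "x \<in> carrier M"
        unfolding str_alg_findual_alg[OF A RFD] by blast
      then show ?case
        by (intro evI[of _ "a \<odot>\<^bsub>M\<^esub> x"]) (simp_all add: s.ev_alg_ev_mod M.act_closed)
    qed
  qed
qed

lemma ev_mod_inject:
  assumes M: "kmodule A M" and RFD: "fully_RFD A" and fg: "fin_gen A M"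
    and x: "x \<in> carrier M" and y: "y \<in> carrier M"
    and eq: "ev_mod A (findual_alg A) M x = ev_mod A (findual_alg A) M y"
  shows "x = y"
proof (rule ccontr)
  interpret kmodule A M by fact
  assume "x \<noteq> y"
  define z where "z = x \<oplus>\<^bsub>M\<^esub> \<ominus>\<^bsub>M\<^esub> y"
  have z: "z \<in> carrier M" using x y by (simp add: z_def)
  have "z \<oplus>\<^bsub>M\<^esub> y = x" using x y by (simp add: z_def M.a_assoc M.l_neg)
  then have "z \<noteq> \<zero>\<^bsub>M\<^esub>" using \<open>x \<noteq> y\<close> y by auto
  moreover have "lsubmodule A M {\<zero>\<^bsub>M\<^esub>}" by (rule lsubmoduleI) (auto simp: act_zero_right)
  ultimately obtain \<phi> where \<phi>: "\<phi> \<in> findual A M" "\<phi> z \<noteq> 0"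
    using fully_RFD_separation[OF RFD fg _ z] by blast
  have "\<phi> x = \<phi> y" using fun_cong[OF eq, of \<phi>] \<phi>(1) by (simp add: ev_mod_def cotens_findual_alg[OF M])
  moreover have "\<phi> z = \<phi> x - \<phi> y"
    using \<phi>(1) x y by (simp add: z_def mdual_add mdual_minus findual_def)
  ultimately show False using \<phi>(2) by simp
qed

section \<open>Functoriality\<close>

text \<open>The dual of the pullback along \<open>f\<close>; the components of \<open>hat_map\<close> are its restrictions.\<close>

definition cotens_push ::
    "('k::field, 'a) module \<Rightarrow> ('a \<Rightarrow> 'k) set \<Rightarrow> ('a, 'm) module \<Rightarrow> ('a, 'n) module \<Rightarrow>
      ('m \<Rightarrow> 'n) \<Rightarrow> (('m \<Rightarrow> 'k) \<Rightarrow> 'k) \<Rightarrow> ('n \<Rightarrow> 'k) \<Rightarrow> 'k" where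
  "cotens_push A C M M' f \<xi> = (\<lambda>\<phi>. if \<phi> \<in> cotens A C M' then \<xi> (pullback M f \<phi>) else 0)"

locale hom_setting = M1: comodule_setting A M C + M2: comodule_setting A M' C
  for A :: "('k::field, 'a) module" (structure) and M :: "('a, 'm) module"
    and M' :: "('a, 'n) module" and C +
  fixes f assumes hom: "f \<in> lmod_hom A M M'"
begin

abbreviation F where "F \<equiv> cotens_push A C M M' f"

lemma coslice_pullback: "coslice A M (pullback M f \<phi>) a = pullback M f (coslice A M' \<phi> a)"
  using lmod_homD(1,3)[OF hom] by (auto simp: fun_eq_iff pullback_def coact_def M1.act_closed)

lemma pullback_cotens:
  assumes \<phi>: "\<phi> \<in> cotens A C M'" shows "pullback M f \<phi> \<in> cotens A C M"
proof -
  have pb: "\<psi> \<in> findual A M' \<Longrightarrow> pullback M f \<psi> \<in> findual A M" for \<psi>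
    by (rule M1.hom_findual[OF M2.kmodule_axioms hom])
  have t: "coact A M' \<phi> \<in> tensor C (findual A M')" using \<phi> by (simp add: cotens_def)
  have "(\<lambda>(a, x). 1 * (if x \<in> carrier M then 1 else 0) * coact A M' \<phi> (a, f x)) \<in> tensor C (findual A M)"
  proof (rule tensor_reindex[OF M1.C_subspace t])
    fix w assume "w \<in> findual A M'"
    moreover have "(\<lambda>x. (if x \<in> carrier M then 1 else 0) * w (f x)) = pullback M f w"
      by (auto simp: pullback_def)
    ultimately show "(\<lambda>x. (if x \<in> carrier M then 1 else 0) * w (f x)) \<in> findual A M" using pb by simp
  qed simp
  also have "(\<lambda>(a, x). 1 * (if x \<in> carrier M then 1 else 0) * coact A M' \<phi> (a, f x)) =
      coact A M (pullback M f \<phi>)"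
    using lmod_homD(1,3)[OF hom] by (auto simp: fun_eq_iff pullback_def coact_def M1.act_closed)
  finally show ?thesis using pb M2.cotens_findual[OF \<phi>] by (simp add: cotens_def)
qed

lemma pullback_add: "pullback M f (\<phi> + \<psi>) = pullback M f \<phi> + pullback M f \<psi>"
  by (auto simp: pullback_def fun_eq_iff)

lemma pullback_scale: "pullback M f (fscale c \<phi>) = fscale c (pullback M f \<phi>)"
  by (auto simp: pullback_def fun_eq_iff)

lemma push_fdual: "\<xi> \<in> fdual M1.CM \<Longrightarrow> F \<xi> \<in> fdual M2.CM"
  using pullback_cotens fun_vs.subspace_add[OF M2.cotens_subspace]
    fun_vs.subspace_scale[OF M2.cotens_subspace]
  unfolding fdual_def[of M2.CM]
  by (simp add: cotens_push_def pullback_add pullback_scale fdual_add fdual_scale del: fscale_apply)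

text \<open>Pulling back along \<open>f\<close> commutes with translation because \<open>f\<close> is \<open>A\<close>-linear.\<close>

lemma push_dact:
  assumes g: "g \<in> fdual C" and \<xi>: "\<xi> \<in> fdual M1.CM"
  shows "F (M1.dact g \<xi>) = M2.dact g (F \<xi>)"
proof
  fix \<phi> show "F (M1.dact g \<xi>) \<phi> = M2.dact g (F \<xi>) \<phi>"
  proof (cases "\<phi> \<in> M2.CM")
    case True
    then show ?thesis
      using g \<xi> push_fdual[OF \<xi>] pullback_cotens[OF True] M2.coslice_cotens[OF True]
      by (simp add: M2.dact_apply) (simp add: cotens_push_def M1.dact_apply coslice_pullback)
  qed (simp add: cotens_push_def M2.dact_outside)
qed

lemma push_ev: "x \<in> carrier M \<Longrightarrow> F (ev_mod A C M x) = ev_mod A C M' (f x)"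
  using pullback_cotens by (auto simp: fun_eq_iff cotens_push_def ev_mod_def pullback_def)

lemma push_add: "F (\<xi> + \<eta>) = F \<xi> + F \<eta>"
  by (auto simp: cotens_push_def fun_eq_iff)

lemma push_zero: "F 0 = 0"
  by (auto simp: cotens_push_def fun_eq_iff)

lemma push_loc:
  assumes "\<xi> \<in> carrier (loc A C M)" shows "F \<xi> \<in> carrier (loc A C M')"
  using assms
proof (induction rule: M1.loc_induct)
  case (gen \<xi>)
  then obtain I where \<xi>: "\<xi> \<in> fdual M1.CM" and I: "I \<in> Fil A C"
    "\<And>a. a \<in> I \<Longrightarrow> M1.dact (ev_alg C a) \<xi> \<in> ev_mod A C M ` carrier M"
    by (auto simp: T_set_def)
  have "M2.dact (ev_alg C a) (F \<xi>) \<in> ev_mod A C M' ` carrier M'" if a: "a \<in> I" for a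
  proof -
    obtain x where "x \<in> carrier M" "M1.dact (ev_alg C a) \<xi> = ev_mod A C M x" using I(2)[OF a] by blast
    then show ?thesis
      using push_dact[OF M1.ev_alg_fdual \<xi>, of a] push_ev lmod_homD(1)[OF hom] by (metis imageI)
  qed
  then have "F \<xi> \<in> T_set A C M'" using push_fdual[OF \<xi>] I(1) by (auto simp: T_set_def)
  then show ?case using M2.T_set_loc by blast
next
  case zero
  then show ?case using M2.loc_zero by (simp only: push_zero)
next
  case (add \<xi> \<eta>)
  then show ?case using M2.loc_add by (simp only: push_add)
next
  case (act g \<xi>)
  then show ?case using M2.loc_act[OF act(1,3)] push_dact[OF M1.str_alg_fdual[OF act(1)] M1.loc_fdual[OF act(2)]]
    by simp
qed

lemma push_hom: "restrict F (carrier (loc A C M)) \<in> lmod_hom (str_alg A C) (loc A C M) (loc A C M')"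
  using push_loc push_add M1.loc_add M1.loc_act push_dact[OF M1.str_alg_fdual M1.loc_fdual]
  by (simp add: lmod_hom_def)

end

context comodule_setting begin

text \<open>The function \<open>u : a \<mapsto> \<eta> (\<phi> (a _))\<close> belongs to \<open>C\<close> because the cotensor product is a comodule over
  \<open>C\<close>. It vanishes on \<open>I\<close>, so it is zero by the choice of \<open>Fil\<close>, and \<open>\<eta> \<phi>\<close> is its value at \<open>1\<close>.\<close>

lemma Fil_torsion_free:
  assumes \<eta>: "\<eta> \<in> fdual CM" and I: "I \<in> Fil A C" and 0: "\<And>a. a \<in> I \<Longrightarrow> ev_alg C a \<star> \<eta> = 0"
  shows "\<eta> = 0"
proof
  interpret reg: kmodule A "reg A" by (rule kmodule_reg) unfold_locales
  fix \<phi> show "\<eta> \<phi> = 0 \<phi>"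
  proof (cases "\<phi> \<in> CM")
    case \<phi>: True
    define u where "u = (\<lambda>a. \<eta> (coslice A M \<phi> a))"
    have uC: "u \<in> C" unfolding u_def by (rule contract_in_C[OF \<phi> \<eta>])
    have "u a = 0" if "a \<in> I" for a
      using fun_cong[OF 0[OF that], of \<phi>] \<phi> by (simp add: ev_alg_dact[OF \<eta>] u_def)
    then have "u \<in> Zo A I \<inter> C" using uC subcoalgebraD(1)[OF C] by (auto simp: Zo_def)
    then have "u = 0" using I by (auto simp: Fil_def)
    then have "u \<one> = 0" by simp
    then show ?thesis by (simp add: u_def coslice_one[OF \<phi>])
  qed (simp add: fdual_outside[OF \<eta>])
qed

text \<open>For a generator \<open>\<xi>\<close> some \<open>I \<in> Fil A C\<close> multiplies \<open>\<xi>\<close> into the evaluations, where \<open>g\<close> and \<open>h\<close>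
  agree; so \<open>I\<close> annihilates \<open>g \<xi> - h \<xi>\<close>, and there is no such torsion.\<close>

lemma loc_hom_unique:
  assumes N: "comodule_setting A N C"
    and g: "g \<in> lmod_hom (str_alg A C) (loc A C M) (loc A C N)"
    and h: "h \<in> lmod_hom (str_alg A C) (loc A C M) (loc A C N)"
    and eq: "\<And>x. x \<in> carrier M \<Longrightarrow> g (ev_mod A C M x) = h (ev_mod A C M x)"
  shows "g = h"
proof
  interpret N: comodule_setting A N C by fact
  fix \<xi> show "g \<xi> = h \<xi>"
  proof (cases "\<xi> \<in> carrier (loc A C M)")
    case True
    then show ?thesis
    proof (induction rule: loc_induct)
      case (gen \<xi>)
      then obtain I where I: "I \<in> Fil A C"
        "\<And>a. a \<in> I \<Longrightarrow> ev_alg C a \<star> \<xi> \<in> ev_mod A C M ` carrier M"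
        by (auto simp: T_set_def)
      have \<xi>: "\<xi> \<in> carrier (loc A C M)" using gen T_set_loc by blast
      have gh: "g \<xi> \<in> fdual N.CM" "h \<xi> \<in> fdual N.CM"
        using N.loc_fdual lmod_homD(1)[OF g \<xi>] lmod_homD(1)[OF h \<xi>] by auto
      have diff: "g \<xi> + fscale (-1) (h \<xi>) \<in> fdual N.CM"
        using gh by (intro fun_vs.subspace_add[OF fdual_subspace] fun_vs.subspace_scale[OF fdual_subspace])
      \<comment> \<open>The difference is written with \<open>fscale (-1)\<close> to use linearity of the action in its second argument.\<close>
      have "g \<xi> + fscale (-1) (h \<xi>) = 0"
      proof (rule N.Fil_torsion_free[OF diff I(1)])
        fix a assume a: "a \<in> I"
        interpret reg: kmodule A "reg A" by (rule kmodule_reg) unfold_locales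
        have "a \<in> carrier A" using a I(1) reg.ksubspaceD(1)[OF reg.lsubmoduleD(1), of I] by (auto simp: Fil_def)
        then have ev: "ev_alg C a \<in> carrier (str_alg A C)" by (rule ev_alg_str_alg)
        obtain x where x: "x \<in> carrier M" "ev_alg C a \<star> \<xi> = ev_mod A C M x" using I(2)[OF a] by blast
        have "N.dact (ev_alg C a) (g \<xi>) = g (ev_alg C a \<star> \<xi>)"
          using lmod_homD(3)[OF g ev \<xi>] by simp
        also have "\<dots> = h (ev_alg C a \<star> \<xi>)" using eq x by simp
        also have "\<dots> = N.dact (ev_alg C a) (h \<xi>)"
          using lmod_homD(3)[OF h ev \<xi>] by simp
        finally have e: "N.dact (ev_alg C a) (g \<xi>) = N.dact (ev_alg C a) (h \<xi>)" .
        have "N.dact (ev_alg C a) (g \<xi> + fscale (-1) (h \<xi>)) =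
            N.dact (ev_alg C a) (g \<xi>) + fscale (-1) (N.dact (ev_alg C a) (h \<xi>))"
          using gh fun_vs.subspace_scale[OF fdual_subspace gh(2)]
          by (simp only: N.dact_add_right N.dact_scale_right ev_alg_fdual)
        then show "N.dact (ev_alg C a) (g \<xi> + fscale (-1) (h \<xi>)) = 0"
          unfolding e by (simp add: fun_eq_iff)
      qed
      then show ?case by (simp add: fun_eq_iff)
    next
      case zero
      show ?case
        using kmodule.hom_zero[OF kmodule_loc N.kmodule_loc g]
          kmodule.hom_zero[OF kmodule_loc N.kmodule_loc h] by (simp only: loc_simps)
    next
      case (add \<xi> \<eta>)
      show ?case
        using lmod_homD(2)[OF g add(1,2)] lmod_homD(2)[OF h add(1,2)]
        by (simp only: loc_simps add(3,4))
    next
      case (act f \<xi>)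
      then show ?case using lmod_homD(3)[OF g act(1,2)] lmod_homD(3)[OF h act(1,2)] by simp
    qed
  next
    case False
    then show ?thesis using lmod_homD(4)[OF g] lmod_homD(4)[OF h] by simp
  qed
qed

end

section \<open>Full faithfulness\<close>

lemma hat_map_apply:
  "subcoalgebra A C \<Longrightarrow> hat_map A M M' f C = restrict (cotens_push A C M M' f) (carrier (loc A C M))"
  by (auto simp: hat_map_def cotens_push_def fun_eq_iff restrict_def)

lemma hom_settingI:
  "kmodule A M \<Longrightarrow> kmodule A M' \<Longrightarrow> subcoalgebra A C \<Longrightarrow> f \<in> lmod_hom A M M' \<Longrightarrow> hom_setting A M M' C f"
  by (simp add: hom_setting_def hom_setting_axioms_def kmodule_setting)

lemma hat_map_rc_hom:
  assumes M: "kmodule A M" and M': "kmodule A M'" and f: "f \<in> lmod_hom A M M'"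
  shows "hat_map A M M' f \<in> rc_hom A (hat A M) (hat A M')"
proof -
  have set: "hom_setting A M M' C f" if "subcoalgebra A C" for C using hom_settingI[OF M M' that f] .
  have "hat_map A M M' f \<in> (\<Pi>\<^sub>E D\<in>{D. subcoalgebra A D}. lmod_hom (str_alg A D) (loc A D M) (loc A D M'))"
  proof (rule PiE_I)
    show "hat_map A M M' f D \<in> lmod_hom (str_alg A D) (loc A D M) (loc A D M')"
      if "D \<in> {D. subcoalgebra A D}" for D
      using that hom_setting.push_hom[OF set] by (simp add: hat_map_apply)
    show "hat_map A M M' f D = undefined" if "D \<notin> {D. subcoalgebra A D}" for D
      using that by (simp add: hat_map_def)
  qed
  moreover have "hat_map A M M' f D' (restr (cotens A D' M) \<xi>) =
      restr (cotens A D' M') (hat_map A M M' f D \<xi>)"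
    if D: "subcoalgebra A D" "subcoalgebra A D'" "D' \<subseteq> D" and \<xi>: "\<xi> \<in> carrier (loc A D M)" for D D' \<xi>
  proof -
    have "restr (cotens A D' M) \<xi> \<in> carrier (loc A D' M)"
      using comodule_setting.restr_loc[OF kmodule_setting[OF M D(1)] D(2,3) \<xi>] .
    moreover have "cotens_push A D' M M' f (restr (cotens A D' M) \<xi>) =
        restr (cotens A D' M') (cotens_push A D M M' f \<xi>)"
      using hom_setting.pullback_cotens[OF set[OF D(2)]] cotens_mono[OF D(3), of A M']
      by (auto simp: fun_eq_iff cotens_push_def restr_def)
    ultimately show ?thesis using D \<xi> by (simp add: hat_map_apply)
  qed
  ultimately show ?thesis by (auto simp: rc_hom_def hat_def)
qed

lemma hat_map_inj:
  assumes M: "kmodule A M" and M': "kmodule A M'" and fg: "fin_gen A M'" and RFD: "fully_RFD A"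
  shows "inj_on (hat_map A M M') (lmod_hom A M M')"
proof (rule inj_onI)
  fix f g assume f: "f \<in> lmod_hom A M M'" and g: "g \<in> lmod_hom A M M'"
    and eq: "hat_map A M M' f = hat_map A M M' g"
  let ?C = "findual_alg A"
  have C: "subcoalgebra A ?C" using M subcoalgebra_findual_alg[of A] by (simp add: kmodule_def)
  interpret f: hom_setting A M M' ?C f by (rule hom_settingI[OF M M' C f])
  interpret g: hom_setting A M M' ?C g by (rule hom_settingI[OF M M' C g])
  show "f = g"
  proof
    fix x show "f x = g x"
    proof (cases "x \<in> carrier M")
      case x: True
      have "hat_map A M M' f ?C (ev_mod A ?C M x) = hat_map A M M' g ?C (ev_mod A ?C M x)"
        by (simp add: eq)
      then have "ev_mod A ?C M' (f x) = ev_mod A ?C M' (g x)"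
        using x C f.M1.ev_mod_loc[OF x] f.push_ev[OF x] g.push_ev[OF x] by (simp add: hat_map_apply)
      then show ?thesis using ev_mod_inject[OF M' RFD fg] lmod_homD(1)[OF f x] lmod_homD(1)[OF g x] by blast
    next
      case False
      then show ?thesis using lmod_homD(4)[OF f] lmod_homD(4)[OF g] by simp
    qed
  qed
qed

text \<open>The component of \<open>h\<close> at the whole finite dual maps evaluations to evaluations and so defines \<open>f\<close>.
  Evaluations over a smaller \<open>D\<close> are restrictions of those over the whole finite dual, so
  naturality gives agreement with \<open>hat_map A M M' f\<close> on them, and \<open>loc_hom_unique\<close> everywhere.\<close>

lemma hat_map_surj:
  assumes M: "kmodule A M" and M': "kmodule A M'" and fg: "fin_gen A M'" and RFD: "fully_RFD A"
    and h: "h \<in> rc_hom A (hat A M) (hat A M')"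
  shows "h \<in> hat_map A M M' ` lmod_hom A M M'"
proof -
  let ?C = "findual_alg A"
  have C: "subcoalgebra A ?C" using M subcoalgebra_findual_alg[of A] by (simp add: kmodule_def)
  have hPi: "h \<in> (\<Pi>\<^sub>E D\<in>{D. subcoalgebra A D}. lmod_hom (str_alg A D) (loc A D M) (loc A D M'))"
    using h by (simp add: rc_hom_def hat_def)
  have hD: "h D \<in> lmod_hom (str_alg A D) (loc A D M) (loc A D M')" if "subcoalgebra A D" for D
    using PiE_mem[OF hPi] that by simp
  have nat: "h D (restr (cotens A D M) \<xi>) = restr (cotens A D M') (h ?C \<xi>)"
    if D: "subcoalgebra A D" and \<xi>: "\<xi> \<in> carrier (loc A ?C M)" for D \<xi>
    using h D C \<xi> subcoalgebraD(1)[OF D] by (simp add: rc_hom_def hat_def)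
  interpret s: comodule_setting A M ?C by (rule kmodule_setting[OF M C])
  interpret s': comodule_setting A M' ?C by (rule kmodule_setting[OF M' C])
  have "\<exists>y\<in>carrier M'. h ?C (ev_mod A ?C M x) = ev_mod A ?C M' y" if x: "x \<in> carrier M" for x
    using lmod_homD(1)[OF hD[OF C] s.ev_mod_loc[OF x]] loc_findual_alg[OF M' RFD] by auto
  then obtain f0 where f0: "\<And>x. x \<in> carrier M \<Longrightarrow> f0 x \<in> carrier M'"
    "\<And>x. x \<in> carrier M \<Longrightarrow> h ?C (ev_mod A ?C M x) = ev_mod A ?C M' (f0 x)" by metis
  define f where "f = restrict f0 (carrier M)"
  note inj = ev_mod_inject[OF M' RFD fg]
  have add: "f0 (x \<oplus>\<^bsub>M\<^esub> y) = f0 x \<oplus>\<^bsub>M'\<^esub> f0 y" if x: "x \<in> carrier M" "y \<in> carrier M" for x y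
  proof (rule inj)
    have "ev_mod A ?C M (x \<oplus>\<^bsub>M\<^esub> y) = ev_mod A ?C M x + ev_mod A ?C M y"
      using x by (auto simp: ev_mod_def fun_eq_iff s.mdual_add s.cotens_mdual)
    then have "h ?C (ev_mod A ?C M (x \<oplus>\<^bsub>M\<^esub> y)) = h ?C (ev_mod A ?C M x) + h ?C (ev_mod A ?C M y)"
      using lmod_homD(2)[OF hD[OF C] s.ev_mod_loc[OF x(1)] s.ev_mod_loc[OF x(2)]] by simp
    also have "\<dots> = ev_mod A ?C M' (f0 x \<oplus>\<^bsub>M'\<^esub> f0 y)"
      using x f0 by (auto simp: ev_mod_def fun_eq_iff s'.mdual_add s'.cotens_mdual)
    finally show "ev_mod A ?C M' (f0 (x \<oplus>\<^bsub>M\<^esub> y)) = ev_mod A ?C M' (f0 x \<oplus>\<^bsub>M'\<^esub> f0 y)"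
      using f0(2) x by simp
  qed (use f0 x in auto)
  have act: "f0 (a \<odot>\<^bsub>M\<^esub> x) = a \<odot>\<^bsub>M'\<^esub> f0 x" if x: "x \<in> carrier M" "a \<in> carrier A" for a x
  proof (rule inj)
    have "h ?C (ev_mod A ?C M (a \<odot>\<^bsub>M\<^esub> x)) = h ?C (ev_alg ?C a \<odot>\<^bsub>loc A ?C M\<^esub> ev_mod A ?C M x)"
      using x by (simp add: s.ev_alg_ev_mod)
    also have "\<dots> = ev_alg ?C a \<odot>\<^bsub>loc A ?C M'\<^esub> h ?C (ev_mod A ?C M x)"
      by (rule lmod_homD(3)[OF hD[OF C] s.ev_alg_str_alg[OF x(2)] s.ev_mod_loc[OF x(1)]])
    also have "\<dots> = ev_mod A ?C M' (a \<odot>\<^bsub>M'\<^esub> f0 x)"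
      using x f0 by (simp add: s'.ev_alg_ev_mod)
    finally show "ev_mod A ?C M' (f0 (a \<odot>\<^bsub>M\<^esub> x)) = ev_mod A ?C M' (a \<odot>\<^bsub>M'\<^esub> f0 x)"
      using f0(2) x by (simp add: s.act_closed)
  qed (use f0 x s.act_closed s'.act_closed in auto)
  have f: "f \<in> lmod_hom A M M'"
    using f0(1) add act by (simp add: f_def lmod_hom_def s.act_closed)
  have "h = hat_map A M M' f"
  proof
    fix D show "h D = hat_map A M M' f D"
    proof (cases "subcoalgebra A D")
      case D: True
      interpret d: hom_setting A M M' D f by (rule hom_settingI[OF M M' D f])
      have hat: "hat_map A M M' f D \<in> lmod_hom (str_alg A D) (loc A D M) (loc A D M')"
        using d.push_hom by (simp add: hat_map_apply[OF D])
      note ev = restr_ev_mod[OF subcoalgebraD(1)[OF D]]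
      show ?thesis
      proof (rule d.M1.loc_hom_unique[OF d.M2.comodule_setting_axioms hD[OF D] hat])
        fix x assume x: "x \<in> carrier M"
        have "h D (ev_mod A D M x) = restr (cotens A D M') (h ?C (ev_mod A ?C M x))"
          using nat[OF D s.ev_mod_loc[OF x]] by (simp add: ev)
        also have "\<dots> = ev_mod A D M' (f x)" using f0(2) x by (simp add: ev f_def)
        also have "\<dots> = hat_map A M M' f D (ev_mod A D M x)"
          using x d.M1.ev_mod_loc[OF x] d.push_ev[OF x] by (simp add: hat_map_apply[OF D])
        finally show "h D (ev_mod A D M x) = hat_map A M M' f D (ev_mod A D M x)" .
      qed
    next
      case False
      then show ?thesis using PiE_arb[OF hPi] by (simp add: hat_map_def)
    qed
  qed
  then show ?thesis using f by blast
qed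

theorem corollary5p10:
  fixes A :: "('k::field, 'a) module"
    and M1 :: "('a, 'm) module" and M2 :: "('a, 'n) module"
  assumes "kalgebra A" and "fully_RFD A"
    and "left_module A M1" and "fin_gen A M1"
    and "left_module A M2" and "fin_gen A M2"
  shows "rc_module A (hat A M1) \<and> rc_module A (hat A M2) \<and>
    bij_betw (hat_map A M1 M2) (lmod_hom A M1 M2) (rc_hom A (hat A M1) (hat A M2)) \<and>
    (hat A M1 \<in> Mod_B A \<and> hat A M2 \<in> Mod_B A \<longrightarrow>
       bij_betw (hat_map A M1 M2) (lmod_hom A M1 M2) (Mod_B_hom A (hat A M1) (hat A M2)))"
proof -
  have M: "kmodule A M1" "kmodule A M2" using assms by (simp_all add: kmodule_def)
  have bij: "bij_betw (hat_map A M1 M2) (lmod_hom A M1 M2) (rc_hom A (hat A M1) (hat A M2))"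
    unfolding bij_betw_def
    using hat_map_inj[OF M assms(6,2)] hat_map_rc_hom[OF M] hat_map_surj[OF M assms(6,2)] by blast
  then show ?thesis using rc_module_hat[OF M(1)] rc_module_hat[OF M(2)] by (simp add: Mod_B_hom_def)
qed

end
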